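(* Let $(a,b)$ be a bounded interval, let $d\nu$ be a finite real signed Borel measure on $(a,b)$ which is singular with respect to Lebesgue measure, let $q\in L^1(a,b)$ be real-valued, and let $dP=dx+d\nu$. Then the Dirichlet operator $\mathrm{H}_{\mathrm{D}}$ in $L^2(a,b)$ associated with $\tau=-\frac{d}{dx}\frac{d}{dP(x)}+q(x)$ has purely discrete spectrum and its eigenvalues satisfy $$N(t)=\begin{cases}\frac{b-a}{\pi}\sqrt{t}+o(\sqrt{t}), & t\to+\infty,\\ o(\sqrt{|t|}), & t\to-\infty,\end{cases}$$ where $N(t)$ denotes the number of eigenvalues of $\mathrm{H}_{\mathrm{D}}$ between zero and $t$.
   Context: A function $f$ is locally absolutely continuous with respect to $dP$ if it is locally of bounded variation and its Borel measure satisfies $df=f^{[1]}\,dP$ for some $f^{[1]}\in L^1_{\mathrm{loc}}((a,b);dP)$ (the quasi-derivative; left-continuous representatives of $f$ are used). The self-adjoint operator $\mathrm{H}_{\mathrm{D}}$ is $\mathrm{H}_{\mathrm{D}}f=\tau f=-(f^{[1]})'+qf$ on all $f\in L^2(a,b)$ such that $f$ is locally absolutely continuous with respect to $dP$, $f^{[1]}\in AC_{\mathrm{loc}}(a,b)$ (with respect to Lebesgue measure), $\tau f\in L^2(a,b)$ and $f(a)=f(b)=0$ (boundary values as limits). *)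

theory Defs
  imports "HOL-Analysis.Analysis" "HOL-Library.Landau_Symbols"
begin

section \<open>Finite signed measures\<close>

text \<open>A finite signed measure is a real-valued countably additive set function on the
  sigma-algebra of \<open>M\<close>; the measure carried by \<open>M\<close> itself plays no role here.\<close>

definition finite_signed_measure :: "'a measure \<Rightarrow> ('a set \<Rightarrow> real) \<Rightarrow> bool" where
  "finite_signed_measure M \<mu> \<longleftrightarrow>
     \<mu> {} = 0 \<and>
     (\<forall>A :: nat \<Rightarrow> 'a set. range A \<subseteq> sets M \<longrightarrow> disjoint_family A \<longrightarrow>
        (\<lambda>n. \<mu> (A n)) sums \<mu> (\<Union>n. A n))"

definition borel_of :: "real \<Rightarrow> real \<Rightarrow> real measure" where
  "borel_of a b = restrict_space borel {a<..<b}"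

text \<open>\<open>\<mu>\<close> is carried by a Lebesgue null set: all Borel subsets of its complement have
  \<open>\<mu>\<close>-measure zero, that is, the total variation of the complement is zero.\<close>

definition lebesgue_singular :: "real \<Rightarrow> real \<Rightarrow> (real set \<Rightarrow> real) \<Rightarrow> bool" where
  "lebesgue_singular a b \<mu> \<longleftrightarrow>
     (\<exists>N \<in> sets (borel_of a b). N \<in> null_sets lborel \<and>
        (\<forall>B \<in> sets (borel_of a b). B \<inter> N = {} \<longrightarrow> \<mu> B = 0))"

text \<open>The positive variation \<open>\<mu>\<^sup>+(A) = sup {\<mu>(B). B \<subseteq> A}\<close>; the supremum in \<open>ennreal\<close> may ignore
  negative values because of \<open>B = {}\<close>. The pair \<open>\<mu>\<^sup>+\<close>, \<open>\<mu>\<^sup>- = (- \<mu>)\<^sup>+\<close> is the Jordan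
  decomposition, and being integrable for both means being integrable for
  \<open>\<bar>\<mu>\<bar> = \<mu>\<^sup>+ + \<mu>\<^sup>-\<close>.\<close>

definition pos_variation :: "'a measure \<Rightarrow> ('a set \<Rightarrow> real) \<Rightarrow> 'a measure" where
  "pos_variation M \<mu> =
     measure_of (space M) (sets M) (\<lambda>A. SUP B \<in> {B \<in> sets M. B \<subseteq> A}. ennreal (\<mu> B))"

definition neg_variation :: "'a measure \<Rightarrow> ('a set \<Rightarrow> real) \<Rightarrow> 'a measure" where
  "neg_variation M \<mu> = pos_variation M (\<lambda>A. - \<mu> A)"

definition signed_set_integrable ::
    "'a measure \<Rightarrow> ('a set \<Rightarrow> real) \<Rightarrow> 'a set \<Rightarrow> ('a \<Rightarrow> complex) \<Rightarrow> bool" where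
  "signed_set_integrable M \<mu> A g \<longleftrightarrow>
     set_integrable (pos_variation M \<mu>) A g \<and> set_integrable (neg_variation M \<mu>) A g"

definition signed_set_integral ::
    "'a measure \<Rightarrow> ('a set \<Rightarrow> real) \<Rightarrow> 'a set \<Rightarrow> ('a \<Rightarrow> complex) \<Rightarrow> complex" where
  "signed_set_integral M \<mu> A g =
     set_lebesgue_integral (pos_variation M \<mu>) A g -
     set_lebesgue_integral (neg_variation M \<mu>) A g"

section \<open>Local absolute continuity with respect to a signed measure\<close>

definition bounded_variation_on :: "(real \<Rightarrow> complex) \<Rightarrow> real \<Rightarrow> real \<Rightarrow> bool" where
  "bounded_variation_on f c d \<longleftrightarrow>
     (\<exists>V. \<forall>n (x :: nat \<Rightarrow> real).
        (\<forall>i\<le>n. x i \<in> {c..d}) \<longrightarrow> (\<forall>i<n. x i \<le> x (Suc i)) \<longrightarrow>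
        (\<Sum>i<n. cmod (f (x (Suc i)) - f (x i))) \<le> V)"

text \<open>The left-continuous function \<open>f\<close> is locally absolutely continuous on \<open>(a,b)\<close> with respect
  to \<open>d\<mu>\<close>, with density \<open>g\<close>: \<open>f\<close> is locally of bounded variation, \<open>g\<close> is locally integrable,
  and \<open>df = g d\<mu>\<close>. For left-continuous \<open>f\<close> the Borel measure \<open>df\<close> is the one given by
  \<open>df([c,d)) = f(d) - f(c)\<close>. For the Lebesgue measure this is the usual local absolute
  continuity, with \<open>g\<close> the derivative of \<open>f\<close>.\<close>

definition loc_abs_cont ::
    "real \<Rightarrow> real \<Rightarrow> (real set \<Rightarrow> real) \<Rightarrow> (real \<Rightarrow> complex) \<Rightarrow> (real \<Rightarrow> complex) \<Rightarrow> bool" where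
  "loc_abs_cont a b \<mu> f g \<longleftrightarrow>
     (\<forall>x \<in> {a<..<b}. continuous (at_left x) f) \<and>
     (\<forall>c d. a < c \<and> c \<le> d \<and> d < b \<longrightarrow>
        bounded_variation_on f c d \<and>
        signed_set_integrable (borel_of a b) \<mu> {c..d} g \<and>
        f d - f c = signed_set_integral (borel_of a b) \<mu> {c..<d} g)"

section \<open>The Hilbert space and operators in it\<close>

text \<open>Elements of \<open>L\<^sup>2\<close> are given by representatives, and equality in \<open>L\<^sup>2\<close> is equality almost
  everywhere. An operator is given by its graph, a set of pairs of representatives which is
  closed under almost everywhere equality in both components.\<close>

definition L2 :: "'a measure \<Rightarrow> ('a \<Rightarrow> complex) set" where
  "L2 M = {f \<in> borel_measurable M. integrable M (\<lambda>x. (cmod (f x))\<^sup>2)}"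

definition L2_norm :: "'a measure \<Rightarrow> ('a \<Rightarrow> complex) \<Rightarrow> real" where
  "L2_norm M f = sqrt (\<integral>x. (cmod (f x))\<^sup>2 \<partial>M)"

type_synonym 'a graph = "(('a \<Rightarrow> complex) \<times> ('a \<Rightarrow> complex)) set"

definition eigenspace :: "'a graph \<Rightarrow> complex \<Rightarrow> ('a \<Rightarrow> complex) set" where
  "eigenspace T z = {f. (f, \<lambda>x. z * f x) \<in> T}"

definition eigenvalue :: "'a measure \<Rightarrow> 'a graph \<Rightarrow> complex \<Rightarrow> bool" where
  "eigenvalue M T z \<longleftrightarrow> (\<exists>f \<in> eigenspace T z. \<not> (AE x in M. f x = 0))"

definition finite_multiplicity :: "'a measure \<Rightarrow> 'a graph \<Rightarrow> complex \<Rightarrow> bool" where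
  "finite_multiplicity M T z \<longleftrightarrow>
     (\<exists>B. finite B \<and> B \<subseteq> eigenspace T z \<and>
        (\<forall>f \<in> eigenspace T z. \<exists>c. AE x in M. f x = (\<Sum>e\<in>B. c e * e x)))"

text \<open>\<open>z\<close> is in the resolvent set iff \<open>T - z\<close> is injective, onto \<open>L\<^sup>2\<close>, and has a bounded
  inverse.\<close>

definition resolvent_set :: "'a measure \<Rightarrow> 'a graph \<Rightarrow> complex set" where
  "resolvent_set M T = {z.
     \<not> eigenvalue M T z \<and>
     (\<forall>g \<in> L2 M. \<exists>(f, h) \<in> T. AE x in M. h x - z * f x = g x) \<and>
     (\<exists>C. \<forall>(f, h) \<in> T. L2_norm M f \<le> C * L2_norm M (\<lambda>x. h x - z * f x))}"

definition op_spectrum :: "'a measure \<Rightarrow> 'a graph \<Rightarrow> complex set" where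
  "op_spectrum M T = - resolvent_set M T"

definition purely_discrete_spectrum :: "'a measure \<Rightarrow> 'a graph \<Rightarrow> bool" where
  "purely_discrete_spectrum M T \<longleftrightarrow>
     (\<forall>z \<in> op_spectrum M T.
        z isolated_in op_spectrum M T \<and> eigenvalue M T z \<and> finite_multiplicity M T z)"

section \<open>The Dirichlet operator\<close>

abbreviation leb_on :: "real \<Rightarrow> real \<Rightarrow> real measure" where
  "leb_on a b \<equiv> lebesgue_on {a<..<b}"

text \<open>Here \<open>u\<close> is the left-continuous representative of \<open>f\<close>, \<open>v\<close> the quasi-derivative \<open>u\<^bsup>[1]\<^esup>\<close>,
  \<open>w\<close> the derivative of \<open>v\<close>, and \<open>g = \<tau> f = - w + q u\<close>.\<close>

definition dirichlet_operator ::
    "real \<Rightarrow> real \<Rightarrow> (real set \<Rightarrow> real) \<Rightarrow> (real \<Rightarrow> real) \<Rightarrow> real graph" where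
  "dirichlet_operator a b P q =
     {(f, g). f \<in> L2 (leb_on a b) \<and> g \<in> L2 (leb_on a b) \<and>
        (\<exists>u v w.
           (AE x in leb_on a b. f x = u x) \<and>
           loc_abs_cont a b P u v \<and>
           loc_abs_cont a b (measure lborel) v w \<and>
           (AE x in leb_on a b. g x = - w x + complex_of_real (q x) * u x) \<and>
           (u \<longlongrightarrow> 0) (at_right a) \<and> (u \<longlongrightarrow> 0) (at_left b))}"

text \<open>Both endpoints are included, which does not affect the asymptotics, and eigenvalues are
  not repeated according to multiplicity: the eigenvalues of the Dirichlet operator are simple. Since \<open>card\<close> is \<open>0\<close> on infinite sets, the
  count is meaningful only together with finiteness of \<open>eigenvalues_between\<close>.\<close>

definition eigenvalues_between :: "'a measure \<Rightarrow> 'a graph \<Rightarrow> real \<Rightarrow> real set" where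
  "eigenvalues_between M T t =
     {s \<in> closed_segment 0 t. eigenvalue M T (complex_of_real s)}"

definition eigenvalue_count :: "'a measure \<Rightarrow> 'a graph \<Rightarrow> real \<Rightarrow> nat" where
  "eigenvalue_count M T t = card (eigenvalues_between M T t)"

end

theory Submission
  imports Defs
begin

text \<open>Let \<open>F x = P ((a,x))\<close>. Integration by parts turns \<open>du = v dP\<close>, \<open>dv = (q - z) u dx\<close> into an
  ordinary system with integrable coefficients for \<open>v\<close> and \<open>\<omega> = u - F v\<close>, namely
  \<open>v' = (q - z) u\<close>, \<open>\<omega>' = - F v'\<close>, in which \<open>P\<close> enters only through the bounded function \<open>F\<close>. The
  eigenvalues are the zeros of \<open>z \<mapsto> u(b, z)\<close> for the solution with \<open>\<omega>(a) = 0\<close>, \<open>v(a) = 1\<close>, and by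
  the Lagrange identity they are real and isolated.

  For real \<open>z\<close> let \<open>\<theta>(x, z)\<close> be the angle of the planar path \<open>(v, \<omega>)\<close>. The Lagrange identity
  shows that \<open>\<theta>(b, \<cdot>)\<close> is strictly increasing, and the eigenvalues are the parameters where it
  meets a fixed residue class modulo \<open>\<pi>\<close>; hence the number of eigenvalues between \<open>0\<close> and \<open>t\<close> is
  \<open>\<bar>\<theta>(b, t) - \<theta>(b, 0)\<bar> / \<pi>\<close> up to an error of at most \<open>1\<close>. Put \<open>\<bar>t\<bar> = k\<^sup>2\<close>. On an interval where
  \<open>F(x) - x\<close> is within \<open>\<eta>\<close> of a constant, the rotation agrees up to \<open>2 \<pi>\<close> with that of a path in
  a sheared and rescaled frame. If \<open>k \<eta> \<le> \<delta>\<close> is small, that path rotates at rate \<open>k + O(\<delta> k)\<close> for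
  \<open>t > 0\<close> and by a bounded amount for \<open>t < 0\<close>; if \<open>\<eta> \<le> L / k\<close>, its rate is \<open>O(L k)\<close>. Since \<open>\<nu>\<close> is
  singular, finitely many intervals of small total length carry almost all of \<open>\<bar>\<nu>\<bar>\<close>; the coarse
  estimate is used on them and the fine one on the rest. An interval of mass \<open>m\<close> needs about
  \<open>m / \<eta>\<close> pieces, which makes the number of pieces \<open>o(k)\<close>.\<close>

section \<open>Functions with an integrable derivative\<close>

text \<open>As \<open>\<nu>\<close> is signed, \<open>P\<close> need not be monotone: the operator
  need not be bounded below and comparison arguments in \<open>P\<close> fail, so angles have to
  serve for both signs of \<open>t\<close>. As \<open>\<nu>\<close> may have atoms, \<open>u\<close>
  jumps and \<open>(v, u)\<close> is no continuous path; \<open>\<omega>\<close> is \<open>u\<close>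
  without these jumps. The frames come from the model \<open>F(x) = x + const\<close>,
  \<open>q = 0\<close>, in which \<open>(v, k u)\<close> rotates at rate exactly \<open>k\<close>. A
  change of frame costs at most \<open>2 \<pi>\<close> whatever its shear and scale, so the price of
  cutting is a multiple of the number of pieces. Small oscillation is asked for only inside a piece;
  large jumps of \<open>F\<close> go to end points. The fine estimate alone would need about
  \<open>|\<nu>| k / \<delta>\<close> pieces. The coarse one needs only
  \<open>|\<nu>| k / L\<close>, small against \<open>k\<close> for large \<open>L\<close>, at a rate
  \<open>O(L k)\<close> that is affordable on a set of small length; hence \<open>L\<close> is fixed
  before the size of the exceptional set. For \<open>t < 0\<close> a lower bound of the angle is
  enough, as monotonicity in \<open>t\<close> bounds it above; near multiples of
  \<open>\<pi>\<close> the model angle moves upwards, which stops a long descent.\<close>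

definition ac_deriv :: "real \<Rightarrow> real \<Rightarrow> (real \<Rightarrow> 'e::euclidean_space) \<Rightarrow> (real \<Rightarrow> 'e) \<Rightarrow> bool" where
  "ac_deriv a b F f \<longleftrightarrow>
     f absolutely_integrable_on {a..b} \<and> (\<forall>x\<in>{a..b}. F x = F a + integral {a..x} f)"

lemma ac_derivD:
  assumes "ac_deriv a b F f"
  shows "f absolutely_integrable_on {a..b}" "\<And>x. x \<in> {a..b} \<Longrightarrow> F x = F a + integral {a..x} f"
  using assms unfolding ac_deriv_def by blast+

lemma abs_int_sub:
  fixes f :: "real \<Rightarrow> 'e::euclidean_space"
  assumes "f absolutely_integrable_on {a..b}" "a \<le> c" "d \<le> b"
  shows "f absolutely_integrable_on {c..d}" "f integrable_on {c..d}"
proof -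
  show *: "f absolutely_integrable_on {c..d}"
    by (rule absolutely_integrable_on_subinterval[OF assms(1)]) (use assms in auto)
  show "f integrable_on {c..d}"
    using * by (simp add: absolutely_integrable_on_def)
qed

lemma abs_int_integral_diff:
  fixes f :: "real \<Rightarrow> 'e::euclidean_space"
  assumes "f absolutely_integrable_on {a..b}" "a \<le> x" "x \<le> y" "y \<le> b"
  shows "integral {a..y} f - integral {a..x} f = integral {x..y} f"
proof -
  have "integral {a..x} f + integral {x..y} f = integral {a..y} f"
    by (rule Henstock_Kurzweil_Integration.integral_combine) (use assms abs_int_sub[OF assms(1), of a y] in auto)
  then show ?thesis by (simp add: algebra_simps)
qed

lemma ac_diff:
  assumes "ac_deriv a b F f" "a \<le> x" "x \<le> y" "y \<le> b"
  shows "F y - F x = integral {x..y} f"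
  using abs_int_integral_diff[OF ac_derivD(1)[OF assms(1)] assms(2-4)]
    ac_derivD(2)[OF assms(1), of x] ac_derivD(2)[OF assms(1), of y] assms by auto

lemma ac_sub:
  assumes "ac_deriv a b F f" "a \<le> c" "d \<le> b"
  shows "ac_deriv c d F f"
  unfolding ac_deriv_def
proof (intro conjI ballI)
  show "f absolutely_integrable_on {c..d}"
    using abs_int_sub[OF ac_derivD(1)[OF assms(1)] assms(2,3)] by simp
  fix x assume "x \<in> {c..d}"
  then have "F x - F c = integral {c..x} f"
    by (intro ac_diff[OF assms(1)]) (use assms in auto)
  then show "F x = F c + integral {c..x} f" by (simp add: algebra_simps)
qed

lemma abs_int_indefinite_continuous:
  fixes f :: "real \<Rightarrow> 'e::euclidean_space"
  assumes "f absolutely_integrable_on {a..b}"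
  shows "continuous_on {a..b} (\<lambda>x. integral {a..x} f)"
  using assms by (intro indefinite_integral_continuous_1) (simp add: absolutely_integrable_on_def)

lemma ac_continuous:
  assumes "ac_deriv a b F f"
  shows "continuous_on {a..b} F"
proof -
  have "continuous_on {a..b} (\<lambda>x. F a + integral {a..x} f)"
    by (intro continuous_intros abs_int_indefinite_continuous ac_derivD(1)[OF assms])
  then show ?thesis
    by (rule continuous_on_eq) (rule ac_derivD(2)[OF assms, symmetric])
qed

lemma ac_integral:
  fixes f :: "real \<Rightarrow> 'e::euclidean_space"
  assumes "f absolutely_integrable_on {a..b}"
  shows "ac_deriv a b (\<lambda>x. C + integral {a..x} f) f"
  using assms by (auto simp: ac_deriv_def)

lemma ac_cong:
  assumes "ac_deriv a b F f" "\<And>x. x \<in> {a..b} \<Longrightarrow> F x = G x" "\<And>x. x \<in> {a..b} \<Longrightarrow> f x = g x"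
  shows "ac_deriv a b G g"
proof (cases "a \<le> b")
  case True
  have "g absolutely_integrable_on {a..b}"
    using ac_derivD(1)[OF assms(1)] assms(3) by (metis (mono_tags, lifting) set_integrable_cong)
  moreover have "G x = G a + integral {a..x} g" if "x \<in> {a..b}" for x
  proof -
    have "integral {a..x} g = integral {a..x} f"
      by (rule integral_cong) (use assms(3) that in auto)
    then show ?thesis using ac_derivD(2)[OF assms(1) that] assms(2)[OF that] assms(2)[of a] True by simp
  qed
  ultimately show ?thesis unfolding ac_deriv_def by blast
qed (auto simp: ac_deriv_def)

lemma ac_add:
  assumes "ac_deriv a b F f" "ac_deriv a b G g"
  shows "ac_deriv a b (\<lambda>x. F x + G x) (\<lambda>x. f x + g x)"
  unfolding ac_deriv_def
proof (intro conjI ballI)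
  note i = ac_derivD(1)[OF assms(1)] ac_derivD(1)[OF assms(2)]
  show "(\<lambda>x. f x + g x) absolutely_integrable_on {a..b}" using i by (rule set_integral_add(1))
  fix x assume x: "x \<in> {a..b}"
  have "integral {a..x} (\<lambda>x. f x + g x) = integral {a..x} f + integral {a..x} g"
    by (rule integral_add) (use abs_int_sub(2)[OF i(1), of a x] abs_int_sub(2)[OF i(2), of a x] x in auto)
  then show "F x + G x = F a + G a + integral {a..x} (\<lambda>x. f x + g x)"
    using ac_derivD(2)[OF assms(1) x] ac_derivD(2)[OF assms(2) x] by simp
qed

lemma ac_linear:
  fixes h :: "'e::euclidean_space \<Rightarrow> 'f::euclidean_space"
  assumes "ac_deriv a b F f" "bounded_linear h"
  shows "ac_deriv a b (\<lambda>x. h (F x)) (\<lambda>x. h (f x))"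
  unfolding ac_deriv_def
proof (intro conjI ballI)
  note i = ac_derivD(1)[OF assms(1)]
  show "(\<lambda>x. h (f x)) absolutely_integrable_on {a..b}"
    using absolutely_integrable_linear[OF i assms(2)] by (simp add: o_def)
  fix x assume x: "x \<in> {a..b}"
  have "integral {a..x} (h \<circ> f) = h (integral {a..x} f)"
    by (rule integral_linear) (use abs_int_sub(2)[OF i, of a x] x assms in auto)
  then show "h (F x) = h (F a) + integral {a..x} (\<lambda>x. h (f x))"
    using ac_derivD(2)[OF assms(1) x] assms(2)
    by (simp add: o_def linear_simps)
qed

lemma ac_const: "ac_deriv a b (\<lambda>x. C) (\<lambda>x. 0)"
  by (auto simp: ac_deriv_def set_integrable_def)

lemma ac_diff_fun:
  assumes "ac_deriv a b F f" "ac_deriv a b G g"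
  shows "ac_deriv a b (\<lambda>x. F x - G x) (\<lambda>x. f x - g x)"
  using ac_add[OF assms(1) ac_linear[OF assms(2), of uminus]] 
  by (simp add: bounded_linear_minus bounded_linear_ident)

lemma ac_mult_left:
  fixes F :: "real \<Rightarrow> 'e::{real_normed_field, euclidean_space}"
  assumes "ac_deriv a b F f"
  shows "ac_deriv a b (\<lambda>x. c * F x) (\<lambda>x. c * f x)"
  by (rule ac_linear[OF assms]) (rule bounded_linear_mult_right)

text \<open>Along a uniform partition of mesh at most \<open>d\<close> the bounds telescope to
  \<open>e * (K b - K a)\<close>. The control \<open>K\<close> is allowed to jump: later it is a
  distribution function, so that the same criterion also yields integration by parts against a
  measure with atoms.\<close>

lemma const_if_small_increments:
  fixes \<Phi> :: "real \<Rightarrow> 'e::real_normed_vector" and K :: "real \<Rightarrow> real"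
  assumes "a \<le> b"
    and small: "\<And>e. e > 0 \<Longrightarrow> \<exists>d>0. \<forall>x y. a \<le> x \<and> x \<le> y \<and> y \<le> b \<and> y - x \<le> d
       \<longrightarrow> norm (\<Phi> y - \<Phi> x) \<le> e * (K y - K x)"
  shows "\<Phi> b = \<Phi> a"
proof -
  have bound: "norm (\<Phi> b - \<Phi> a) \<le> e * (K b - K a)" if "e > 0" for e
  proof -
    obtain d where d: "d > 0" "\<And>x y. a \<le> x \<Longrightarrow> x \<le> y \<Longrightarrow> y \<le> b \<Longrightarrow> y - x \<le> d
       \<Longrightarrow> norm (\<Phi> y - \<Phi> x) \<le> e * (K y - K x)" using small[OF \<open>e > 0\<close>] by blast
    obtain n :: nat where n: "n > 0" "(b - a) / n \<le> d"
    proof -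
      obtain m :: nat where "(b - a) / d < real m" using reals_Archimedean2 by blast
      then have "(b - a) / real (Suc m) \<le> d" using d(1) assms(1) by (simp add: field_simps)
      then show ?thesis using that[of "Suc m"] by simp
    qed
    define y where "y i = a + real i * ((b - a) / n)" for i :: nat
    have yn: "y n = b" "y 0 = a" using n by (auto simp: y_def)
    have ystep: "y (Suc i) - y i = (b - a) / n" for i by (simp add: y_def algebra_simps add_divide_distrib diff_divide_distrib)
    have ymono: "y i \<le> y j" if "i \<le> j" for i j
      using that assms(1) unfolding y_def by (intro add_left_mono mult_right_mono) auto
    have "norm (\<Phi> (y m) - \<Phi> (y 0)) \<le> e * (K (y m) - K (y 0))" if "m \<le> n" for m
      using that
    proof (induction m)
      case (Suc m)
      have "norm (\<Phi> (y (Suc m)) - \<Phi> (y m)) \<le> e * (K (y (Suc m)) - K (y m))"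
      proof (rule d(2))
        show "a \<le> y m" using ymono[of 0 m] yn by simp
        show "y m \<le> y (Suc m)" using ymono[of m "Suc m"] by simp
        show "y (Suc m) \<le> b" using ymono[of "Suc m" n] yn Suc by simp
        show "y (Suc m) - y m \<le> d" using ystep n by simp
      qed
      moreover have "norm (\<Phi> (y (Suc m)) - \<Phi> (y 0))
          \<le> norm (\<Phi> (y (Suc m)) - \<Phi> (y m)) + norm (\<Phi> (y m) - \<Phi> (y 0))"
        by (metis norm_triangle_ineq diff_add_cancel add_diff_eq)
      ultimately show ?case using Suc by (simp add: algebra_simps)
    qed simp
    from this[of n] show ?thesis using yn by simp
  qed
  have "norm (\<Phi> b - \<Phi> a) \<le> 0 + e" if "e > 0" for e
  proof -
    \<comment> \<open>The added 1 keeps the divisor positive when \<open>K b = K a\<close>.\<close>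
    define k where "k = \<bar>K b - K a\<bar> + 1"
    have k: "k > 0" "K b - K a \<le> k" by (auto simp: k_def)
    have "norm (\<Phi> b - \<Phi> a) \<le> e / k * (K b - K a)"
      using bound[of "e / k"] that k by simp
    also have "\<dots> \<le> e / k * k" using k that by (intro mult_left_mono) auto
    finally show ?thesis using k by simp
  qed
  then have "norm (\<Phi> b - \<Phi> a) \<le> 0" by (rule field_le_epsilon)
  then show ?thesis by simp
qed

lemma abs_int_continuous_mult:
  fixes F f :: "real \<Rightarrow> 'e::{real_normed_field, euclidean_space}"
  assumes "f absolutely_integrable_on {a..b}" "continuous_on {a..b} F"
  shows "(\<lambda>x. F x * f x) absolutely_integrable_on {a..b}"
proof (rule absolutely_integrable_bounded_measurable_product[OF bilinear_times])
  show "F \<in> borel_measurable (lebesgue_on {a..b})"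
    by (rule continuous_imp_measurable_on_sets_lebesgue[OF assms(2)]) auto
  show "bounded (F ` {a..b})"
    by (rule compact_imp_bounded) (use assms(2) in \<open>auto intro: compact_continuous_image\<close>)
qed (use assms in auto)

lemma uniform_modulus:
  fixes F :: "real \<Rightarrow> 'e::metric_space"
  assumes "continuous_on {a..b} F" "e > 0"
  obtains d where "d > 0" "\<And>x y. x \<in> {a..b} \<Longrightarrow> y \<in> {a..b} \<Longrightarrow> \<bar>y - x\<bar> \<le> d \<Longrightarrow> dist (F y) (F x) \<le> e"
proof -
  have "uniformly_continuous_on {a..b} F"
    by (rule compact_uniformly_continuous[OF assms(1)]) auto
  then obtain d where "d > 0" "\<And>x y. x \<in> {a..b} \<Longrightarrow> y \<in> {a..b} \<Longrightarrow> dist y x < d \<Longrightarrow> dist (F y) (F x) < e"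
    using assms(2) unfolding uniformly_continuous_on_def by meson
  then show ?thesis by (intro that[of "d/2"]) (simp, force simp: dist_real_def intro: less_imp_le)
qed

text \<open>The constancy criterion is applied to \<open>F\<close> minus the indefinite integral of
  \<open>f\<close>. The product rule, the chain rule and hence the exponential weights all come from
  this form.\<close>

lemma ac_if_small_increments:
  fixes F :: "real \<Rightarrow> 'e::euclidean_space"
  assumes f: "f absolutely_integrable_on {a..b}" 
    and small: "\<And>e. e > 0 \<Longrightarrow> \<exists>d>0. \<forall>x y. a \<le> x \<and> x \<le> y \<and> y \<le> b \<and> y - x \<le> d
       \<longrightarrow> norm (F y - F x - integral {x..y} f) \<le> e * (K y - K x)"
  shows "ac_deriv a b F f"
  unfolding ac_deriv_def
proof (intro conjI ballI f)
  fix x assume x: "x \<in> {a..b}"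
  have "F x - integral {a..x} f = F a - integral {a..a} f"
  proof (rule const_if_small_increments[where K = K])
    fix e :: real assume "e > 0"
    from small[OF this] obtain d where d: "d > 0" "\<And>x y. a \<le> x \<and> x \<le> y \<and> y \<le> b \<and> y - x \<le> d
       \<Longrightarrow> norm (F y - F x - integral {x..y} f) \<le> e * (K y - K x)" by blast
    have "norm ((F u - integral {a..u} f) - (F t - integral {a..t} f)) \<le> e * (K u - K t)"
      if "a \<le> t \<and> t \<le> u \<and> u \<le> x \<and> u - t \<le> d" for t u
      using d(2)[of t u] abs_int_integral_diff[OF f, of t u] that x by (simp add: algebra_simps)
    then show "\<exists>d>0. \<forall>t u. a \<le> t \<and> t \<le> u \<and> u \<le> x \<and> u - t \<le> d \<longrightarrow>
       norm ((F u - integral {a..u} f) - (F t - integral {a..t} f)) \<le> e * (K u - K t)"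
      using d(1) by blast
  qed (use x in auto)
  then show "F x = F a + integral {a..x} f" by (simp add: algebra_simps)
qed

lemma ac_mult:
  fixes F G :: "real \<Rightarrow> 'e::{real_normed_field, euclidean_space}"
  assumes F: "ac_deriv a b F f" and G: "ac_deriv a b G g"
  shows "ac_deriv a b (\<lambda>x. F x * G x) (\<lambda>x. f x * G x + F x * g x)"
proof (rule ac_if_small_increments)
  note fi = ac_derivD(1)[OF F] and gi = ac_derivD(1)[OF G]
  note Fc = ac_continuous[OF F] and Gc = ac_continuous[OF G]
  have fG: "(\<lambda>x. f x * G x) absolutely_integrable_on {a..b}"
    using abs_int_continuous_mult[OF fi Gc] by (simp add: mult.commute)
  have Fg: "(\<lambda>x. F x * g x) absolutely_integrable_on {a..b}"
    using abs_int_continuous_mult[OF gi Fc] .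
  show "(\<lambda>x. f x * G x + F x * g x) absolutely_integrable_on {a..b}"
    using fG Fg by (rule set_integral_add(1))
  define K where "K x = integral {a..x} (\<lambda>s. norm (f s)) + integral {a..x} (\<lambda>s. norm (g s))" for x
  have nfi: "(\<lambda>s. norm (f s)) absolutely_integrable_on {a..b}" "(\<lambda>s. norm (g s)) absolutely_integrable_on {a..b}"
    using fi gi by (auto intro: absolutely_integrable_norm[unfolded o_def])
  fix e :: real assume e: "e > 0"
  obtain d1 where d1: "d1 > 0" "\<And>x y. x \<in> {a..b} \<Longrightarrow> y \<in> {a..b} \<Longrightarrow> \<bar>y - x\<bar> \<le> d1 \<Longrightarrow> dist (F y) (F x) \<le> e"
    using uniform_modulus[OF Fc e] by blast
  obtain d2 where d2: "d2 > 0" "\<And>x y. x \<in> {a..b} \<Longrightarrow> y \<in> {a..b} \<Longrightarrow> \<bar>y - x\<bar> \<le> d2 \<Longrightarrow> dist (G y) (G x) \<le> e"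
    using uniform_modulus[OF Gc e] by blast
  have "norm (F y * G y - F x * G x - integral {x..y} (\<lambda>x. f x * G x + F x * g x)) \<le> e * (K y - K x)"
    if xy: "a \<le> x" "x \<le> y" "y \<le> b" "y - x \<le> min d1 d2" for x y
  proof -
    note sub = abs_int_sub(2)[OF _ xy(1) xy(3)]
    \<comment> \<open>Freezing \<open>G\<close> at the right and \<open>F\<close> at the left end
      point makes the increment of the product exact; what remains is the oscillation of
      \<open>F\<close> and \<open>G\<close> on \<open>[x,y]\<close>, at most
      \<open>e\<close>.\<close>
    have eq: "F y * G y - F x * G x - integral {x..y} (\<lambda>x. f x * G x + F x * g x)
      = integral {x..y} (\<lambda>s. f s * (G y - G s) + (F x - F s) * g s)"
    proof -
      have "F y * G y - F x * G x = (F y - F x) * G y + F x * (G y - G x)" by (simp add: algebra_simps)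
      also have "\<dots> = integral {x..y} (\<lambda>s. f s * G y) + integral {x..y} (\<lambda>s. F x * g s)"
        using ac_diff[OF F xy(1-3)] ac_diff[OF G xy(1-3)]
        by simp
      also have "\<dots> = integral {x..y} (\<lambda>s. f s * G y + F x * g s)"
        by (rule integral_add[symmetric]) (use sub[OF fi] sub[OF gi] in \<open>auto intro!: integrable_on_mult_left integrable_on_mult_right\<close>)
      finally have *: "F y * G y - F x * G x = integral {x..y} (\<lambda>s. f s * G y + F x * g s)" .
      have "integral {x..y} (\<lambda>s. f s * G y + F x * g s) - integral {x..y} (\<lambda>x. f x * G x + F x * g x)
        = integral {x..y} (\<lambda>s. (f s * G y + F x * g s) - (f s * G s + F s * g s))"
        by (rule integral_diff[symmetric])
          (use sub[OF fi] sub[OF gi] sub[OF fG] sub[OF Fg] in \<open>auto intro!: integrable_add integrable_on_mult_left integrable_on_mult_right\<close>)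
      then show ?thesis unfolding * by (simp add: algebra_simps)
    qed
    have int: "(\<lambda>s. f s * (G y - G s) + (F x - F s) * g s) integrable_on {x..y}"
    proof -
      have "(\<lambda>s. (f s * G y + F x * g s) - (f s * G s + F s * g s)) integrable_on {x..y}"
        by (intro integrable_diff integrable_add integrable_on_mult_left integrable_on_mult_right sub fi gi fG Fg)
      then show ?thesis by (simp add: algebra_simps)
    qed
    have "norm (integral {x..y} (\<lambda>s. f s * (G y - G s) + (F x - F s) * g s))
      \<le> integral {x..y} (\<lambda>s. e * (norm (f s) + norm (g s)))"
    proof (rule integral_norm_bound_integral[OF int])
      show "(\<lambda>s. e * (norm (f s) + norm (g s))) integrable_on {x..y}"
        by (intro integrable_on_mult_right integrable_add sub nfi)
      fix s assume s: "s \<in> {x..y}"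
      have "norm (G y - G s) \<le> e" using d2(2)[of s y] s xy by (auto simp: dist_norm)
      moreover have "norm (F x - F s) \<le> e" using d1(2)[of s x] s xy by (auto simp: dist_norm)
      ultimately have "norm (f s * (G y - G s)) + norm ((F x - F s) * g s) \<le> norm (f s) * e + e * norm (g s)"
        unfolding norm_mult using e by (intro add_mono mult_mono) auto
      then show "norm (f s * (G y - G s) + (F x - F s) * g s) \<le> e * (norm (f s) + norm (g s))"
        using norm_triangle_ineq[of "f s * (G y - G s)" "(F x - F s) * g s"] by (simp add: algebra_simps)
    qed
    also have "\<dots> = e * (integral {x..y} (\<lambda>s. norm (f s)) + integral {x..y} (\<lambda>s. norm (g s)))"
      by (simp add: integral_add sub nfi)
    also have "\<dots> = e * (K y - K x)"
      using abs_int_integral_diff[OF nfi(1) xy(1-3)] abs_int_integral_diff[OF nfi(2) xy(1-3)]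
      by (simp add: K_def)
    finally show ?thesis unfolding eq .
  qed
  then show "\<exists>d>0. \<forall>x y. a \<le> x \<and> x \<le> y \<and> y \<le> b \<and> y - x \<le> d
     \<longrightarrow> norm (F y * G y - F x * G x - integral {x..y} (\<lambda>x. f x * G x + F x * g x)) \<le> e * (K y - K x)"
    using d1(1) d2(1) by (intro exI[of _ "min d1 d2"]) auto
qed

text \<open>Two errors arise on a short interval: linearizing \<open>h\<close> at
  \<open>F x\<close>, and freezing \<open>h'\<close> along the path. Each is at most
  \<open>e\<close> times the integral of the norm of \<open>f\<close>, hence the factor 2 in the
  control function.\<close>

lemma ac_chain:
  fixes F :: "real \<Rightarrow> 'e::{real_normed_field, euclidean_space}"
  assumes F: "ac_deriv a b F f"
    and h: "\<And>z. (h has_field_derivative h' z) (at z)" and h': "continuous_on UNIV h'"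
  shows "ac_deriv a b (\<lambda>x. h (F x)) (\<lambda>x. h' (F x) * f x)"
proof (rule ac_if_small_increments)
  note fi = ac_derivD(1)[OF F] 
  note Fc = ac_continuous[OF F]
  have h'F: "continuous_on {a..b} (\<lambda>x. h' (F x))"
    by (rule continuous_on_compose2[OF h' Fc]) auto
  have int: "(\<lambda>x. h' (F x) * f x) absolutely_integrable_on {a..b}"
    using abs_int_continuous_mult[OF fi h'F] .
  show "(\<lambda>x. h' (F x) * f x) absolutely_integrable_on {a..b}" by fact
  define K where "K x = 2 * integral {a..x} (\<lambda>s. norm (f s))" for x
  have nfi: "(\<lambda>s. norm (f s)) absolutely_integrable_on {a..b}" 
    using fi by (auto intro: absolutely_integrable_norm[unfolded o_def])
  obtain R where R: "R > 0" "\<And>x. x \<in> {a..b} \<Longrightarrow> norm (F x) \<le> R"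
  proof -
    have "bounded (F ` {a..b})"
      by (rule compact_imp_bounded) (use Fc in \<open>auto intro: compact_continuous_image\<close>)
    then show ?thesis using that by (auto simp: bounded_pos)
  qed
  fix e :: real assume e: "e > 0"
  have "uniformly_continuous_on (cball 0 R) h'"
    by (rule compact_uniformly_continuous) (use h' continuous_on_subset in auto)
  then obtain r where r: "r > 0" "\<And>u v. u \<in> cball 0 R \<Longrightarrow> v \<in> cball 0 R \<Longrightarrow> dist u v < r \<Longrightarrow> dist (h' u) (h' v) < e"
    using e unfolding uniformly_continuous_on_def by meson
  have "r / 2 > 0" using r by simp
  from uniform_modulus[OF Fc this] obtain d where 
    d: "d > 0" "\<And>x y. x \<in> {a..b} \<Longrightarrow> y \<in> {a..b} \<Longrightarrow> \<bar>y - x\<bar> \<le> d \<Longrightarrow> dist (F y) (F x) \<le> r / 2" by blast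
  have "norm (h (F y) - h (F x) - integral {x..y} (\<lambda>x. h' (F x) * f x)) \<le> e * (K y - K x)"
    if xy: "a \<le> x" "x \<le> y" "y \<le> b" "y - x \<le> d" for x y
  proof -
    note sub = abs_int_sub(2)[OF _ xy(1) xy(3)]
    have D: "F y - F x = integral {x..y} f" by (rule ac_diff[OF F xy(1-3)])
    have Db: "norm (F y - F x) \<le> integral {x..y} (\<lambda>s. norm (f s))"
      unfolding D by (rule integral_norm_bound_integral) (use sub[OF fi] sub[OF nfi] in auto)
    have 1: "norm (h (F y) - h (F x) - h' (F x) * (F y - F x)) \<le> norm (F y - F x) * e"
    proof (rule differentiable_bound_linearization[where S = "closed_segment (F x) (F y)" and f' = "\<lambda>z. (*) (h' z)"])
      fix t :: real assume "t \<in> {0..1}"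
      then show "F x + t *\<^sub>R (F y - F x) \<in> closed_segment (F x) (F y)"
        by (auto simp: in_segment algebra_simps intro!: exI[of _ t])
    next
      fix z assume z: "z \<in> closed_segment (F x) (F y)"
      show "(h has_derivative (*) (h' z)) (at z within closed_segment (F x) (F y))"
        using h[of z] by (meson has_field_derivative_def has_field_derivative_at_within)
      \<comment> \<open>Convexity of the ball keeps the whole segment in the region where
        \<open>h'\<close> is uniformly continuous.\<close>
      have "closed_segment (F x) (F y) \<subseteq> cball 0 R"
        by (rule closed_segment_subset) (use R xy in auto)
      moreover have "dist z (F x) < r"
      proof -
        have "norm (z - F x) \<le> norm (F y - F x)"
          using z segment_bound(1)[of z "F x" "F y"] by simp
        also have "\<dots> \<le> r / 2" using d(2)[of x y] xy by (auto simp: dist_norm)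
        finally show ?thesis using r(1) by (simp add: dist_norm)
      qed
      ultimately have "dist (h' z) (h' (F x)) < e"
        using r(2)[of z "F x"] z R(2)[of x] xy by auto
      then have "norm (h' z - h' (F x)) \<le> e" by (simp add: dist_norm)
      then show "onorm ((*) (h' z) - (*) (h' (F x))) \<le> e"
        by (intro onorm_le) (auto simp: fun_diff_def norm_mult left_diff_distrib[symmetric] mult_right_mono)
    qed auto
    have 2: "norm (h' (F x) * (F y - F x) - integral {x..y} (\<lambda>s. h' (F s) * f s)) \<le> e * integral {x..y} (\<lambda>s. norm (f s))"
    proof -
      have "h' (F x) * (F y - F x) - integral {x..y} (\<lambda>s. h' (F s) * f s)
         = integral {x..y} (\<lambda>s. h' (F x) * f s) - integral {x..y} (\<lambda>s. h' (F s) * f s)"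
        unfolding D by simp
      also have "\<dots> = integral {x..y} (\<lambda>s. h' (F x) * f s - h' (F s) * f s)"
        by (intro integral_diff[symmetric] integrable_on_mult_right sub fi int)
      also have "norm \<dots> \<le> integral {x..y} (\<lambda>s. e * norm (f s))"
      proof (rule integral_norm_bound_integral)
        show "(\<lambda>s. h' (F x) * f s - h' (F s) * f s) integrable_on {x..y}"
          by (intro integrable_diff integrable_on_mult_right sub fi int)
        show "(\<lambda>s. e * norm (f s)) integrable_on {x..y}" by (intro integrable_on_mult_right sub nfi)
        fix s assume s: "s \<in> {x..y}"
        have "dist (h' (F x)) (h' (F s)) < e"
        proof (rule r(2))
          show "dist (F x) (F s) < r" using d(2)[of s x] s xy r(1) by auto
        qed (use R(2) s xy in auto)
        then have "norm (h' (F x) - h' (F s)) \<le> e" by (simp add: dist_norm)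
        then show "norm (h' (F x) * f s - h' (F s) * f s) \<le> e * norm (f s)"
          by (auto simp: norm_mult left_diff_distrib[symmetric] mult_right_mono)
      qed
      finally show ?thesis by simp
    qed
    have "norm (F y - F x) * e \<le> e * integral {x..y} (\<lambda>s. norm (f s))"
      using Db e by (simp add: mult.commute)
    moreover have "K y - K x = 2 * integral {x..y} (\<lambda>s. norm (f s))"
      using abs_int_integral_diff[OF nfi(1) xy(1-3)] by (simp add: K_def)
    ultimately show ?thesis using 1 2 
      norm_triangle_ineq[of "h (F y) - h (F x) - h' (F x) * (F y - F x)" "h' (F x) * (F y - F x) - integral {x..y} (\<lambda>s. h' (F s) * f s)"]
      by (simp add: algebra_simps)
  qed
  then show "\<exists>d>0. \<forall>x y. a \<le> x \<and> x \<le> y \<and> y \<le> b \<and> y - x \<le> d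
     \<longrightarrow> norm (h (F y) - h (F x) - integral {x..y} (\<lambda>x. h' (F x) * f x)) \<le> e * (K y - K x)"
    using d(1) by blast
qed

lemma ac_exp:
  fixes F :: "real \<Rightarrow> 'e::{real_normed_field, euclidean_space}"
  assumes "ac_deriv a b F f"
  shows "ac_deriv a b (\<lambda>x. exp (F x)) (\<lambda>x. exp (F x) * f x)"
  by (rule ac_chain[OF assms]) (auto intro: continuous_intros)

section \<open>Gronwall inequality and Caratheodory existence\<close>

text \<open>The derivative of \<open>exp (2 * K)\<close> is \<open>2 * k * exp (2 * K)\<close>. The
  resulting factor 1/2 is what makes both weighted arguments below close.\<close>

lemma exp_weight_integral:
  fixes k :: "real \<Rightarrow> real"
  assumes "k absolutely_integrable_on {a..b}" and x: "x \<in> {a..b}"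
  defines "K \<equiv> \<lambda>x. integral {a..x} k"
  shows "(\<lambda>s. exp (2 * K s) * k s) absolutely_integrable_on {a..b}"
    and "integral {a..x} (\<lambda>s. exp (2 * K s) * k s) = (exp (2 * K x) - 1) / 2"
proof -
  have "ac_deriv a b K k" using ac_integral[OF assms(1), of 0] by (simp add: K_def)
  from ac_exp[OF ac_mult_left[OF this, of 2]] 
  have 1: "ac_deriv a b (\<lambda>x. exp (2 * K x)) (\<lambda>x. exp (2 * K x) * (2 * k x))" .
  have 2: "K a = 0" by (simp add: K_def)
  have "ac_deriv a b (\<lambda>x. (1/2) * exp (2 * K x)) (\<lambda>x. exp (2 * K x) * k x)"
    by (rule ac_cong[OF ac_mult_left[OF 1, of "1/2"]]) auto
  then show "(\<lambda>s. exp (2 * K s) * k s) absolutely_integrable_on {a..b}"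
    "integral {a..x} (\<lambda>s. exp (2 * K s) * k s) = (exp (2 * K x) - 1) / 2"
    using ac_derivD(2)[of a b _ _ x] x 2 by (auto simp: ac_deriv_def diff_divide_distrib)
qed

text \<open>At a maximum point of \<open>exp (- 2 * K) * Y\<close>, with maximum
  \<open>S > 0\<close>, the integral term gives back at most half of the left side, so
  \<open>S \<le> 2 * C\<close>. The factors 2 are the price of this weight and are not
  sharp.\<close>

lemma gronwall_exp2:
  fixes k Y :: "real \<Rightarrow> real"
  assumes k: "k absolutely_integrable_on {a..b}" "\<And>s. s \<in> {a..b} \<Longrightarrow> 0 \<le> k s"
    and Y: "continuous_on {a..b} Y" 
    and le: "\<And>x. x \<in> {a..b} \<Longrightarrow> Y x \<le> C + integral {a..x} (\<lambda>s. k s * Y s)"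
    and C: "0 \<le> C" and x: "x \<in> {a..b}"
  shows "Y x \<le> 2 * C * exp (2 * integral {a..x} k)"
proof -
  define K where "K x = integral {a..x} k" for x
  have Kc: "continuous_on {a..b} K"
    unfolding K_def by (rule abs_int_indefinite_continuous[OF k(1)])
  have K0: "K y \<ge> 0" if "y \<in> {a..b}" for y
    unfolding K_def by (rule integral_nonneg) (use abs_int_sub(2)[OF k(1), of a y] k(2) that in auto)
  have "continuous_on {a..b} (\<lambda>x. exp (- 2 * K x) * Y x)" by (intro continuous_intros Kc Y)
  moreover have "{a..b} \<noteq> {}" using x by auto
  ultimately obtain x0 where x0: "x0 \<in> {a..b}" "\<And>y. y \<in> {a..b} \<Longrightarrow> exp (- 2 * K y) * Y y \<le> exp (- 2 * K x0) * Y x0"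
    using continuous_attains_sup[of "{a..b}" "\<lambda>x. exp (- 2 * K x) * Y x"] compact_Icc by blast
  define S where "S = exp (- 2 * K x0) * Y x0"
  have YS: "Y y \<le> S * exp (2 * K y)" if "y \<in> {a..b}" for y
    using x0(2)[OF that] by (simp add: S_def exp_minus field_simps)
  have "S \<le> 2 * C"
  proof (cases "S \<le> 0")
    case False
    have kY: "(\<lambda>s. k s * Y s) absolutely_integrable_on {a..b}"
      using abs_int_continuous_mult[OF k(1) Y] by (simp add: mult.commute)
    note w = exp_weight_integral[OF k(1) x0(1), folded K_def]
    have "integral {a..x0} (\<lambda>s. k s * Y s) \<le> integral {a..x0} (\<lambda>s. S * (exp (2 * K s) * k s))"
    proof (rule integral_le)
      show "(\<lambda>s. k s * Y s) integrable_on {a..x0}" using abs_int_sub(2)[OF kY, of a x0] x0(1) by auto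
      show "(\<lambda>s. S * (exp (2 * K s) * k s)) integrable_on {a..x0}" 
        using abs_int_sub(2)[OF w(1), of a x0] x0(1) by (auto intro: integrable_on_mult_right)
      fix s assume "s \<in> {a..x0}"
      then have s: "s \<in> {a..b}" using x0(1) by auto
      show "k s * Y s \<le> S * (exp (2 * K s) * k s)"
        using mult_left_mono[OF YS[OF s] k(2)[OF s]] by (simp add: algebra_simps)
    qed
    also have "\<dots> = S * ((exp (2 * K x0) - 1) / 2)" using w(2) by simp
    also have "\<dots> \<le> S * (exp (2 * K x0) / 2)" using False by (intro mult_left_mono) auto
    finally have "Y x0 \<le> C + S * (exp (2 * K x0) / 2)" using le[OF x0(1)] by simp
    moreover have "Y x0 = S * exp (2 * K x0)" by (simp add: S_def exp_minus)
    ultimately have "S * exp (2 * K x0) \<le> 2 * C" by simp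
    moreover have "S * 1 \<le> S * exp (2 * K x0)" using False K0[OF x0(1)] by (intro mult_left_mono) auto
    ultimately show ?thesis by simp
  qed (use C in simp)
  then have "S * exp (2 * K x) \<le> 2 * C * exp (2 * K x)" by (rule mult_right_mono) simp
  with YS[OF x] show ?thesis unfolding K_def by (rule order.trans)
qed

text \<open>Picard iteration in a weighted supremum norm (Bielecki): with the weight
  \<open>exp (- 2 * K)\<close> it contracts by 1/2 on all of \<open>[a,b]\<close> at once, for a
  Lipschitz coefficient \<open>k\<close> that is merely integrable.\<close>

lemma caratheodory_existence:
  fixes G :: "real \<Rightarrow> 'e \<Rightarrow> 'e::euclidean_space" and k :: "real \<Rightarrow> real"
  assumes "a \<le> b" and k: "k absolutely_integrable_on {a..b}" "\<And>s. s \<in> {a..b} \<Longrightarrow> 0 \<le> k s"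
    and G: "\<And>Y. continuous_on {a..b} Y \<Longrightarrow> (\<lambda>s. G s (Y s)) absolutely_integrable_on {a..b}"
    and lip: "\<And>s y y'. s \<in> {a..b} \<Longrightarrow> norm (G s y - G s y') \<le> k s * norm (y - y')"
  obtains Y where "ac_deriv a b Y (\<lambda>s. G s (Y s))" "Y a = Y0"
proof -
  define K where "K x = integral {a..x} k" for x
  \<comment> \<open>The complete space used here consists of bounded continuous functions on the
    whole line; \<open>c\<close> clamps arguments to \<open>[a,b]\<close>, so functions are
    continued by their end values.\<close>
  define c where "c x = max a (min b x)" for x
  have c: "continuous_on UNIV c" "\<And>x. c x \<in> {a..b}" "\<And>x. x \<in> {a..b} \<Longrightarrow> c x = x"
    using assms(1) by (auto simp: c_def intro!: continuous_intros)
  have Kc: "continuous_on {a..b} K"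
    unfolding K_def by (rule abs_int_indefinite_continuous[OF k(1)])
  \<comment> \<open>The Picard operator conjugated by the weight: \<open>X\<close> stands for
    \<open>exp (- 2 * K)\<close> times the unknown \<open>Y\<close>.\<close>
  define U where "U X x = exp (- 2 * K x) *\<^sub>R (Y0 + integral {a..x} (\<lambda>s. G s (exp (2 * K s) *\<^sub>R X s)))" 
    for X :: "real \<Rightarrow> 'e" and x
  have GX: "(\<lambda>s. G s (exp (2 * K s) *\<^sub>R X s)) absolutely_integrable_on {a..b}" if "continuous_on {a..b} X" for X
    by (rule G) (intro continuous_intros Kc that)
  have Uc: "continuous_on {a..b} (U X)" if "continuous_on {a..b} X" for X
    unfolding U_def by (intro continuous_intros Kc abs_int_indefinite_continuous GX that)
  define T where "T X = Bcontfun (\<lambda>x. U (apply_bcontfun X) (c x))" for X :: "real \<Rightarrow>\<^sub>C 'e"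
  have bc: "(\<lambda>x. U (apply_bcontfun X) (c x)) \<in> bcontfun" for X :: "real \<Rightarrow>\<^sub>C 'e"
  proof -
    have Xc: "continuous_on S (apply_bcontfun X)" for S by (rule continuous_on_apply_bcontfun) 
    have 1: "continuous_on UNIV (\<lambda>x. U (apply_bcontfun X) (c x))"
      by (rule continuous_on_compose2[OF Uc[OF Xc] c(1)]) (use c(2) in auto)
    have "bounded (U (apply_bcontfun X) ` {a..b})"
      by (rule compact_imp_bounded) (auto intro!: compact_continuous_image Uc Xc)
    then have "bounded (range (\<lambda>x. U (apply_bcontfun X) (c x)))"
      by (rule bounded_subset) (use c(2) in auto)
    with 1 show ?thesis by (simp add: bcontfun_def)
  qed
  have T: "apply_bcontfun (T X) x = U (apply_bcontfun X) (c x)" for X x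
    unfolding T_def using bc by (simp add: Bcontfun_inverse)
  have contr: "dist (T X) (T X') \<le> 1/2 * dist X X'" for X X'
  proof (rule dist_bound)
    fix x
    define y where "y = c x"
    have y: "y \<in> {a..b}" using c(2) by (simp add: y_def)
    have Xc: "continuous_on {a..b} (apply_bcontfun Z)" for Z :: "real \<Rightarrow>\<^sub>C 'e" by (rule continuous_on_apply_bcontfun) 
    note i = abs_int_sub(2)[OF GX[OF Xc], of a y]
    note w = exp_weight_integral[OF k(1) y, folded K_def]
    define g where "g = (\<lambda>Z s. G s (exp (2 * K s) *\<^sub>R apply_bcontfun Z s))"
    have "dist (T X x) (T X' x) = norm (exp (- 2 * K y) *\<^sub>R (integral {a..y} (g X) - integral {a..y} (g X')))"
      unfolding T U_def y_def[symmetric] dist_norm g_def by (simp add: scaleR_diff_right[symmetric])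
    also have "\<dots> = exp (- 2 * K y) * norm (integral {a..y} (g X) - integral {a..y} (g X'))" by simp
    also have "integral {a..y} (g X) - integral {a..y} (g X') = integral {a..y} (\<lambda>s. g X s - g X' s)"
      by (rule integral_diff[symmetric]) (use i y in \<open>auto simp: g_def\<close>)
    also have "norm (integral {a..y} (\<lambda>s. g X s - g X' s)) \<le> integral {a..y} (\<lambda>s. dist X X' * (exp (2 * K s) * k s))"
    proof (rule integral_norm_bound_integral)
      show "(\<lambda>s. g X s - g X' s) integrable_on {a..y}"
        using i y by (intro integrable_diff) (auto simp: g_def)
      show "(\<lambda>s. dist X X' * (exp (2 * K s) * k s)) integrable_on {a..y}"
        using abs_int_sub(2)[OF w(1), of a y] y by (auto intro: integrable_on_mult_right)
      fix s assume "s \<in> {a..y}"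
      then have s: "s \<in> {a..b}" using y by auto
      have "norm (g X s - g X' s) \<le> k s * norm (exp (2 * K s) *\<^sub>R (X s - X' s))"
        unfolding g_def using lip[OF s] by (simp add: scaleR_diff_right)
      also have "\<dots> \<le> k s * (exp (2 * K s) * dist X X')"
        using k(2)[OF s] dist_bounded[of X s X'] by (intro mult_left_mono) (auto simp: dist_norm)
      finally show "norm (g X s - g X' s) \<le> dist X X' * (exp (2 * K s) * k s)" by (simp add: algebra_simps)
    qed
    also have "\<dots> = dist X X' * ((exp (2 * K y) - 1) / 2)" using w(2) by simp
    also have "exp (- 2 * K y) * \<dots> \<le> exp (- 2 * K y) * (dist X X' * (exp (2 * K y) / 2))"
      by (intro mult_left_mono) auto
    also have "\<dots> = 1/2 * dist X X'" by (simp add: exp_minus)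
    finally show "dist (T X x) (T X' x) \<le> 1/2 * dist X X'" by simp
  qed
  obtain X where X: "T X = X"
    using banach_fix_type[of "1/2" T] contr by auto
  define Y where "Y x = exp (2 * K x) *\<^sub>R apply_bcontfun X x" for x
  have Xc: "continuous_on {a..b} (apply_bcontfun X)" by (rule continuous_on_apply_bcontfun) 
  have Yx: "Y x = Y0 + integral {a..x} (\<lambda>s. G s (Y s))" if "x \<in> {a..b}" for x
  proof -
    have "apply_bcontfun X x = U (apply_bcontfun X) x" using T[of X x] X c(3)[OF that] by simp
    then show ?thesis by (simp add: Y_def U_def exp_minus)
  qed
  have Ya: "Y a = Y0" using Yx[of a] assms(1) by simp
  show ?thesis
  proof (rule that)
    show "Y a = Y0" by fact
    show "ac_deriv a b Y (\<lambda>s. G s (Y s))"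
      unfolding ac_deriv_def
    proof (intro conjI ballI)
      show "(\<lambda>s. G s (Y s)) absolutely_integrable_on {a..b}" unfolding Y_def by (rule GX[OF Xc])
      show "Y x = Y a + integral {a..x} (\<lambda>s. G s (Y s))" if "x \<in> {a..b}" for x
        unfolding Ya by (rule Yx[OF that])
    qed
  qed
qed

section \<open>The regularized first order system\<close>

lemma bounded_borel_mult_abs_int:
  fixes h f :: "real \<Rightarrow> 'e::{real_normed_field, euclidean_space}"
  assumes "h \<in> borel_measurable borel" "\<And>x. x \<in> {a..b} \<Longrightarrow> norm (h x) \<le> B"
    and "f absolutely_integrable_on {a..b}"
  shows "(\<lambda>x. h x * f x) absolutely_integrable_on {a..b}"
proof (rule absolutely_integrable_bounded_measurable_product[OF bilinear_times])
  show "h \<in> borel_measurable (lebesgue_on {a..b})"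
    using assms(1) by (simp add: measurable_restrict_space1 measurable_completion)
  show "bounded (h ` {a..b})" using assms(2) unfolding bounded_iff by blast
qed (use assms in auto)

lemma abs_int_of_real:
  fixes f :: "real \<Rightarrow> real"
  assumes "f absolutely_integrable_on S"
  shows "(\<lambda>x. of_real (f x) :: complex) absolutely_integrable_on S"
  using absolutely_integrable_linear[OF assms bounded_linear_of_real] by (simp add: o_def)

lemma abs_int_Pair:
  fixes f :: "real \<Rightarrow> 'e::euclidean_space" and g :: "real \<Rightarrow> 'f::euclidean_space"
  assumes "f absolutely_integrable_on S" "g absolutely_integrable_on S"
  shows "(\<lambda>x. (f x, g x)) absolutely_integrable_on S"
proof -
  have 1: "bounded_linear (\<lambda>x::'e. (x, 0::'f))" "bounded_linear (\<lambda>x::'f. (0::'e, x))"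
    by (intro bounded_linear_Pair bounded_linear_ident bounded_linear_zero)+
  have "(\<lambda>x. (f x, 0) + (0, g x)) absolutely_integrable_on S"
    using absolutely_integrable_linear[OF assms(1) 1(1)] absolutely_integrable_linear[OF assms(2) 1(2)]
    by (intro set_integral_add(1)) (auto simp: o_def)
  then show ?thesis by simp
qed

text \<open>\<open>F\<close> is bounded and Borel but not assumed continuous, because a distribution
  function jumps at every atom; \<open>\<omega>\<close> and \<open>v\<close> are nevertheless
  continuous.\<close>

locale sl_system =
  fixes a b :: real and F q :: "real \<Rightarrow> real" and M :: real
  assumes ab: "a < b"
    and F_meas: "F \<in> borel_measurable borel"
    and F_bound: "\<And>x. x \<in> {a..b} \<Longrightarrow> \<bar>F x\<bar> \<le> M"
    and q_int: "q absolutely_integrable_on {a..b}"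
begin

lemma M_nonneg: "0 \<le> M" using F_bound[of a] ab by auto

text \<open>With \<open>u = \<omega> + F v\<close>, \<open>is_sol z g \<omega> v\<close> is the regularized form of \<open>(\<tau> - z) u = g\<close>.\<close>

definition is_sol :: "complex \<Rightarrow> (real \<Rightarrow> complex) \<Rightarrow> (real \<Rightarrow> complex) \<Rightarrow> (real \<Rightarrow> complex) \<Rightarrow> bool" where
  "is_sol z g om v \<longleftrightarrow>
     ac_deriv a b om (\<lambda>s. - of_real (F s) * ((of_real (q s) - z) * (om s + of_real (F s) * v s) - g s)) \<and>
     ac_deriv a b v (\<lambda>s. (of_real (q s) - z) * (om s + of_real (F s) * v s) - g s)"

text \<open>Lipschitz coefficient of the system in the norm \<open>|\<omega>| + |v|\<close>: one
  factor \<open>1 + M\<close> comes from forming \<open>\<omega> + F v\<close>, the other from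
  adding the sizes of the two components \<open>- F w\<close> and \<open>w\<close>.\<close>

definition growth :: "real \<Rightarrow> real \<Rightarrow> real" where "growth r s = (\<bar>q s\<bar> + r) * (1 + M)\<^sup>2"

lemma growth_int: "growth r absolutely_integrable_on {a..b}"
proof -
  have "(\<lambda>s. \<bar>q s\<bar>) absolutely_integrable_on {a..b}"
    using absolutely_integrable_norm[OF q_int] by (simp add: o_def)
  moreover have "(\<lambda>s. r) absolutely_integrable_on {a..b}" by (intro absolutely_integrable_continuous_real continuous_intros)
  ultimately have "(\<lambda>s. (1 + M)\<^sup>2 * (\<bar>q s\<bar> + r)) absolutely_integrable_on {a..b}"
    by (intro set_integrable_mult_right set_integral_add(1)) 
  then show ?thesis by (simp add: growth_def[abs_def] mult.commute)
qed

lemma growth_nonneg: "r \<ge> 0 \<Longrightarrow> growth r s \<ge> 0" by (simp add: growth_def)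

lemma F_mult_abs_int:
  fixes f :: "real \<Rightarrow> complex"
  assumes "f absolutely_integrable_on {a..b}"
  shows "(\<lambda>x. of_real (F x) * f x) absolutely_integrable_on {a..b}"
  by (rule bounded_borel_mult_abs_int[where B = M]) (use F_meas F_bound assms in auto)

lemma qz_int: "(\<lambda>s. of_real (q s) - z :: complex) absolutely_integrable_on {a..b}"
proof -
  have "(\<lambda>s. z) absolutely_integrable_on {a..b}" by (intro absolutely_integrable_continuous_real continuous_intros)
  then show ?thesis using abs_int_of_real[OF q_int] by (intro set_integral_diff(1)) auto
qed

lemma quasi_abs_int:
  fixes f om v :: "real \<Rightarrow> complex"
  assumes "f absolutely_integrable_on {a..b}" "continuous_on {a..b} om" "continuous_on {a..b} v"
  shows "(\<lambda>s. f s * (om s + of_real (F s) * v s)) absolutely_integrable_on {a..b}"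
proof -
  have "(\<lambda>s. om s * f s) absolutely_integrable_on {a..b}"
    by (rule abs_int_continuous_mult[OF assms(1,2)])
  moreover have "(\<lambda>s. of_real (F s) * (v s * f s)) absolutely_integrable_on {a..b}"
    by (intro F_mult_abs_int abs_int_continuous_mult assms)
  ultimately have "(\<lambda>s. om s * f s + of_real (F s) * (v s * f s)) absolutely_integrable_on {a..b}"
    by (rule set_integral_add(1))
  then show ?thesis by (simp add: algebra_simps)
qed

lemma rhs_bound:
  assumes "s \<in> {a..b}"
  shows "cmod (- of_real (F s) * ((of_real (q s) - z) * (x + of_real (F s) * y) - g)) + cmod ((of_real (q s) - z) * (x + of_real (F s) * y) - g)
    \<le> growth (cmod z) s * (cmod x + cmod y) + (1 + M) * cmod g"
proof -
  have F: "\<bar>F s\<bar> \<le> M" using F_bound assms by auto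
  define w where "w = (of_real (q s) - z) * (x + of_real (F s) * y) - g"
  have "cmod (x + of_real (F s) * y) \<le> cmod x + \<bar>F s\<bar> * cmod y"
    using norm_triangle_ineq[of x "of_real (F s) * y"] by (simp add: norm_mult)
  also have "\<dots> \<le> (1 + M) * cmod x + (1 + M) * cmod y"
    using F M_nonneg by (intro add_mono mult_right_mono) (auto intro: mult_right_mono[of 1 "1+M", simplified])
  finally have 1: "cmod (x + of_real (F s) * y) \<le> (1 + M) * (cmod x + cmod y)" by (simp add: algebra_simps)
  have 2: "cmod (of_real (q s) - z) \<le> \<bar>q s\<bar> + cmod z"
    using norm_triangle_ineq4[of "of_real (q s)" z] by simp
  have "cmod w \<le> cmod (of_real (q s) - z) * cmod (x + of_real (F s) * y) + cmod g"
    unfolding w_def using norm_triangle_ineq4 by (metis norm_mult)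
  also have "\<dots> \<le> (\<bar>q s\<bar> + cmod z) * ((1 + M) * (cmod x + cmod y)) + cmod g"
    using 1 2 by (intro add_right_mono mult_mono) auto
  finally have 3: "cmod w \<le> (\<bar>q s\<bar> + cmod z) * ((1 + M) * (cmod x + cmod y)) + cmod g" .
  have "cmod (- of_real (F s) * w) + cmod w = (1 + \<bar>F s\<bar>) * cmod w" by (simp add: norm_mult algebra_simps)
  also have "\<dots> \<le> (1 + M) * ((\<bar>q s\<bar> + cmod z) * ((1 + M) * (cmod x + cmod y)) + cmod g)"
    using F 3 M_nonneg by (intro mult_mono) auto
  also have "\<dots> = growth (cmod z) s * (cmod x + cmod y) + (1 + M) * cmod g"
    by (simp add: growth_def power2_eq_square algebra_simps)
  finally show ?thesis by (simp add: w_def)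
qed

lemma is_sol_exists:
  assumes g: "g absolutely_integrable_on {a..b}"
  obtains om v where "is_sol z g om v" "om a = A" "v a = B"
proof -
  define W where "W s y = (of_real (q s) - z) * (fst y + of_real (F s) * snd y) - g s" for s and y :: "complex \<times> complex"
  define G where "G s y = (- of_real (F s) * W s y, W s y)" for s and y :: "complex \<times> complex"
  obtain Y where Y: "ac_deriv a b Y (\<lambda>s. G s (Y s))" "Y a = (A, B)"
  proof (rule caratheodory_existence[where a = a and b = b and k = "\<lambda>s. 2 * growth (cmod z) s" and G = G and ?Y0.0 = "(A, B)"])
    show "a \<le> b" using ab by simp
    show "(\<lambda>s. 2 * growth (cmod z) s) absolutely_integrable_on {a..b}" 
      by (intro set_integrable_mult_right growth_int)
    show "0 \<le> 2 * growth (cmod z) s" for s by (simp add: growth_nonneg)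
    fix Y :: "real \<Rightarrow> complex \<times> complex" assume Y: "continuous_on {a..b} Y"
    have W: "(\<lambda>s. W s (Y s)) absolutely_integrable_on {a..b}"
      unfolding W_def by (intro set_integral_diff(1) quasi_abs_int qz_int g continuous_on_fst continuous_on_snd Y)
    have "(\<lambda>s. - 1 * (of_real (F s) * W s (Y s))) absolutely_integrable_on {a..b}"
      by (intro set_integrable_mult_right F_mult_abs_int W)
    then have "(\<lambda>s. - of_real (F s) * W s (Y s)) absolutely_integrable_on {a..b}" by simp
    then show "(\<lambda>s. G s (Y s)) absolutely_integrable_on {a..b}"
      unfolding G_def using W by (rule abs_int_Pair)
  next
    fix s and y y' :: "complex \<times> complex" assume s: "s \<in> {a..b}"
    define d where "d = y - y'"
    have dW: "W s y - W s y' = (of_real (q s) - z) * (fst d + of_real (F s) * snd d) - 0"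
      by (simp add: W_def d_def algebra_simps)
    have "norm (G s y - G s y') = norm (- of_real (F s) * (W s y - W s y'), W s y - W s y')"
      by (simp add: G_def algebra_simps)
    also have "\<dots> \<le> cmod (- of_real (F s) * (W s y - W s y')) + cmod (W s y - W s y')" by (rule norm_Pair_le)
    also have "\<dots> \<le> growth (cmod z) s * (cmod (fst d) + cmod (snd d))"
      using rhs_bound[OF s, of z "fst d" "snd d" 0] unfolding dW by simp
    finally have *: "norm (G s y - G s y') \<le> growth (cmod z) s * (cmod (fst d) + cmod (snd d))" .
    \<comment> \<open>Source of the factor 2 in the coefficient handed to the existence theorem,
      which measures pairs in the Euclidean norm.\<close>
    have "cmod (fst d) + cmod (snd d) \<le> 2 * norm d"
      using norm_fst_le[of "fst d" "snd d"] norm_snd_le[of "snd d" "fst d"] by simp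
    then have "growth (cmod z) s * (cmod (fst d) + cmod (snd d)) \<le> 2 * growth (cmod z) s * norm d"
      using growth_nonneg[of "cmod z" s] mult_left_mono by fastforce
    with * show "norm (G s y - G s y') \<le> 2 * growth (cmod z) s * norm (y - y')" by (simp add: d_def)
  qed
  have "is_sol z g (\<lambda>x. fst (Y x)) (\<lambda>x. snd (Y x))"
    using ac_linear[OF Y(1) bounded_linear_fst] ac_linear[OF Y(1) bounded_linear_snd]
    by (simp add: is_sol_def G_def W_def)
  then show ?thesis using that Y(2) by auto
qed

lemma is_sol_cont:
  assumes "is_sol z g om v"
  shows "continuous_on {a..b} om" "continuous_on {a..b} v"
  using assms ac_continuous by (auto simp: is_sol_def)

text \<open>The constant of \<open>gronwall_exp2\<close> for the whole interval. It sees the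
  spectral parameter only through its modulus, which makes the a priori bounds locally
  uniform.\<close>

definition growth_bound :: "real \<Rightarrow> real" where "growth_bound r = 2 * exp (2 * integral {a..b} (growth r))"

lemma growth_bound_pos: "growth_bound r > 0" by (simp add: growth_bound_def)

lemma growth_bound_mono: "r \<le> r' \<Longrightarrow> growth_bound r \<le> growth_bound r'"
  unfolding growth_bound_def using growth_int absolutely_integrable_on_def M_nonneg
  by (auto intro!: integral_le mult_right_mono simp: growth_def)

lemma is_sol_bound:
  assumes sol: "is_sol z g om v" and g: "g absolutely_integrable_on {a..b}" and x: "x \<in> {a..b}"
  shows "cmod (om x) + cmod (v x) \<le>
     (cmod (om a) + cmod (v a) + (1 + M) * integral {a..b} (\<lambda>s. cmod (g s))) * growth_bound (cmod z)"
proof -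
  define w where "w s = (of_real (q s) - z) * (om s + of_real (F s) * v s) - g s" for s
  have om: "ac_deriv a b om (\<lambda>s. - of_real (F s) * w s)" and v: "ac_deriv a b v w"
    using sol by (auto simp: is_sol_def w_def[abs_def])
  note omi = ac_derivD(1)[OF om] and vi = ac_derivD(1)[OF v]
  define Y where "Y x = cmod (om x) + cmod (v x)" for x
  define C where "C = cmod (om a) + cmod (v a) + (1 + M) * integral {a..b} (\<lambda>s. cmod (g s))"
  note cont = is_sol_cont[OF sol]
  have Yc: "continuous_on {a..b} Y" unfolding Y_def by (intro continuous_intros cont)
  have kY: "(\<lambda>s. growth (cmod z) s * Y s) absolutely_integrable_on {a..b}"
    using abs_int_continuous_mult[OF growth_int Yc] by (simp add: mult.commute)
  have ng: "(\<lambda>s. cmod (g s)) absolutely_integrable_on {a..b}"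
    using absolutely_integrable_norm[OF g] by (simp add: o_def)
  have no: "(\<lambda>s. cmod (- of_real (F s) * w s)) absolutely_integrable_on {a..b}" "(\<lambda>s. cmod (w s)) absolutely_integrable_on {a..b}"
    using absolutely_integrable_norm[OF omi] absolutely_integrable_norm[OF vi] by (auto simp: o_def)
  have Cn: "0 \<le> integral {a..b} (\<lambda>s. cmod (g s))"
    by (rule integral_nonneg) (use ng absolutely_integrable_on_def in auto)
  have "Y x \<le> 2 * C * exp (2 * integral {a..x} (growth (cmod z)))"
  proof (rule gronwall_exp2[OF growth_int _ Yc _ _ x])
    show "0 \<le> growth (cmod z) s" for s by (simp add: growth_nonneg)
    show "0 \<le> C" using Cn M_nonneg by (simp add: C_def)
    fix y assume y: "y \<in> {a..b}"
    note sub = abs_int_sub(2)[OF _ order.refl, where d = y]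
    have yb: "y \<le> b" using y by auto
    have "Y y \<le> cmod (om a) + cmod (v a) + (cmod (integral {a..y} (\<lambda>s. - of_real (F s) * w s)) + cmod (integral {a..y} w))"
      unfolding Y_def ac_derivD(2)[OF om y] ac_derivD(2)[OF v y]
      using norm_triangle_ineq[of "om a" "integral {a..y} (\<lambda>s. - of_real (F s) * w s)"]
        norm_triangle_ineq[of "v a" "integral {a..y} w"] by simp
    also have "cmod (integral {a..y} (\<lambda>s. - of_real (F s) * w s)) \<le> integral {a..y} (\<lambda>s. cmod (- of_real (F s) * w s))"
      by (rule integral_norm_bound_integral) (use sub[OF omi yb] sub[OF no(1) yb] in auto)
    also have "cmod (integral {a..y} w) \<le> integral {a..y} (\<lambda>s. cmod (w s))"
      by (rule integral_norm_bound_integral) (use sub[OF vi yb] sub[OF no(2) yb] in auto)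
    also have "integral {a..y} (\<lambda>s. cmod (- of_real (F s) * w s)) + integral {a..y} (\<lambda>s. cmod (w s))
       = integral {a..y} (\<lambda>s. cmod (- of_real (F s) * w s) + cmod (w s))"
      by (rule integral_add[symmetric]) (use sub[OF no(1) yb] sub[OF no(2) yb] in auto)
    also have "\<dots> \<le> integral {a..y} (\<lambda>s. growth (cmod z) s * Y s + (1 + M) * cmod (g s))"
    proof (rule integral_le)
      show "(\<lambda>s. cmod (- of_real (F s) * w s) + cmod (w s)) integrable_on {a..y}"
        using sub[OF no(1) yb] sub[OF no(2) yb] by (rule integrable_add)
      show "(\<lambda>s. growth (cmod z) s * Y s + (1 + M) * cmod (g s)) integrable_on {a..y}"
        using sub[OF kY yb] sub[OF ng yb] by (intro integrable_add integrable_on_mult_right)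
      fix s assume "s \<in> {a..y}"
      then have "s \<in> {a..b}" using yb by auto
      from rhs_bound[OF this] show "cmod (- of_real (F s) * w s) + cmod (w s) \<le> growth (cmod z) s * Y s + (1 + M) * cmod (g s)"
        unfolding w_def Y_def .
    qed
    also have "\<dots> = integral {a..y} (\<lambda>s. growth (cmod z) s * Y s) + (1 + M) * integral {a..y} (\<lambda>s. cmod (g s))"
      using sub[OF kY yb] sub[OF ng yb] by (subst integral_add) (auto intro!: integrable_on_mult_right)
    also have "integral {a..y} (\<lambda>s. cmod (g s)) \<le> integral {a..b} (\<lambda>s. cmod (g s))"
      by (rule integral_subset_le) (use sub[OF ng yb] ng yb absolutely_integrable_on_def in auto)
    finally show "Y y \<le> C + integral {a..y} (\<lambda>s. growth (cmod z) s * Y s)"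
      using M_nonneg by (simp add: C_def mult_left_mono)
  qed
  also have "\<dots> \<le> C * growth_bound (cmod z)"
  proof -
    have "integral {a..x} (growth (cmod z)) \<le> integral {a..b} (growth (cmod z))"
      by (rule integral_subset_le) (use abs_int_sub(2)[OF growth_int, of a x] growth_int absolutely_integrable_on_def x growth_nonneg in auto)
    moreover have "0 \<le> C" using Cn M_nonneg by (simp add: C_def)
    ultimately show ?thesis by (simp add: growth_bound_def mult_left_mono)
  qed
  finally show ?thesis by (simp add: Y_def C_def)
qed

lemma is_sol_add:
  assumes "is_sol z g om v" "is_sol z g' om' v'"
  shows "is_sol z (\<lambda>s. g s + c * g' s) (\<lambda>s. om s + c * om' s) (\<lambda>s. v s + c * v' s)"
  unfolding is_sol_def
proof (intro conjI)
  note o = ac_add[OF assms(1)[unfolded is_sol_def, THEN conjunct1] ac_mult_left[OF assms(2)[unfolded is_sol_def, THEN conjunct1], of c]]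
  note v = ac_add[OF assms(1)[unfolded is_sol_def, THEN conjunct2] ac_mult_left[OF assms(2)[unfolded is_sol_def, THEN conjunct2], of c]]
  show "ac_deriv a b (\<lambda>s. om s + c * om' s) (\<lambda>s. - of_real (F s) *
          ((of_real (q s) - z) * (om s + c * om' s + of_real (F s) * (v s + c * v' s)) - (g s + c * g' s)))"
    by (rule ac_cong[OF o]) (auto simp: algebra_simps)
  show "ac_deriv a b (\<lambda>s. v s + c * v' s) (\<lambda>s. 
          (of_real (q s) - z) * (om s + c * om' s + of_real (F s) * (v s + c * v' s)) - (g s + c * g' s))"
    by (rule ac_cong[OF v]) (auto simp: algebra_simps)
qed

text \<open>A change of the spectral parameter is moved into the inhomogeneity, so comparing
  solutions for two parameters becomes an a priori bound at one of them.\<close>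

lemma is_sol_change:
  assumes "is_sol z g om v"
  shows "is_sol z' (\<lambda>s. g s + (z - z') * (om s + of_real (F s) * v s)) om v"
proof -
  have "(of_real (q s) - z') * (om s + of_real (F s) * v s) - (g s + (z - z') * (om s + of_real (F s) * v s))
    = (of_real (q s) - z) * (om s + of_real (F s) * v s) - g s" for s by (simp add: algebra_simps)
  then show ?thesis using assms unfolding is_sol_def by presburger
qed

lemma is_sol_unique:
  assumes "is_sol z g om v" "is_sol z g om' v'" "om a = om' a" "v a = v' a" "x \<in> {a..b}"
  shows "om x = om' x" "v x = v' x"
proof -
  from is_sol_add[OF assms(1,2), of "-1"] 
  have "is_sol z (\<lambda>s. 0) (\<lambda>s. om s - om' s) (\<lambda>s. v s - v' s)" by simp
  from is_sol_bound[OF this _ assms(5)] assms(3,4)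
  have "cmod (om x - om' x) + cmod (v x - v' x) \<le> 0"
    by (simp add: set_integrable_def)
  then show "om x = om' x" "v x = v' x"
    by (smt (verit) norm_ge_zero norm_le_zero_iff right_minus_eq)+
qed

text \<open>With primes marking the second solution, the terms containing \<open>F\<close> cancel in
  \<open>u v' - u' v\<close>, so the Wronskian equals \<open>\<omega> v' - \<omega>' v\<close>. It
  is therefore absolutely continuous although \<open>u\<close> may jump.\<close>

lemma lagrange:
  assumes 1: "is_sol z g om v" and 2: "is_sol z' g' om' v'"
  shows "ac_deriv a b (\<lambda>x. om x * v' x - om' x * v x)
    (\<lambda>x. (z - z') * ((om x + of_real (F x) * v x) * (om' x + of_real (F x) * v' x))
       - g' x * (om x + of_real (F x) * v x) + g x * (om' x + of_real (F x) * v' x))"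
proof -
  note o = 1[unfolded is_sol_def, THEN conjunct1] 2[unfolded is_sol_def, THEN conjunct1]
  note v = 1[unfolded is_sol_def, THEN conjunct2] 2[unfolded is_sol_def, THEN conjunct2]
  show ?thesis
    by (rule ac_cong[OF ac_diff_fun[OF ac_mult[OF o(1) v(2)] ac_mult[OF o(2) v(1)]]])
      (auto simp: algebra_simps)
qed

lemma is_sol_cnj:
  assumes "is_sol z g om v"
  shows "is_sol (cnj z) (\<lambda>s. cnj (g s)) (\<lambda>s. cnj (om s)) (\<lambda>s. cnj (v s))"
  using ac_linear[OF assms[unfolded is_sol_def, THEN conjunct1] bounded_linear_cnj]
    ac_linear[OF assms[unfolded is_sol_def, THEN conjunct2] bounded_linear_cnj]
  by (simp add: is_sol_def)

section \<open>The fundamental solution and its dependence on the parameter\<close>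

definition fund :: "complex \<Rightarrow> (real \<Rightarrow> complex) \<times> (real \<Rightarrow> complex)" where
  "fund z = (SOME p. is_sol z (\<lambda>s. 0) (fst p) (snd p) \<and> fst p a = 0 \<and> snd p a = 1)"

definition om :: "complex \<Rightarrow> real \<Rightarrow> complex" where "om z = fst (fund z)"
definition ve :: "complex \<Rightarrow> real \<Rightarrow> complex" where "ve z = snd (fund z)"
definition uu :: "complex \<Rightarrow> real \<Rightarrow> complex" where "uu z x = om z x + of_real (F x) * ve z x"
definition char_fun :: "complex \<Rightarrow> complex" where "char_fun z = uu z b"

lemma zero_abs_int: "(\<lambda>s. 0 :: 'e::euclidean_space) absolutely_integrable_on S"
  by (simp add: set_integrable_def)

lemma fund_sol: "is_sol z (\<lambda>s. 0) (om z) (ve z)" "om z a = 0" "ve z a = 1"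
proof -
  obtain o1 v1 where "is_sol z (\<lambda>s. 0) o1 v1" "o1 a = 0" "v1 a = 1"
    using is_sol_exists[OF zero_abs_int] by blast
  then have "\<exists>p. is_sol z (\<lambda>s. 0) (fst p) (snd p) \<and> fst p a = 0 \<and> snd p a = 1"
    by (intro exI[of _ "(o1, v1)"]) auto
  from someI_ex[OF this]
  show "is_sol z (\<lambda>s. 0) (om z) (ve z)" "om z a = 0" "ve z a = 1" by (auto simp: om_def ve_def fund_def)
qed

lemma fund_bound: "x \<in> {a..b} \<Longrightarrow> cmod (om z x) + cmod (ve z x) \<le> growth_bound (cmod z)"
  using is_sol_bound[OF fund_sol(1) zero_abs_int, of x z] fund_sol(2,3)[of z] by simp

lemma quasi_bound:
  assumes "x \<in> {a..b}"
  shows "cmod (y + of_real (F x) * y') \<le> (1 + M) * (cmod y + cmod y')"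
proof -
  have F: "\<bar>F x\<bar> \<le> M" using F_bound assms by auto
  have "cmod (y + of_real (F x) * y') \<le> cmod y + \<bar>F x\<bar> * cmod y'"
    using norm_triangle_ineq[of y "of_real (F x) * y'"] by (simp add: norm_mult)
  also have "\<dots> \<le> (1 + M) * cmod y + (1 + M) * cmod y'"
    using F M_nonneg by (intro add_mono mult_right_mono) (auto intro: mult_right_mono[of 1 "1+M", simplified])
  finally show ?thesis by (simp add: algebra_simps)
qed

lemma uu_bound: "x \<in> {a..b} \<Longrightarrow> cmod (uu z x) \<le> (1 + M) * growth_bound (cmod z)"
  using order.trans[OF quasi_bound[of x "om z x" "ve z x"] mult_left_mono[OF fund_bound[of x z]]] M_nonneg
  by (simp add: uu_def)

lemma const_abs_int: "(\<lambda>s. c :: complex) absolutely_integrable_on {a..b}"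
  by (intro absolutely_integrable_continuous_real continuous_intros)

lemma uu_abs_int: "(\<lambda>x. f x * uu z x) absolutely_integrable_on {a..b}" if "f absolutely_integrable_on {a..b}"
  unfolding uu_def by (intro quasi_abs_int that is_sol_cont[OF fund_sol(1)])

lemma uu_integrable: "uu z absolutely_integrable_on {a..b}"
  using uu_abs_int[OF const_abs_int[of 1], of z] by simp

text \<open>The difference of the two solutions has zero initial data and solves the equation at
  \<open>z0\<close> with right side \<open>(z - z0) u\<close>, so its a priori bound is linear in
  \<open>z - z0\<close>. Distance at most 1 is what makes the bound on \<open>u\<close> uniform in
  \<open>z\<close>.\<close>

lemma fund_cont_param:
  obtains C where "C > 0" "\<And>z x. cmod (z - z0) \<le> 1 \<Longrightarrow> x \<in> {a..b} \<Longrightarrow>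
    cmod (om z x - om z0 x) + cmod (ve z x - ve z0 x) \<le> C * cmod (z - z0)"
proof -
  define B where "B = (1 + M) * growth_bound (cmod z0 + 1)"
  define C where "C = (1 + M) * ((b - a) * B) * growth_bound (cmod z0) + 1"
  have B: "B \<ge> 0" using M_nonneg growth_bound_pos[of "cmod z0 + 1"] by (simp add: B_def)
  then have "C > 0" using M_nonneg ab growth_bound_pos[of "cmod z0"]
    unfolding C_def by (intro add_nonneg_pos mult_nonneg_nonneg) auto
  moreover have "cmod (om z x - om z0 x) + cmod (ve z x - ve z0 x) \<le> C * cmod (z - z0)"
    if z: "cmod (z - z0) \<le> 1" and x: "x \<in> {a..b}" for z x
  proof -
    have uB: "cmod (uu z s) \<le> B" if "s \<in> {a..b}" for s
    proof -
      have "cmod z \<le> cmod z0 + 1" using z norm_triangle_sub[of z z0] by simp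
      then have "(1 + M) * growth_bound (cmod z) \<le> B" unfolding B_def using M_nonneg growth_bound_mono by (intro mult_left_mono) auto
      then show ?thesis using uu_bound[OF that, of z] by linarith
    qed
    have g: "(\<lambda>s. (z - z0) * uu z s) absolutely_integrable_on {a..b}"
      by (intro set_integrable_mult_right uu_integrable)
    have 1: "is_sol z0 (\<lambda>s. 0 + (z - z0) * uu z s) (om z) (ve z)"
      using is_sol_change[OF fund_sol(1)[of z], of z0] by (simp add: uu_def)
    have "is_sol z0 (\<lambda>s. (z - z0) * uu z s) (\<lambda>s. om z s - om z0 s) (\<lambda>s. ve z s - ve z0 s)"
      using is_sol_add[OF 1 fund_sol(1)[of z0], of "-1"] by simp
    from is_sol_bound[OF this g x]
    have *: "cmod (om z x - om z0 x) + cmod (ve z x - ve z0 x) \<le>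
       (1 + M) * integral {a..b} (\<lambda>s. cmod ((z - z0) * uu z s)) * growth_bound (cmod z0)"
      by (simp add: fund_sol)
    have "integral {a..b} (\<lambda>s. cmod ((z - z0) * uu z s)) \<le> integral {a..b} (\<lambda>s. cmod (z - z0) * B)"
    proof (rule integral_le)
      show "(\<lambda>s. cmod ((z - z0) * uu z s)) integrable_on {a..b}"
        using absolutely_integrable_norm[OF g] unfolding o_def by (rule set_lebesgue_integral_eq_integral(1))
      show "(\<lambda>s. cmod (z - z0) * B) integrable_on {a..b}" by (rule integrable_const_ivl)
      show "cmod ((z - z0) * uu z s) \<le> cmod (z - z0) * B" if "s \<in> {a..b}" for s
        using uB[OF that] by (simp add: norm_mult mult_left_mono)
    qed
    also have "\<dots> = cmod (z - z0) * ((b - a) * B)" using ab by simp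
    finally have "(1 + M) * integral {a..b} (\<lambda>s. cmod ((z - z0) * uu z s)) * growth_bound (cmod z0)
       \<le> (1 + M) * (cmod (z - z0) * ((b - a) * B)) * growth_bound (cmod z0)"
      using M_nonneg growth_bound_pos[of "cmod z0"] by (intro mult_right_mono mult_left_mono) auto
    also have "\<dots> \<le> C * cmod (z - z0)" by (simp add: C_def algebra_simps)
    finally show ?thesis using * by linarith
  qed
  ultimately show ?thesis using that by blast
qed

lemma fund_cnj:
  assumes "x \<in> {a..b}"
  shows "om (cnj z) x = cnj (om z x)" "ve (cnj z) x = cnj (ve z x)" "uu (cnj z) x = cnj (uu z x)"
proof -
  have "is_sol (cnj z) (\<lambda>s. 0) (\<lambda>s. cnj (om z s)) (\<lambda>s. cnj (ve z s))"
    using is_sol_cnj[OF fund_sol(1)[of z]] by simp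
  from is_sol_unique[OF fund_sol(1)[of "cnj z"] this _ _ assms]
  show "om (cnj z) x = cnj (om z x)" "ve (cnj z) x = cnj (ve z x)" by (auto simp: fund_sol)
  then show "uu (cnj z) x = cnj (uu z x)" by (simp add: uu_def)
qed

text \<open>The Wronskian with the solution started at \<open>(1, 0)\<close> has derivative zero and
  keeps its initial value \<open>-1\<close>.\<close>

lemma fund_nonzero:
  assumes "x \<in> {a..b}"
  shows "om z x \<noteq> 0 \<or> ve z x \<noteq> 0"
proof -
  obtain o1 v1 where s: "is_sol z (\<lambda>s. 0) o1 v1" "o1 a = 1" "v1 a = 0"
    using is_sol_exists[OF zero_abs_int] by blast
  have "ac_deriv a b (\<lambda>x. om z x * v1 x - o1 x * ve z x) (\<lambda>x. 0)"
    using lagrange[OF fund_sol(1)[of z] s(1)] by simp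
  from ac_derivD(2)[OF this assms] s fund_sol have "om z x * v1 x - o1 x * ve z x = -1" by simp
  then show ?thesis by auto
qed

lemma lagrange_fund:
  assumes "x \<in> {a..b}"
  shows "om z x * ve z' x - om z' x * ve z x = (z - z') * integral {a..x} (\<lambda>s. uu z s * uu z' s)"
proof -
  have "ac_deriv a b (\<lambda>x. om z x * ve z' x - om z' x * ve z x) (\<lambda>x. (z - z') * (uu z x * uu z' x))"
    using lagrange[OF fund_sol(1)[of z] fund_sol(1)[of z']] by (simp add: uu_def)
  from ac_derivD(2)[OF this assms] show ?thesis by (simp add: fund_sol)
qed

lemma sol_zero_init:
  assumes "is_sol z (\<lambda>s. 0) o1 v1" "o1 a = 0" "x \<in> {a..b}"
  shows "o1 x = v1 a * om z x" "v1 x = v1 a * ve z x"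
proof -
  have "is_sol z (\<lambda>s. 0) (\<lambda>s. 0) (\<lambda>s. 0)" by (simp add: is_sol_def ac_const)
  from is_sol_add[OF this fund_sol(1), of "v1 a"] 
  have "is_sol z (\<lambda>s. 0) (\<lambda>s. v1 a * om z s) (\<lambda>s. v1 a * ve z s)" by simp
  from is_sol_unique[OF assms(1) this _ _ assms(3)] show "o1 x = v1 a * om z x" "v1 x = v1 a * ve z x"
    using assms(2) by (auto simp: fund_sol)
qed

end

section \<open>The abstract Dirichlet operator and its spectrum\<close>

lemma AE_leb_on_iff:
  "(AE x in leb_on a b. P x) \<longleftrightarrow> (AE x in lebesgue. x \<in> {a..b} \<longrightarrow> P x)"
proof -
  have ep: "AE x in lebesgue. x \<noteq> a \<and> x \<noteq> b"
  proof -
    have "{a, b} \<in> null_sets lebesgue" by (simp add: negligible_iff_null_sets[symmetric])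
    then show ?thesis by (rule AE_I') auto
  qed
  have "(AE x in leb_on a b. P x) \<longleftrightarrow> (AE x in lebesgue. x \<in> {a<..<b} \<longrightarrow> P x)"
    by (subst AE_restrict_space_iff) auto
  also have "\<dots> \<longleftrightarrow> (AE x in lebesgue. x \<in> {a..b} \<longrightarrow> P x)"
    using ep by (intro iffI; (elim AE_mp)) (auto intro!: AE_I2)
  finally show ?thesis .
qed

lemma AE_negligible:
  assumes "AE x in lebesgue. x \<in> {a..b::real} \<longrightarrow> P x"
  shows "negligible {x \<in> {a..b}. \<not> P x}"
proof -
  from assms obtain N where "N \<in> null_sets lebesgue" "{x \<in> space lebesgue. \<not> (x \<in> {a..b} \<longrightarrow> P x)} \<subseteq> N"
    by (rule AE_E3) auto
  then have "{x \<in> {a..b}. \<not> P x} \<subseteq> N" "negligible N" by (auto simp: negligible_iff_null_sets)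
  then show ?thesis using negligible_subset by blast
qed

lemma abs_int_AE_cong:
  fixes f g :: "real \<Rightarrow> 'e::euclidean_space"
  assumes "f absolutely_integrable_on {a..b}" "AE x in lebesgue. x \<in> {a..b} \<longrightarrow> f x = g x"
  shows "g absolutely_integrable_on {a..b}" "c \<in> {a..b} \<Longrightarrow> integral {a..c} f = integral {a..c} g"
proof -
  note N = AE_negligible[OF assms(2)]
  show "g absolutely_integrable_on {a..b}"
    by (rule absolutely_integrable_spike[OF assms(1) N]) auto
  show "integral {a..c} f = integral {a..c} g" if "c \<in> {a..b}"
    by (rule integral_spike[OF N]) (use that in auto)
qed

lemma ac_deriv_AE_cong:
  assumes "ac_deriv a b F f" "AE x in lebesgue. x \<in> {a..b} \<longrightarrow> f x = g x"
  shows "ac_deriv a b F g"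
  unfolding ac_deriv_def
proof (intro conjI ballI)
  note i = abs_int_AE_cong[OF ac_derivD(1)[OF assms(1)] assms(2)]
  show "g absolutely_integrable_on {a..b}" by (rule i(1))
  show "F x = F a + integral {a..x} g" if "x \<in> {a..b}" for x
    using ac_derivD(2)[OF assms(1) that] i(2)[OF that] by metis
qed

lemma abs_int_leb_on_iff:
  fixes f :: "real \<Rightarrow> 'e::euclidean_space"
  shows "integrable (leb_on a b) f \<longleftrightarrow> f absolutely_integrable_on {a..b}"
proof -
  have "integrable (leb_on a b) f \<longleftrightarrow> f absolutely_integrable_on {a<..<b}"
    by (simp add: set_integrable_def integrable_restrict_space)
  also have "\<dots> \<longleftrightarrow> f absolutely_integrable_on {a..b}"
    using absolutely_integrable_spike_set_eq[of "{a<..<b}" "{a..b}" f] 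
    by (metis (mono_tags, lifting) box_real(1) box_real(2) absolutely_integrable_on_open_interval)
  finally show ?thesis .
qed

lemma finite_measure_leb_on: "finite_measure (leb_on a b)"
  by (rule finite_measure_lebesgue_on) simp

lemma integral_leb_on:
  fixes f :: "real \<Rightarrow> 'e::euclidean_space"
  assumes "integrable (leb_on a b) f"
  shows "integral\<^sup>L (leb_on a b) f = integral {a..b} f"
proof -
  have "integral\<^sup>L (leb_on a b) f = integral {a<..<b} f"
    using assms by (intro lebesgue_integral_eq_integral) auto
  also have "\<dots> = integral {a..b} f"
    by (metis box_real(1) box_real(2) integral_open_interval)
  finally show ?thesis .
qed

text \<open>The measure is finite, and \<open>|y| \<le> 1 + |y|^2\<close>.\<close>

lemma L2_abs_int:
  assumes "f \<in> L2 (leb_on a b)"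
  shows "f absolutely_integrable_on {a..b}"
proof -
  interpret finite_measure "leb_on a b" by (rule finite_measure_leb_on)
  have "integrable (leb_on a b) (\<lambda>x. 1 + (cmod (f x))\<^sup>2)"
    using assms by (auto simp: L2_def)
  then have "integrable (leb_on a b) f"
  proof (rule Bochner_Integration.integrable_bound)
    show "f \<in> borel_measurable (leb_on a b)" using assms by (auto simp: L2_def)
    have "cmod y \<le> 1 + (cmod y)\<^sup>2" for y
      using sum_squares_bound[of "cmod y" 1] by (simp add: power2_eq_square) (smt (verit) zero_le_square norm_ge_zero)
    then show "AE x in leb_on a b. norm (f x) \<le> norm (1 + (cmod (f x))\<^sup>2)" by auto
  qed
  then show ?thesis by (simp add: abs_int_leb_on_iff)
qed

lemma L2_norm_square:
  assumes "f \<in> L2 (leb_on a b)"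
  shows "(L2_norm (leb_on a b) f)\<^sup>2 = integral\<^sup>L (leb_on a b) (\<lambda>x. (cmod (f x))\<^sup>2)" "L2_norm (leb_on a b) f \<ge> 0"
  by (auto simp: L2_norm_def)

text \<open>Nonnegativity of the integral of \<open>(|f| - m)^2\<close>, where \<open>m\<close> is
  the mean of \<open>|f|\<close>.\<close>

lemma L2_cauchy_schwarz:
  assumes f: "f \<in> L2 (leb_on a b)" and ab: "a < b"
  shows "integral {a..b} (\<lambda>x. cmod (f x)) \<le> sqrt (b - a) * L2_norm (leb_on a b) f"
proof -
  interpret finite_measure "leb_on a b" by (rule finite_measure_leb_on)
  have i1: "integrable (leb_on a b) (\<lambda>x. cmod (f x))"
    using L2_abs_int[OF f] by (simp add: abs_int_leb_on_iff[symmetric])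
  have i2: "integrable (leb_on a b) (\<lambda>x. (cmod (f x))\<^sup>2)" using f by (simp add: L2_def)
  define m where "m = integral\<^sup>L (leb_on a b) (\<lambda>x. cmod (f x)) / (b - a)"
  have meas: "measure (leb_on a b) (space (leb_on a b)) = b - a"
    using ab by (simp add: measure_restrict_space)
  have "0 \<le> integral\<^sup>L (leb_on a b) (\<lambda>x. (cmod (f x) - m)\<^sup>2)" by simp
  also have "(\<lambda>x. (cmod (f x) - m)\<^sup>2) = (\<lambda>x. (cmod (f x))\<^sup>2 - 2 * m * cmod (f x) + m\<^sup>2)"
    by (auto simp: power2_diff algebra_simps)
  also have "integral\<^sup>L (leb_on a b) \<dots> = integral\<^sup>L (leb_on a b) (\<lambda>x. (cmod (f x))\<^sup>2) - 2 * m * (m * (b - a)) + m\<^sup>2 * (b - a)"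
    using i1 i2 meas ab by (simp add: m_def)
  finally have "m\<^sup>2 * (b - a) \<le> (L2_norm (leb_on a b) f)\<^sup>2"
    unfolding L2_norm_square(1)[OF f] by (simp add: power2_eq_square algebra_simps)
  then have "(m * sqrt (b - a))\<^sup>2 \<le> (L2_norm (leb_on a b) f)\<^sup>2" using ab by (simp add: power_mult_distrib)
  then have "m * sqrt (b - a) \<le> L2_norm (leb_on a b) f"
    using L2_norm_square(2)[OF f] power2_le_imp_le by blast
  then have "sqrt (b - a) * (m * sqrt (b - a)) \<le> sqrt (b - a) * L2_norm (leb_on a b) f"
    using ab by (intro mult_left_mono) auto
  moreover have "sqrt (b - a) * (m * sqrt (b - a)) = m * (b - a)" using ab by simp
  ultimately show ?thesis using integral_leb_on[OF i1] ab by (simp add: m_def)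
qed

lemma L2_scale:
  assumes "f \<in> L2 M" shows "(\<lambda>x. c * f x) \<in> L2 M"
  using assms by (auto simp: L2_def norm_mult power_mult_distrib)

lemma L2_add:
  assumes "f \<in> L2 M" "g \<in> L2 M" shows "(\<lambda>x. f x + g x) \<in> L2 M"
proof -
  have m: "f \<in> borel_measurable M" "g \<in> borel_measurable M" using assms by (auto simp: L2_def)
  have "integrable M (\<lambda>x. 2 * (cmod (f x))\<^sup>2 + 2 * (cmod (g x))\<^sup>2)"
    using assms by (auto simp: L2_def)
  then have "integrable M (\<lambda>x. (cmod (f x + g x))\<^sup>2)"
  proof (rule Bochner_Integration.integrable_bound)
    show "(\<lambda>x. (cmod (f x + g x))\<^sup>2) \<in> borel_measurable M" using m by measurable
    have "(cmod (y + z))\<^sup>2 \<le> 2 * (cmod y)\<^sup>2 + 2 * (cmod z)\<^sup>2" for y z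
    proof -
      have "(cmod (y + z))\<^sup>2 \<le> (cmod y + cmod z)\<^sup>2"
        by (rule power_mono[OF norm_triangle_ineq]) auto
      also have "\<dots> \<le> 2 * (cmod y)\<^sup>2 + 2 * (cmod z)\<^sup>2"
        using sum_squares_bound[of "cmod y" "cmod z"] by (simp add: power2_sum)
      finally show ?thesis .
    qed
    then show "AE x in M. norm ((cmod (f x + g x))\<^sup>2) \<le> norm (2 * (cmod (f x))\<^sup>2 + 2 * (cmod (g x))\<^sup>2)" by auto
  qed
  then show ?thesis using m by (auto simp: L2_def)
qed

lemma L2_bounded:
  assumes "f \<in> borel_measurable (leb_on a b)" "\<And>x. x \<in> {a<..<b} \<Longrightarrow> cmod (f x) \<le> B"
  shows "f \<in> L2 (leb_on a b)"
proof -
  interpret finite_measure "leb_on a b" by (rule finite_measure_leb_on)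
  have "integrable (leb_on a b) (\<lambda>x. (cmod (f x))\<^sup>2)"
  proof (rule integrable_const_bound[where B = "B\<^sup>2"])
    show "AE x in leb_on a b. norm ((cmod (f x))\<^sup>2) \<le> B\<^sup>2"
      using assms(2) by (auto intro!: AE_I2 power_mono)
    show "(\<lambda>x. (cmod (f x))\<^sup>2) \<in> borel_measurable (leb_on a b)" using assms(1) by measurable
  qed
  then show ?thesis using assms(1) by (auto simp: L2_def)
qed

lemma L2_norm_le_sup:
  assumes f: "f \<in> L2 (leb_on a b)" and ab: "a < b"
    and B: "AE x in leb_on a b. cmod (f x) \<le> B" and B0: "0 \<le> B"
  shows "L2_norm (leb_on a b) f \<le> sqrt (b - a) * B"
proof -
  interpret finite_measure "leb_on a b" by (rule finite_measure_leb_on)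
  have meas: "measure (leb_on a b) (space (leb_on a b)) = b - a"
    using ab by (simp add: measure_restrict_space)
  have "integral\<^sup>L (leb_on a b) (\<lambda>x. (cmod (f x))\<^sup>2) \<le> integral\<^sup>L (leb_on a b) (\<lambda>x. B\<^sup>2)"
    by (rule integral_mono_AE[OF _ _ eventually_mono[OF B]]) (use f in \<open>auto simp: L2_def intro!: power_mono\<close>)
  also have "\<dots> = (b - a) * B\<^sup>2" using meas by simp
  finally have "L2_norm (leb_on a b) f \<le> sqrt ((b - a) * B\<^sup>2)"
    unfolding L2_norm_def by (rule real_sqrt_le_mono)
  then show ?thesis using B0 by (simp add: real_sqrt_mult)
qed

section \<open>Resolvent and eigenspaces of the regularized operator\<close>

context sl_system
begin

text \<open>When \<open>F\<close> is the distribution function of \<open>P\<close>, it tends to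
  \<open>0\<close> at \<open>a\<close> and is left-continuous at \<open>b\<close>; the two boundary
  conditions are then exactly the limits of \<open>u\<close> at the end points. The regularity of
  \<open>o1\<close> and \<open>v1\<close> reaches up to the end points in this form.\<close>

definition dirichlet :: "real graph" where
  "dirichlet = {(f, g). f \<in> L2 (leb_on a b) \<and> g \<in> L2 (leb_on a b) \<and>
     (\<exists>w o1 v1. ac_deriv a b o1 (\<lambda>s. - of_real (F s) * w s) \<and> ac_deriv a b v1 w \<and>
        o1 a = 0 \<and> o1 b + of_real (F b) * v1 b = 0 \<and>
        (AE x in leb_on a b. f x = o1 x + of_real (F x) * v1 x) \<and>
        (AE x in leb_on a b. g x = - w x + of_real (q x) * (o1 x + of_real (F x) * v1 x)))}"

lemma dirichlet_is_sol:
  assumes "(f, g) \<in> dirichlet"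
  obtains o1 v1 where "is_sol z (\<lambda>x. g x - z * f x) o1 v1" "o1 a = 0"
    "o1 b + of_real (F b) * v1 b = 0" "AE x in leb_on a b. f x = o1 x + of_real (F x) * v1 x"
proof -
  obtain w o1 v1 where 1: "ac_deriv a b o1 (\<lambda>s. - of_real (F s) * w s)" "ac_deriv a b v1 w"
        "o1 a = 0" "o1 b + of_real (F b) * v1 b = 0"
    and 2: "AE x in leb_on a b. f x = o1 x + of_real (F x) * v1 x"
        "AE x in leb_on a b. g x = - w x + of_real (q x) * (o1 x + of_real (F x) * v1 x)"
    using assms by (auto simp: dirichlet_def)
  have "AE x in leb_on a b. w x = (of_real (q x) - z) * (o1 x + of_real (F x) * v1 x) - (g x - z * f x)"
    using 2 by eventually_elim (simp add: algebra_simps)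
  then have 3: "AE x in lebesgue. x \<in> {a..b} \<longrightarrow> w x = (of_real (q x) - z) * (o1 x + of_real (F x) * v1 x) - (g x - z * f x)"
    unfolding AE_leb_on_iff .
  have "is_sol z (\<lambda>x. g x - z * f x) o1 v1"
    unfolding is_sol_def
  proof
    show "ac_deriv a b o1 (\<lambda>s. - of_real (F s) * ((of_real (q s) - z) * (o1 s + of_real (F s) * v1 s) - (g s - z * f s)))"
      by (rule ac_deriv_AE_cong[OF 1(1)], rule eventually_mono[OF 3]) simp
    show "ac_deriv a b v1 (\<lambda>s. ((of_real (q s) - z) * (o1 s + of_real (F s) * v1 s) - (g s - z * f s)))"
      by (rule ac_deriv_AE_cong[OF 1(2) 3])
  qed
  then show ?thesis using that 1 2 by blast
qed

lemma measurable_cont: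
  "continuous_on {a..b} y \<Longrightarrow> y \<in> borel_measurable (leb_on a b)"
  by (rule continuous_imp_measurable_on_sets_lebesgue) (auto elim: continuous_on_subset)

lemma F_measurable_leb: "F \<in> borel_measurable (leb_on a b)"
  using F_meas by (simp add: measurable_restrict_space1 measurable_completion)

lemma quasi_measurable:
  assumes "is_sol z g o1 v1"
  shows "(\<lambda>x. o1 x + of_real (F x) * v1 x) \<in> borel_measurable (leb_on a b)"
  using measurable_cont[OF is_sol_cont(1)[OF assms]] measurable_cont[OF is_sol_cont(2)[OF assms]] F_measurable_leb
  by measurable

lemma quasi_L2:
  assumes "is_sol z g o1 v1" and g: "g absolutely_integrable_on {a..b}"
  shows "(\<lambda>x. o1 x + of_real (F x) * v1 x) \<in> L2 (leb_on a b)"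
proof (rule L2_bounded[OF quasi_measurable[OF assms(1)]])
  fix x assume "x \<in> {a<..<b}"
  then have x: "x \<in> {a..b}" by auto
  show "cmod (o1 x + of_real (F x) * v1 x) \<le> (1 + M) * ((cmod (o1 a) + cmod (v1 a) + (1 + M) * integral {a..b} (\<lambda>s. cmod (g s))) * growth_bound (cmod z))"
    using quasi_bound[OF x] is_sol_bound[OF assms x] M_nonneg
    by (meson add_nonneg_nonneg mult_left_mono order.trans zero_le_one)
qed

lemma dirichlet_intro:
  assumes sol: "is_sol z g o1 v1" and g: "g \<in> L2 (leb_on a b)" and bc: "o1 a = 0" "o1 b + of_real (F b) * v1 b = 0"
  defines "u \<equiv> \<lambda>x. o1 x + of_real (F x) * v1 x"
  shows "(u, \<lambda>x. z * u x + g x) \<in> dirichlet"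
proof -
  have u: "u \<in> L2 (leb_on a b)" unfolding u_def by (rule quasi_L2[OF sol L2_abs_int[OF g]])
  have h: "(\<lambda>x. z * u x + g x) \<in> L2 (leb_on a b)" by (intro L2_add L2_scale u g)
  define w where "w s = (of_real (q s) - z) * u s - g s" for s
  have "ac_deriv a b o1 (\<lambda>s. - of_real (F s) * w s)" "ac_deriv a b v1 w"
    using sol by (auto simp: is_sol_def u_def w_def[abs_def])
  moreover have "AE x in leb_on a b. z * u x + g x = - w x + of_real (q x) * u x"
    by (simp add: w_def algebra_simps)
  ultimately show ?thesis unfolding dirichlet_def using u h bc by (auto simp: u_def)
qed

text \<open>After subtracting \<open>v1 a\<close> times the fundamental solution, the initial data
  vanish and the remainder is bounded by the right side alone. The condition at \<open>b\<close>
  identifies the boundary value of this remainder as \<open>- v1 a * char_fun z\<close>, so division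
  by \<open>char_fun z\<close> bounds \<open>v1 a\<close>.\<close>

lemma dirichlet_sol_bound:
  assumes D: "char_fun z \<noteq> 0"
  obtains C where "\<And>h o1 v1 x. h absolutely_integrable_on {a..b} \<Longrightarrow> is_sol z h o1 v1 \<Longrightarrow> o1 a = 0 \<Longrightarrow>
     o1 b + of_real (F b) * v1 b = 0 \<Longrightarrow> x \<in> {a..b} \<Longrightarrow>
     cmod (o1 x + of_real (F x) * v1 x) \<le> C * integral {a..b} (\<lambda>s. cmod (h s))" "C \<ge> 0"
proof -
  define E where "E = growth_bound (cmod z)"
  define C0 where "C0 = (1 + M) * (1 + M) * E"
  define C where "C = (1 + M) * ((C0 / cmod (char_fun z) + (1 + M)) * E)"
  have E: "E > 0" by (simp add: E_def growth_bound_pos)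
  have C0: "C0 \<ge> 0" "C \<ge> 0" using E M_nonneg by (auto simp: C0_def C_def intro!: mult_nonneg_nonneg add_nonneg_nonneg)
  have "cmod (o1 x + of_real (F x) * v1 x) \<le> C * integral {a..b} (\<lambda>s. cmod (h s))"
    if h: "h absolutely_integrable_on {a..b}" and sol: "is_sol z h o1 v1" and bc: "o1 a = 0" "o1 b + of_real (F b) * v1 b = 0"
      and x: "x \<in> {a..b}" for h o1 v1 x
  proof -
    define I where "I = integral {a..b} (\<lambda>s. cmod (h s))"
    have bb: "b \<in> {a..b}" using ab by auto
    have s0: "is_sol z h (\<lambda>s. o1 s + (- v1 a) * om z s) (\<lambda>s. v1 s + (- v1 a) * ve z s)"
      using is_sol_add[OF sol fund_sol(1), of "- v1 a"] by simp
    let ?o = "o1 b + (- v1 a) * om z b" and ?v = "v1 b + (- v1 a) * ve z b"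
    have "cmod ?o + cmod ?v \<le> (1 + M) * I * E"
      using is_sol_bound[OF s0 h bb] bc fund_sol[of z] by (simp add: I_def E_def)
    then have "cmod (?o + of_real (F b) * ?v) \<le> C0 * I"
      using quasi_bound[OF bb, of ?o ?v] mult_left_mono[of "cmod ?o + cmod ?v" "(1 + M) * I * E" "1 + M"] M_nonneg
      by (simp add: C0_def algebra_simps)
    moreover have "?o + of_real (F b) * ?v = - v1 a * char_fun z"
      using bc(2) by (simp add: char_fun_def uu_def algebra_simps)
    ultimately have "cmod (v1 a) * cmod (char_fun z) \<le> C0 * I" by (simp add: norm_mult)
    then have va: "cmod (v1 a) \<le> C0 / cmod (char_fun z) * I" using D by (simp add: field_simps)
    have "cmod (o1 x) + cmod (v1 x) \<le> (cmod (v1 a) + (1 + M) * I) * E"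
      using is_sol_bound[OF sol h x] bc by (simp add: I_def E_def)
    also have "\<dots> \<le> (C0 / cmod (char_fun z) * I + (1 + M) * I) * E"
      using va E by (intro mult_right_mono add_right_mono) auto
    also have "\<dots> = (C0 / cmod (char_fun z) + (1 + M)) * E * I" by (simp add: algebra_simps)
    finally have "(1 + M) * (cmod (o1 x) + cmod (v1 x)) \<le> (1 + M) * ((C0 / cmod (char_fun z) + (1 + M)) * E * I)"
      using M_nonneg by (intro mult_left_mono) auto
    then show ?thesis using quasi_bound[OF x, of "o1 x" "v1 x"] by (simp add: C_def I_def algebra_simps)
  qed
  then show ?thesis using that C0 by blast
qed

text \<open>The condition at \<open>a\<close> leaves a one-parameter family of solutions, all
  multiples of the fundamental one; the condition at \<open>b\<close> then bears on the factor
  \<open>c\<close>.\<close>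

lemma eigenspace_dirichlet:
  assumes "f \<in> eigenspace dirichlet z"
  obtains c where "AE x in leb_on a b. f x = c * uu z x" "c * char_fun z = 0"
proof -
  have "(f, \<lambda>x. z * f x) \<in> dirichlet" using assms by (simp add: eigenspace_def)
  from dirichlet_is_sol[OF this, of z] obtain o1 v1 where s: "is_sol z (\<lambda>x. 0) o1 v1" "o1 a = 0"
    "o1 b + of_real (F b) * v1 b = 0" "AE x in leb_on a b. f x = o1 x + of_real (F x) * v1 x" by auto
  have eq: "o1 x + of_real (F x) * v1 x = v1 a * uu z x" if "x \<in> {a..b}" for x
    using sol_zero_init[OF s(1,2) that] by (simp add: uu_def algebra_simps)
  have "AE x in leb_on a b. f x = v1 a * uu z x"
    using s(4) unfolding AE_leb_on_iff by (rule AE_mp) (use eq in \<open>auto intro!: AE_I2\<close>)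
  moreover have "v1 a * char_fun z = 0" using eq[of b] s(3) ab by (simp add: char_fun_def)
  ultimately show ?thesis using that by blast
qed

lemma uu_eigen: "char_fun z = 0 \<Longrightarrow> uu z \<in> eigenspace dirichlet z"
proof -
  assume D: "char_fun z = 0"
  have "(\<lambda>x. 0) \<in> L2 (leb_on a b)" by (rule L2_bounded[where B = 0]) auto
  from dirichlet_intro[OF fund_sol(1) this] D show ?thesis
    by (simp add: eigenspace_def char_fun_def uu_def[abs_def] fund_sol)
qed

lemma not_eigenvalue: "char_fun z \<noteq> 0 \<Longrightarrow> \<not> eigenvalue (leb_on a b) dirichlet z"
  unfolding eigenvalue_def by (auto elim!: eigenspace_dirichlet)

lemma finite_multiplicity_dirichlet:
  assumes "char_fun z = 0"
  shows "finite_multiplicity (leb_on a b) dirichlet z"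
  unfolding finite_multiplicity_def
proof (intro exI[of _ "{uu z}"] conjI ballI)
  fix f assume "f \<in> eigenspace dirichlet z"
  then obtain c where "AE x in leb_on a b. f x = c * uu z x" by (rule eigenspace_dirichlet)
  then show "\<exists>c. AE x in leb_on a b. f x = (\<Sum>e\<in>{uu z}. c e * e x)"
    by (intro exI[of _ "\<lambda>_. c"]) simp
qed (use uu_eigen[OF assms] in auto)

text \<open>Surjectivity is a shooting argument: a solution with zero initial data is corrected by a
  multiple of the fundamental solution. Boundedness goes from the integral of the right side to a
  uniform bound on the solution, with Cauchy-Schwarz closing the circle to
  \<open>L2_norm\<close>.\<close>

lemma resolvent_dirichlet:
  assumes D: "char_fun z \<noteq> 0"
  shows "z \<in> resolvent_set (leb_on a b) dirichlet"
  unfolding resolvent_set_def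
proof (intro CollectI conjI not_eigenvalue[OF D] ballI)
  fix g assume g: "g \<in> L2 (leb_on a b)"
  obtain o1 v1 where s: "is_sol z g o1 v1" "o1 a = 0" "v1 a = 0"
    using is_sol_exists[OF L2_abs_int[OF g]] by blast
  \<comment> \<open>The multiple that cancels the boundary value at \<open>b\<close>.\<close>
  define c where "c = - (o1 b + of_real (F b) * v1 b) / char_fun z"
  have "is_sol z g (\<lambda>s. o1 s + c * om z s) (\<lambda>s. v1 s + c * ve z s)"
    using is_sol_add[OF s(1) fund_sol(1), of c] by simp
  from dirichlet_intro[OF this g] 
  have "(\<lambda>x. o1 x + c * om z x + of_real (F x) * (v1 x + c * ve z x),
         \<lambda>x. z * (o1 x + c * om z x + of_real (F x) * (v1 x + c * ve z x)) + g x) \<in> dirichlet"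
  proof -
    have "o1 b + c * om z b + of_real (F b) * (v1 b + c * ve z b) = (o1 b + of_real (F b) * v1 b) + c * char_fun z"
      by (simp add: char_fun_def uu_def algebra_simps)
    also have "\<dots> = 0" using D by (simp add: c_def)
    finally show ?thesis using \<open>\<lbrakk>_; _\<rbrakk> \<Longrightarrow> _\<close> s(2) by (simp add: fund_sol)
  qed
  then show "\<exists>(f, h)\<in>dirichlet. AE x in leb_on a b. h x - z * f x = g x"
    by (intro bexI) auto
next
  obtain C where C: "\<And>h o1 v1 x. h absolutely_integrable_on {a..b} \<Longrightarrow> is_sol z h o1 v1 \<Longrightarrow> o1 a = 0 \<Longrightarrow>
     o1 b + of_real (F b) * v1 b = 0 \<Longrightarrow> x \<in> {a..b} \<Longrightarrow>
     cmod (o1 x + of_real (F x) * v1 x) \<le> C * integral {a..b} (\<lambda>s. cmod (h s))" "C \<ge> 0"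
    using dirichlet_sol_bound[OF D] by blast
  have "L2_norm (leb_on a b) f \<le> ((b - a) * C) * L2_norm (leb_on a b) (\<lambda>x. h x - z * f x)"
    if fh: "(f, h) \<in> dirichlet" for f h
  proof -
    define g where "g = (\<lambda>x. h x - z * f x)"
    have f: "f \<in> L2 (leb_on a b)" and h: "h \<in> L2 (leb_on a b)" using fh by (auto simp: dirichlet_def)
    have g: "g \<in> L2 (leb_on a b)" using L2_add[OF h L2_scale[OF f, of "- z"]] by (simp add: g_def)
    obtain o1 v1 where s: "is_sol z g o1 v1" "o1 a = 0"
      "o1 b + of_real (F b) * v1 b = 0" "AE x in leb_on a b. f x = o1 x + of_real (F x) * v1 x"
      using dirichlet_is_sol[OF fh, of z] unfolding g_def by blast
    define I where "I = integral {a..b} (\<lambda>s. cmod (g s))"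
    have I0: "I \<ge> 0" unfolding I_def 
      by (rule integral_nonneg) (use absolutely_integrable_norm[OF L2_abs_int[OF g]] in \<open>auto simp: o_def intro: set_lebesgue_integral_eq_integral(1)\<close>)
    have "AE x in leb_on a b. cmod (f x) \<le> C * I"
      using s(4) unfolding AE_leb_on_iff
      by (rule AE_mp) (use C(1)[OF L2_abs_int[OF g] s(1,2,3)] in \<open>auto intro!: AE_I2 simp: I_def\<close>)
    from L2_norm_le_sup[OF f ab this] C(2) I0
    have "L2_norm (leb_on a b) f \<le> sqrt (b - a) * (C * I)" by simp
    also have "\<dots> \<le> sqrt (b - a) * (C * (sqrt (b - a) * L2_norm (leb_on a b) g))"
      using L2_cauchy_schwarz[OF g ab] C(2) ab unfolding I_def by (intro mult_left_mono) auto
    also have "\<dots> = (b - a) * C * L2_norm (leb_on a b) g" using ab by simp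
    finally show ?thesis by (simp add: g_def)
  qed
  then show "\<exists>C. \<forall>(f, h)\<in>dirichlet. L2_norm (leb_on a b) f \<le> C * L2_norm (leb_on a b) (\<lambda>x. h x - z * f x)"
    by blast
qed

end

text \<open>If \<open>F\<close> vanished almost everywhere, so would every \<open>uu z\<close>, and
  a zero of \<open>char_fun\<close> would have no eigenfunction belonging to it.\<close>

locale sl_nontrivial = sl_system +
  assumes F_nontrivial: "\<not> (AE x in leb_on a b. F x = 0)"
begin

text \<open>If \<open>u\<close> vanished almost everywhere, so would the derivatives of
  \<open>\<omega>\<close> and \<open>v\<close>. These would keep their initial values 0 and 1, and
  \<open>u\<close> would be \<open>F\<close> itself.\<close>

lemma uu_not_AE_zero: "\<not> (AE x in leb_on a b. uu z x = 0)"
proof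
  assume 0: "AE x in leb_on a b. uu z x = 0"
  have z: "AE x in lebesgue. x \<in> {a..b} \<longrightarrow> (of_real (q x) - z) * uu z x = 0"
    using 0 unfolding AE_leb_on_iff by (rule AE_mp) (auto intro!: AE_I2)
  have z': "AE x in lebesgue. x \<in> {a..b} \<longrightarrow> - of_real (F x) * ((of_real (q x) - z) * uu z x) = 0"
    using z by (rule AE_mp) (auto intro!: AE_I2)
  note s = fund_sol(1)[of z, unfolded is_sol_def diff_0_right, folded uu_def]
  have "ac_deriv a b (ve z) (\<lambda>x. 0)" "ac_deriv a b (om z) (\<lambda>x. 0)"
    using ac_deriv_AE_cong[OF s[THEN conjunct2] z] ac_deriv_AE_cong[OF s[THEN conjunct1] z'] by auto
  from this[THEN ac_derivD(2)] have "uu z x = of_real (F x)" if "x \<in> {a..b}" for x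
    using that fund_sol[of z] by (auto simp: uu_def)
  then have "AE x in leb_on a b. F x = 0"
    using 0 unfolding AE_leb_on_iff by (auto elim!: AE_mp intro!: AE_I2)
  then show False using F_nontrivial by simp
qed

lemma eigenvalue_dirichlet_iff: "eigenvalue (leb_on a b) dirichlet z \<longleftrightarrow> char_fun z = 0"
  using not_eigenvalue[of z] uu_eigen[of z] uu_not_AE_zero[of z] unfolding eigenvalue_def by blast

lemma uu_prod_int: "(\<lambda>s. uu z s * uu z' s) absolutely_integrable_on {a..b}"
  by (rule uu_abs_int[OF uu_integrable])

lemma uu_norm_sq_int: "(\<lambda>s. (cmod (uu z s))\<^sup>2) absolutely_integrable_on {a..b}"
  using quasi_L2[OF fund_sol(1) zero_abs_int, of z]
  by (simp add: L2_def abs_int_leb_on_iff uu_def[symmetric])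

lemma uu_norm_sq_pos: "integral {a..b} (\<lambda>s. (cmod (uu z s))\<^sup>2) > 0"
proof -
  have i: "integrable (leb_on a b) (\<lambda>s. (cmod (uu z s))\<^sup>2)"
    using uu_norm_sq_int by (simp add: abs_int_leb_on_iff)
  have "integral\<^sup>L (leb_on a b) (\<lambda>s. (cmod (uu z s))\<^sup>2) \<noteq> 0"
    using integral_nonneg_eq_0_iff_AE[OF i] uu_not_AE_zero[of z] by auto
  moreover have "integral\<^sup>L (leb_on a b) (\<lambda>s. (cmod (uu z s))\<^sup>2) \<ge> 0" by simp
  ultimately show ?thesis using integral_leb_on[OF i] by linarith
qed

text \<open>At a zero, \<open>\<omega>(b) = - F(b) v(b)\<close>; two such pairs are proportional, so
  the Wronskian at \<open>b\<close> vanishes and the Lagrange identity becomes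
  orthogonality.\<close>

lemma lagrange_zeros:
  assumes "char_fun z = 0" "char_fun z' = 0" "z \<noteq> z'"
  shows "integral {a..b} (\<lambda>s. uu z s * uu z' s) = 0"
proof -
  have o: "om z b = - of_real (F b) * ve z b" "om z' b = - of_real (F b) * ve z' b"
    using assms by (auto simp: char_fun_def uu_def add_eq_0_iff)
  have "(z - z') * integral {a..b} (\<lambda>s. uu z s * uu z' s) = 0"
    using lagrange_fund[of b z z'] ab by (simp add: o)
  then show ?thesis using assms(3) by simp
qed

text \<open>The conjugate parameter is a zero too and carries the conjugate solution, so for nonreal
  \<open>z\<close> orthogonality would force the norm of \<open>u\<close> to vanish.\<close>

lemma char_fun_zero_real: assumes "char_fun z = 0" shows "z \<in> \<real>"
proof (rule ccontr)
  assume "z \<notin> \<real>"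
  then have "z \<noteq> cnj z" using Reals_cnj_iff by metis
  moreover have "char_fun (cnj z) = 0" using fund_cnj(3)[of b z] ab assms by (simp add: char_fun_def)
  ultimately have "integral {a..b} (\<lambda>s. uu z s * uu (cnj z) s) = 0" using lagrange_zeros assms by blast
  also have "integral {a..b} (\<lambda>s. uu z s * uu (cnj z) s) = integral {a..b} (\<lambda>s. of_real ((cmod (uu z s))\<^sup>2))"
    by (rule integral_cong) (simp only: fund_cnj complex_norm_square)
  also have "\<dots> = of_real (integral {a..b} (\<lambda>s. (cmod (uu z s))\<^sup>2))"
    using integral_linear[OF set_lebesgue_integral_eq_integral(1)[OF uu_norm_sq_int] bounded_linear_of_real, of z]
    by (simp add: o_def)
  finally show False using uu_norm_sq_pos[of z] by simp
qed

lemma uu_real: "s \<in> {a..b} \<Longrightarrow> uu (of_real t) s = of_real (Re (uu (of_real t) s))"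
  "s \<in> {a..b} \<Longrightarrow> om (of_real t) s = of_real (Re (om (of_real t) s))"
  "s \<in> {a..b} \<Longrightarrow> ve (of_real t) s = of_real (Re (ve (of_real t) s))"
  using fund_cnj[of s "of_real t"] by (auto simp: complex_eq_iff)

text \<open>At \<open>z = t\<close> the solution is real and the integral is a positive squared
  norm; Lipschitz dependence on the parameter keeps it positive nearby. Isolation of the eigenvalues
  and local monotonicity of the angle both rest on this.\<close>

lemma uu_prod_near:
  obtains r where "r > 0" "\<And>z. cmod (z - of_real t) < r \<Longrightarrow> Re (integral {a..b} (\<lambda>s. uu z s * uu (of_real t) s)) > 0"
proof -
  define z0 :: complex where "z0 = of_real t"
  obtain C where C: "C > 0" "\<And>z x. cmod (z - z0) \<le> 1 \<Longrightarrow> x \<in> {a..b} \<Longrightarrow>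
    cmod (om z x - om z0 x) + cmod (ve z x - ve z0 x) \<le> C * cmod (z - z0)"
    using fund_cont_param by blast
  define B where "B = (1 + M) * growth_bound (cmod z0)"
  have B: "B > 0" using M_nonneg growth_bound_pos by (auto simp: B_def)
  define I0 where "I0 = integral {a..b} (\<lambda>s. (cmod (uu z0 s))\<^sup>2)"
  have I0: "I0 > 0" using uu_norm_sq_pos by (simp add: I0_def)
  \<comment> \<open>A Lipschitz constant at \<open>z0\<close> for the integral as a function of
    \<open>z\<close>.\<close>
  define L where "L = (b - a) * ((1 + M) * C * B)"
  have L: "L > 0" using ab M_nonneg C B by (auto simp: L_def)
  have I0': "integral {a..b} (\<lambda>s. uu z0 s * uu z0 s) = of_real I0"
  proof -
    have "integral {a..b} (\<lambda>s. uu z0 s * uu z0 s) = integral {a..b} (\<lambda>s. of_real ((cmod (uu z0 s))\<^sup>2))"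
    proof (rule integral_cong)
      fix s assume "s \<in> {a..b}"
      then have "cnj (uu z0 s) = uu z0 s" using fund_cnj(3)[of s z0] by (simp add: z0_def)
      then show "uu z0 s * uu z0 s = of_real ((cmod (uu z0 s))\<^sup>2)"
        by (simp only: complex_norm_square)
    qed
    also have "\<dots> = of_real I0"
      using integral_linear[OF set_lebesgue_integral_eq_integral(1)[OF uu_norm_sq_int] bounded_linear_of_real, of z0]
      by (simp add: o_def I0_def)
    finally show ?thesis .
  qed
  have "Re (integral {a..b} (\<lambda>s. uu z s * uu z0 s)) > 0" if z: "cmod (z - z0) < min 1 (I0 / L)" for z
  proof -
    define e where "e = cmod (z - z0)"
    have i: "(\<lambda>s. uu z s * uu z0 s) integrable_on {a..b}" "(\<lambda>s. uu z0 s * uu z0 s) integrable_on {a..b}"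
      by (intro set_lebesgue_integral_eq_integral(1) uu_prod_int)+
    have eq: "integral {a..b} (\<lambda>s. uu z s * uu z0 s) - of_real I0
      = integral {a..b} (\<lambda>s. uu z s * uu z0 s - uu z0 s * uu z0 s)"
      unfolding I0'[symmetric] by (rule integral_diff[symmetric]) (use i in auto)
    have "cmod (integral {a..b} (\<lambda>s. uu z s * uu z0 s) - of_real I0) \<le> integral {a..b} (\<lambda>s. (1 + M) * C * B * e)"
      unfolding eq
    proof (rule integral_norm_bound_integral)
      show "(\<lambda>s. uu z s * uu z0 s - uu z0 s * uu z0 s) integrable_on {a..b}" using i by (rule integrable_diff)
      show "(\<lambda>s. (1 + M) * C * B * e) integrable_on {a..b}" by (rule integrable_const_ivl)
      fix s assume s: "s \<in> {a..b}"
      have "uu z s - uu z0 s = (om z s - om z0 s) + of_real (F s) * (ve z s - ve z0 s)"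
        by (simp add: uu_def algebra_simps)
      then have "cmod (uu z s - uu z0 s) \<le> (1 + M) * (cmod (om z s - om z0 s) + cmod (ve z s - ve z0 s))"
        using quasi_bound[OF s] by simp
      also have "\<dots> \<le> (1 + M) * (C * e)"
        using C(2)[of z s] s z M_nonneg by (intro mult_left_mono) (auto simp: e_def)
      finally have "cmod (uu z s - uu z0 s) * cmod (uu z0 s) \<le> (1 + M) * (C * e) * B"
        using uu_bound[OF s, of z0] by (intro mult_mono) (auto simp: B_def intro: order.trans[OF norm_ge_zero])
      then show "cmod (uu z s * uu z0 s - uu z0 s * uu z0 s) \<le> (1 + M) * C * B * e"
        unfolding left_diff_distrib[symmetric] norm_mult by (simp add: mult_ac)
    qed
    also have "\<dots> = L * e" using ab by (simp add: L_def algebra_simps)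
    also have "\<dots> < I0" using z L by (simp add: e_def field_simps)
    finally have "cmod (integral {a..b} (\<lambda>s. uu z s * uu z0 s) - of_real I0) < I0" .
    then show ?thesis using complex_Re_le_cmod[of "of_real I0 - integral {a..b} (\<lambda>s. uu z s * uu z0 s)"]
      by (simp add: norm_minus_commute)
  qed
  then show ?thesis using that[of "min 1 (I0 / L)"] I0 L by (simp add: z0_def)
qed

lemma spectrum_dirichlet: "op_spectrum (leb_on a b) dirichlet = {z. char_fun z = 0}"
  using resolvent_dirichlet eigenvalue_dirichlet_iff
  by (auto simp: op_spectrum_def resolvent_set_def)

text \<open>Isolation comes from orthogonality: a second zero close to the first would make the
  product integral vanish where \<open>uu_prod_near\<close> keeps it positive.\<close>

lemma purely_discrete_dirichlet: "purely_discrete_spectrum (leb_on a b) dirichlet"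
  unfolding purely_discrete_spectrum_def spectrum_dirichlet
proof (intro ballI conjI)
  fix z assume "z \<in> {z. char_fun z = 0}"
  then have z: "char_fun z = 0" by simp
  show "eigenvalue (leb_on a b) dirichlet z" using z by (simp add: eigenvalue_dirichlet_iff)
  show "finite_multiplicity (leb_on a b) dirichlet z" using z by (rule finite_multiplicity_dirichlet)
  obtain t where t: "z = of_real t" using char_fun_zero_real[OF z] by (auto elim: Reals_cases)
  obtain r where r: "r > 0" "\<And>z. cmod (z - of_real t) < r \<Longrightarrow> Re (integral {a..b} (\<lambda>s. uu z s * uu (of_real t) s)) > 0"
    using uu_prod_near by blast
  have "z' = z" if "char_fun z' = 0" "dist z' z < r" for z'
  proof (rule ccontr)
    assume "z' \<noteq> z"
    from lagrange_zeros[OF that(1) z this] r(2)[of z'] that(2) t show False by (simp add: dist_norm)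
  qed
  then have "ball z r \<inter> {z. char_fun z = 0} = {z}" using z r(1) by (auto simp: dist_commute)
  then show "z isolated_in {z. char_fun z = 0}"
    using z unfolding isolated_in_def by (intro conjI exI[of _ "ball z r"]) auto
qed

end

section \<open>Rotation of the fundamental solution and the eigenvalue count\<close>

text \<open>The integral of \<open>Z' / Z\<close> is a continuous logarithm of
  \<open>Z / Z c\<close>: multiplying \<open>Z\<close> by the exponential of its negative produces
  derivative zero.\<close>

lemma ac_lift:
  fixes Z Z' :: "real \<Rightarrow> complex"
  assumes Z: "ac_deriv c d Z Z'" and nz: "\<And>x. x \<in> {c..d} \<Longrightarrow> Z x \<noteq> 0"
  shows "(\<lambda>s. Z' s / Z s) absolutely_integrable_on {c..d}"
    and "x \<in> {c..d} \<Longrightarrow> Z x = Z c * exp (integral {c..x} (\<lambda>s. Z' s / Z s))"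
proof -
  have "continuous_on {c..d} (\<lambda>x. inverse (Z x))"
    using nz by (intro continuous_intros ac_continuous[OF Z]) auto
  from abs_int_continuous_mult[OF ac_derivD(1)[OF Z] this]
  show i: "(\<lambda>s. Z' s / Z s) absolutely_integrable_on {c..d}" by (simp add: divide_inverse mult.commute)
  define L where "L = (\<lambda>x. integral {c..x} (\<lambda>s. Z' s / Z s))"
  have L: "ac_deriv c d L (\<lambda>s. Z' s / Z s)" using ac_integral[OF i, of 0] by (simp add: L_def)
  have "ac_deriv c d (\<lambda>x. Z x * exp (-1 * L x)) (\<lambda>x. 0)"
    by (rule ac_cong[OF ac_mult[OF Z ac_exp[OF ac_mult_left[OF L, of "-1"]]]]) (use nz in auto)
  from ac_derivD(2)[OF this, of x] show "Z x = Z c * exp (integral {c..x} (\<lambda>s. Z' s / Z s))" if "x \<in> {c..d}"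
    using that by (simp add: L_def exp_minus field_simps)
qed

text \<open>As long as the quotient avoids the nonpositive axis, its principal logarithm is
  continuous. It differs from the difference of the two lifts by a continuous function with discrete
  values, hence by a constant. This compares rotations without counting full turns.\<close>

lemma rot_Ln:
  fixes Z1 Z2 :: "real \<Rightarrow> complex"
  assumes Z1: "ac_deriv c d Z1 Z1'" and Z2: "ac_deriv c d Z2 Z2'" and cd: "c \<le> d"
    and nr: "\<And>x. x \<in> {c..d} \<Longrightarrow> Z1 x / Z2 x \<notin> \<real>\<^sub>\<le>\<^sub>0"
  shows "integral {c..d} (\<lambda>s. Z1' s / Z1 s) - integral {c..d} (\<lambda>s. Z2' s / Z2 s)
    = Ln (Z1 d / Z2 d) - Ln (Z1 c / Z2 c)"
proof -
  have nz: "Z1 x \<noteq> 0" "Z2 x \<noteq> 0" if "x \<in> {c..d}" for x using nr[OF that] by auto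
  note l1 = ac_lift[OF Z1 nz(1)] and l2 = ac_lift[OF Z2 nz(2)]
  define L1 where "L1 x = integral {c..x} (\<lambda>s. Z1' s / Z1 s)" for x
  define L2 where "L2 x = integral {c..x} (\<lambda>s. Z2' s / Z2 s)" for x
  have c1: "continuous_on {c..d} L1" "continuous_on {c..d} L2"
    unfolding L1_def L2_def by (intro abs_int_indefinite_continuous l1(1) l2(1); assumption)+
  define D where "D x = Ln (Z1 x / Z2 x) - Ln (Z1 c / Z2 c) - (L1 x - L2 x)" for x
  have Dc: "continuous_on {c..d} D"
    unfolding D_def using nr nz
    by (intro continuous_intros continuous_on_Ln ac_continuous[OF Z1] ac_continuous[OF Z2] c1) auto
  have expD: "exp (D x) = 1" if x: "x \<in> {c..d}" for x
  proof -
    have cc: "c \<in> {c..d}" using cd by auto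
    have "exp (D x) = (Z1 x / Z2 x) / (Z1 c / Z2 c) / (exp (L1 x) / exp (L2 x))"
      using nz[OF x] nz[OF cc] by (simp add: D_def exp_diff)
    also have "\<dots> = 1"
      using l1(2)[OF _ x] l2(2)[OF _ x] nz[OF cc] nz[OF x] unfolding L1_def L2_def by simp
    finally show ?thesis .
  qed
  have "D constant_on {c..d}"
  proof (rule continuous_discrete_range_constant[OF _ Dc])
    show "connected {c..d}" by simp
    fix x assume x: "x \<in> {c..d}"
    \<comment> \<open>Values with exponential 1 are multiples of \<open>2 pi i\<close>; a gap of
      \<open>pi\<close> already makes the range discrete.\<close>
    have "pi \<le> norm (D y - D x)" if "y \<in> {c..d}" "D y \<noteq> D x" for y
    proof -
      have "exp (D y - D x) = 1" using expD[OF x] expD[OF that(1)] by (simp add: exp_diff)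
      then obtain n :: int where "Re (D y - D x) = 0" "Im (D y - D x) = of_int (2 * n) * pi"
        unfolding exp_eq_1 by blast
      moreover from this have "n \<noteq> 0" using that(2) by (auto simp: complex_eq_iff)
      then have "pi * 1 \<le> pi * \<bar>of_int (2 * n)\<bar>" by (intro mult_left_mono) auto
      ultimately have "pi \<le> \<bar>Im (D y - D x)\<bar>" by (simp add: abs_mult mult.commute)
      then show ?thesis using abs_Im_le_cmod order.trans by blast
    qed
    then show "\<exists>e>0. \<forall>y. y \<in> {c..d} \<and> D y \<noteq> D x \<longrightarrow> e \<le> norm (D y - D x)"
      by (intro exI[of _ pi]) auto
  qed
  then have "D d = D c" unfolding constant_on_def using cd by fastforce
  then show ?thesis by (simp add: D_def L1_def L2_def algebra_simps)
qed

text \<open>The maximum of \<open>h\<close> on \<open>[s,e]\<close> can only be attained at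
  \<open>e\<close>, since just to the right of any other point \<open>h\<close> takes a larger
  value.\<close>

lemma strict_mono_if_local:
  fixes h :: "real \<Rightarrow> real"
  assumes cont: "continuous_on UNIV h"
    and loc: "\<And>s. \<exists>r>0. \<forall>t. \<bar>t - s\<bar> < r \<and> t \<noteq> s \<longrightarrow> (t - s) * (h t - h s) > 0"
  shows "strict_mono h"
proof (rule strict_monoI)
  fix s e :: real assume se: "s < e"
  have right: "\<exists>t>s. t \<le> e \<and> h t > h s" if "s < e" for s
  proof -
    obtain r where r: "r > 0" "\<And>t. \<bar>t - s\<bar> < r \<Longrightarrow> t \<noteq> s \<Longrightarrow> (t - s) * (h t - h s) > 0" using loc by meson
    define t where "t = min e (s + r / 2)"
    have t: "s < t" "t \<le> e" "\<bar>t - s\<bar> < r" using r(1) that by (auto simp: t_def)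
    from r(2)[of t] t have "h t - h s > 0" by (simp add: zero_less_mult_iff)
    then show ?thesis using t by auto
  qed
  obtain c where c: "c \<in> {s..e}" "\<And>t. t \<in> {s..e} \<Longrightarrow> h t \<le> h c"
    using continuous_attains_sup[of "{s..e}" h] continuous_on_subset[OF cont] se by auto
  have "c = e"
  proof (rule ccontr)
    assume "c \<noteq> e"
    then have "c < e" using c by auto
    from right[OF this] obtain t where "t > c" "t \<le> e" "h t > h c" by blast
    then show False using c(1) c(2)[of t] by auto
  qed
  moreover obtain t where "t > s" "t \<le> e" "h t > h s" using right[OF se] by blast
  ultimately show "h s < h e" using c(2)[of t] by auto
qed

text \<open>\<open>h\<close> carries \<open>S\<close> bijectively onto the integers between
  \<open>h s\<close> and \<open>h e\<close>, whose number differs from \<open>h e - h s\<close> by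
  at most one.\<close>

lemma card_integer_level:
  fixes h :: "real \<Rightarrow> real"
  assumes cont: "continuous_on UNIV h" and mono: "strict_mono h" and "s \<le> e"
  defines "S \<equiv> {t \<in> {s..e}. h t \<in> \<int>}"
  shows "finite S" "\<bar>real (card S) - (h e - h s)\<bar> \<le> 1"
proof -
  have le: "h s \<le> h e" using mono assms(3) by (simp add: strict_mono_less_eq)
  have img: "(\<lambda>t. \<lfloor>h t\<rfloor>) ` S = {\<lceil>h s\<rceil>..\<lfloor>h e\<rfloor>}"
  proof safe
    fix t assume "t \<in> S"
    then have "s \<le> t" "t \<le> e" "h t \<in> \<int>" by (auto simp: S_def)
    moreover from this have "h s \<le> h t" "h t \<le> h e" using mono by (auto simp: strict_mono_less_eq)
    ultimately show "\<lfloor>h t\<rfloor> \<in> {\<lceil>h s\<rceil>..\<lfloor>h e\<rfloor>}"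
      by (auto elim!: Ints_cases simp: ceiling_le_iff le_floor_iff)
  next
    fix n assume "n \<in> {\<lceil>h s\<rceil>..\<lfloor>h e\<rfloor>}"
    then have "h s \<le> of_int n" "of_int n \<le> h e" by (auto simp: ceiling_le_iff le_floor_iff)
    then obtain t where "s \<le> t" "t \<le> e" "h t = of_int n"
      using IVT'[of h s "of_int n" e] continuous_on_subset[OF cont] assms(3) by auto
    then show "n \<in> (\<lambda>t. \<lfloor>h t\<rfloor>) ` S" by (intro image_eqI[of _ _ t]) (auto simp: S_def)
  qed
  have inj: "inj_on (\<lambda>t. \<lfloor>h t\<rfloor>) S"
  proof (rule inj_onI)
    fix x y assume "x \<in> S" "y \<in> S" "\<lfloor>h x\<rfloor> = \<lfloor>h y\<rfloor>"
    then have "h x = h y" by (auto simp: S_def elim!: Ints_cases)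
    then show "x = y" using mono by (simp add: strict_mono_eq)
  qed
  show "finite S" using img inj by (metis finite_atLeastAtMost_int finite_imageD)
  have "card S = nat (\<lfloor>h e\<rfloor> - \<lceil>h s\<rceil> + 1)" using card_image[OF inj] img by simp
  moreover have "\<lfloor>h e\<rfloor> - \<lceil>h s\<rceil> + 1 \<ge> 0" using le by linarith
  ultimately have "real (card S) = of_int (\<lfloor>h e\<rfloor> - \<lceil>h s\<rceil> + 1)" by simp
  then show "\<bar>real (card S) - (h e - h s)\<bar> \<le> 1" by linarith
qed

section \<open>The angle as a function of the spectral parameter\<close>

context sl_nontrivial
begin

definition om_re :: "real \<Rightarrow> real \<Rightarrow> real" where "om_re t x = Re (om (of_real t) x)"
definition ve_re :: "real \<Rightarrow> real \<Rightarrow> real" where "ve_re t x = Re (ve (of_real t) x)"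
definition uu_re :: "real \<Rightarrow> real \<Rightarrow> real" where "uu_re t x = om_re t x + F x * ve_re t x"

lemma Re_uu: "Re (uu (of_real t) x) = uu_re t x" by (simp add: uu_re_def om_re_def ve_re_def uu_def)

lemma om_ve_re_ac:
  "ac_deriv a b (om_re t) (\<lambda>s. F s * (t - q s) * uu_re t s)"
  "ac_deriv a b (ve_re t) (\<lambda>s. (q s - t) * uu_re t s)"
proof -
  note s = fund_sol(1)[of "of_real t", unfolded is_sol_def diff_0_right, folded uu_def]
  show "ac_deriv a b (om_re t) (\<lambda>s. F s * (t - q s) * uu_re t s)"
    by (rule ac_cong[OF ac_linear[OF s[THEN conjunct1] bounded_linear_Re]]) (auto simp: om_re_def Re_uu algebra_simps)
  show "ac_deriv a b (ve_re t) (\<lambda>s. (q s - t) * uu_re t s)"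
    by (rule ac_cong[OF ac_linear[OF s[THEN conjunct2] bounded_linear_Re]]) (auto simp: ve_re_def Re_uu algebra_simps)
qed

text \<open>With the quasi-derivative as real part, the path starts at 1 for every \<open>t\<close>,
  so all angles start at 0 and an increase of \<open>\<omega>\<close> at positive \<open>v\<close>
  turns the path counterclockwise.\<close>

definition path :: "real \<Rightarrow> real \<Rightarrow> complex" where "path t x = Complex (ve_re t x) (om_re t x)"
definition path' :: "real \<Rightarrow> real \<Rightarrow> complex" where
  "path' t s = Complex ((q s - t) * uu_re t s) (F s * (t - q s) * uu_re t s)"

lemma ac_Complex:
  assumes "ac_deriv c d f f'" "ac_deriv c d g g'"
  shows "ac_deriv c d (\<lambda>x. Complex (f x) (g x)) (\<lambda>x. Complex (f' x) (g' x))"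
proof -
  have 1: "bounded_linear (\<lambda>x::real. \<i> * of_real x)"
    by (intro bounded_linear_mult_right[THEN bounded_linear_compose] bounded_linear_of_real)
  show ?thesis
    by (rule ac_cong[OF ac_add[OF ac_linear[OF assms(1) bounded_linear_of_real] ac_linear[OF assms(2) 1]]])
      (auto simp: complex_eq_iff)
qed

lemma path_ac: "ac_deriv a b (path t) (path' t)"
  unfolding path_def path'_def by (intro ac_Complex om_ve_re_ac)

lemma om_ve_re_nonzero: "x \<in> {a..b} \<Longrightarrow> om_re t x \<noteq> 0 \<or> ve_re t x \<noteq> 0"
  using fund_nonzero[of x "of_real t"] uu_real(2,3)[of x t] by (auto simp: om_re_def ve_re_def)

lemma path_nonzero: "x \<in> {a..b} \<Longrightarrow> path t x \<noteq> 0"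
  using om_ve_re_nonzero[of x t] by (auto simp: path_def complex_eq_iff)

lemma path_a: "path t a = 1" using fund_sol[of "of_real t"] by (simp add: path_def om_re_def ve_re_def complex_eq_iff)

definition log_path :: "real \<Rightarrow> real \<Rightarrow> complex" where "log_path t x = integral {a..x} (\<lambda>s. path' t s / path t s)"
definition angle :: "real \<Rightarrow> real \<Rightarrow> real" where "angle t x = Im (log_path t x)"

lemma path_int: "(\<lambda>s. path' t s / path t s) absolutely_integrable_on {a..b}"
  by (rule ac_lift(1)[OF path_ac path_nonzero])

lemma path_exp: "x \<in> {a..b} \<Longrightarrow> path t x = exp (log_path t x)"
  using ac_lift(2)[OF path_ac path_nonzero, of x t] by (simp add: path_a log_path_def)

text \<open>Multiplied by \<open>cos (arctan (F b))\<close>, the value \<open>\<omega> + F v\<close>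
  at \<open>b\<close> becomes the radius times the sine of the angle shifted by
  \<open>arctan (F b)\<close>, and this shift does not depend on \<open>t\<close>.\<close>

lemma char_fun_zero_iff_angle:
  "char_fun (of_real t) = 0 \<longleftrightarrow> (angle t b + arctan (F b)) / pi \<in> \<int>"
proof -
  define r where "r = exp (Re (log_path t b))"
  have bb: "b \<in> {a..b}" using ab by auto
  have "ve_re t b = r * cos (angle t b)" "om_re t b = r * sin (angle t b)"
    using path_exp[OF bb, of t] by (auto simp: path_def complex_eq_iff Re_exp Im_exp r_def angle_def)
  then have u: "uu_re t b * cos (arctan (F b)) = r * sin (angle t b + arctan (F b))"
    using tan_arctan[of "F b"] cos_arctan_not_zero[of "F b"]
    by (simp add: uu_re_def sin_add tan_def field_simps)
  have "char_fun (of_real t) = of_real (uu_re t b)" using uu_real(1)[OF bb, of t] by (simp add: char_fun_def Re_uu)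
  then have "char_fun (of_real t) = 0 \<longleftrightarrow> uu_re t b * cos (arctan (F b)) = 0" by (simp add: cos_arctan_not_zero)
  also have "\<dots> \<longleftrightarrow> sin (angle t b + arctan (F b)) = 0" unfolding u by (simp add: r_def)
  also have "\<dots> \<longleftrightarrow> (angle t b + arctan (F b)) / pi \<in> \<int>"
    unfolding sin_zero_iff_int2 by (auto simp: field_simps elim!: Ints_cases intro: Ints_of_int)
  finally show ?thesis .
qed

lemma path_cont_param:
  obtains C where "C > 0" "\<And>s x. \<bar>s - t\<bar> \<le> 1 \<Longrightarrow> x \<in> {a..b} \<Longrightarrow> cmod (path s x - path t x) \<le> C * \<bar>s - t\<bar>"
proof -
  obtain C where C: "C > 0" "\<And>z x. cmod (z - of_real t) \<le> 1 \<Longrightarrow> x \<in> {a..b} \<Longrightarrow>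
    cmod (om z x - om (of_real t) x) + cmod (ve z x - ve (of_real t) x) \<le> C * cmod (z - of_real t)"
    using fund_cont_param by blast
  have "cmod (path s x - path t x) \<le> C * \<bar>s - t\<bar>" if "\<bar>s - t\<bar> \<le> 1" "x \<in> {a..b}" for s x
  proof -
    have st: "cmod (of_real s - of_real t) = \<bar>s - t\<bar>" by (metis norm_of_real of_real_diff)
    have "cmod (path s x - path t x) \<le> \<bar>ve_re s x - ve_re t x\<bar> + \<bar>om_re s x - om_re t x\<bar>"
      using cmod_le[of "path s x - path t x"] by (simp add: path_def)
    also have "\<dots> \<le> cmod (ve s x - ve t x) + cmod (om s x - om t x)"
      using abs_Re_le_cmod[of "ve s x - ve t x"] abs_Re_le_cmod[of "om s x - om t x"] by (simp add: ve_re_def om_re_def)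
    also have "\<dots> \<le> C * \<bar>s - t\<bar>" using C(2)[of "of_real s" x] that st by simp
    finally show ?thesis .
  qed
  then show ?thesis using that C by blast
qed

text \<open>For \<open>s\<close> near \<open>t\<close> the quotient of the two paths lies in the
  right half plane for all \<open>x\<close> simultaneously. Both paths start at 1, so the difference
  of the angles at \<open>b\<close> is the principal argument of the final quotient.\<close>

lemma angle_increment_near:
  obtains r where "r > 0" "\<And>s. \<bar>s - t\<bar> < r \<Longrightarrow> Re (path s b / path t b) > 0 \<and> angle s b - angle t b = Im (Ln (path s b / path t b))"
proof -
  obtain C where C: "C > 0" "\<And>s x. \<bar>s - t\<bar> \<le> 1 \<Longrightarrow> x \<in> {a..b} \<Longrightarrow> cmod (path s x - path t x) \<le> C * \<bar>s - t\<bar>"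
    using path_cont_param by blast
  have "continuous_on {a..b} (\<lambda>x. cmod (path t x))" by (intro continuous_intros ac_continuous[OF path_ac])
  then obtain x0 where x0: "x0 \<in> {a..b}" "\<And>x. x \<in> {a..b} \<Longrightarrow> cmod (path t x0) \<le> cmod (path t x)"
    using continuous_attains_inf[of "{a..b}" "\<lambda>x. cmod (path t x)"] ab by auto
  \<comment> \<open>The minimal radius of the reference path; a deviation below \<open>m\<close>
    keeps the quotient within distance 1 of 1.\<close>
  define m where "m = cmod (path t x0)"
  have m: "m > 0" using path_nonzero[OF x0(1)] by (simp add: m_def)
  have pos: "Re (path s x / path t x) > 0" if s: "\<bar>s - t\<bar> < min 1 (m / C)" and x: "x \<in> {a..b}" for s x
  proof -
    have "cmod (path s x - path t x) \<le> C * \<bar>s - t\<bar>" using C(2) s x by auto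
    also have "\<dots> < m" using s C(1) by (simp add: field_simps)
    also have "\<dots> \<le> cmod (path t x)" using x0(2)[OF x] by (simp add: m_def)
    finally have "cmod (path s x / path t x - 1) < 1"
      using path_nonzero[OF x, of t] by (simp add: diff_divide_distrib[symmetric] norm_divide field_simps divide_simps)
    then show ?thesis using complex_Re_le_cmod[of "1 - path s x / path t x"] by (simp add: norm_minus_commute)
  qed
  have "angle s b - angle t b = Im (Ln (path s b / path t b))" if s: "\<bar>s - t\<bar> < min 1 (m / C)" for s
  proof -
    have "path s x / path t x \<notin> \<real>\<^sub>\<le>\<^sub>0" if "x \<in> {a..b}" for x
      using pos[OF s that] by (auto simp: complex_nonpos_Reals_iff)
    from rot_Ln[OF path_ac path_ac _ this] ab have "log_path s b - log_path t b = Ln (path s b / path t b)"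
      by (simp add: log_path_def path_a)
    from arg_cong[OF this, of Im] show ?thesis by (simp add: angle_def)
  qed
  then show ?thesis using that[of "min 1 (m / C)"] m C(1) pos ab by auto
qed

lemma angle_continuous: "continuous_on UNIV (\<lambda>t. angle t b)"
  unfolding continuous_on_eq_continuous_at[OF open_UNIV]
proof
  fix t
  obtain r where r: "r > 0" "\<And>s. \<bar>s - t\<bar> < r \<Longrightarrow> Re (path s b / path t b) > 0 \<and> angle s b - angle t b = Im (Ln (path s b / path t b))"
    using angle_increment_near by blast
  obtain C where C: "C > 0" "\<And>s x. \<bar>s - t\<bar> \<le> 1 \<Longrightarrow> x \<in> {a..b} \<Longrightarrow> cmod (path s x - path t x) \<le> C * \<bar>s - t\<bar>"
    using path_cont_param by blast
  have bb: "b \<in> {a..b}" using ab by auto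
  have "((\<lambda>s. path s b - path t b) \<longlongrightarrow> 0) (at t)"
  proof (rule Lim_null_comparison)
    show "\<forall>\<^sub>F s in at t. norm (path s b - path t b) \<le> C * \<bar>s - t\<bar>"
      unfolding eventually_at using C(2)[OF _ bb] by (intro exI[of _ 1]) (auto simp: dist_real_def)
    show "((\<lambda>s. C * \<bar>s - t\<bar>) \<longlongrightarrow> 0) (at t)" by (auto intro!: tendsto_eq_intros)
  qed
  then have "((\<lambda>s. path s b) \<longlongrightarrow> path t b) (at t)" by (simp add: LIM_zero_iff)
  then have "((\<lambda>s. path s b / path t b) \<longlongrightarrow> 1) (at t)"
    using path_nonzero[OF bb, of t] by (auto intro!: tendsto_eq_intros)
  then have "((\<lambda>s. Ln (path s b / path t b)) \<longlongrightarrow> Ln 1) (at t)"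
    by (rule tendsto_Ln) simp
  from tendsto_Im[OF this] have "((\<lambda>s. Im (Ln (path s b / path t b))) \<longlongrightarrow> 0) (at t)" by simp
  moreover have "\<forall>\<^sub>F s in at t. Im (Ln (path s b / path t b)) = angle s b - angle t b"
    unfolding eventually_at using r by (intro exI[of _ r]) (auto simp: dist_real_def)
  ultimately have "((\<lambda>s. angle s b - angle t b) \<longlongrightarrow> 0) (at t)" by (rule Lim_transform_eventually)
  then show "isCont (\<lambda>t. angle t b) t" by (simp add: isCont_def LIM_zero_iff)
qed

text \<open>The imaginary part of \<open>path s b / path t b\<close> is the Wronskian at
  \<open>b\<close> over a positive number. By the Lagrange identity and \<open>uu_prod_near\<close>
  it has the sign of \<open>s - t\<close>, and an angle strictly between \<open>- pi\<close> and
  \<open>pi\<close> has the sign of its sine.\<close>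

lemma angle_strict_mono: "strict_mono (\<lambda>t. angle t b)"
proof (rule strict_mono_if_local[OF angle_continuous])
  fix t
  have bb: "b \<in> {a..b}" using ab by auto
  obtain r where r: "r > 0" "\<And>s. \<bar>s - t\<bar> < r \<Longrightarrow> Re (path s b / path t b) > 0 \<and> angle s b - angle t b = Im (Ln (path s b / path t b))"
    using angle_increment_near by blast
  obtain r' where r': "r' > 0" "\<And>z. cmod (z - of_real t) < r' \<Longrightarrow> Re (integral {a..b} (\<lambda>s. uu z s * uu (of_real t) s)) > 0"
    using uu_prod_near by blast
  have "(s - t) * (angle s b - angle t b) > 0" if s: "\<bar>s - t\<bar> < min r r'" "s \<noteq> t" for s
  proof -
    have "cmod (of_real s - of_real t) = \<bar>s - t\<bar>" by (metis norm_of_real of_real_diff)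
    then have J: "Re (integral {a..b} (\<lambda>x. uu s x * uu t x)) > 0" (is "Re ?J > 0") using r'(2)[of "of_real s"] s by simp
    define w where "w = path s b / path t b"
    have n: "(cmod (path t b))\<^sup>2 > 0" using path_nonzero[OF bb, of t] by simp
    have "om_re s b * ve_re t b - om_re t b * ve_re s b = Re ((of_real s - of_real t) * ?J)"
      unfolding lagrange_fund[OF bb, symmetric]
      using uu_real(2,3)[OF bb, of s] uu_real(2,3)[OF bb, of t] 
      by (simp add: om_re_def ve_re_def) (metis Im_complex_of_real diff_zero mult_zero_left)
    also have "\<dots> = (s - t) * Re ?J" by simp
    finally have *: "om_re s b * ve_re t b - om_re t b * ve_re s b = (s - t) * Re ?J" .
    have "Im w = (om_re s b * ve_re t b - om_re t b * ve_re s b) / (cmod (path t b))\<^sup>2"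
      by (simp add: w_def Im_divide cmod_power2 path_def mult.commute)
    then have "Im w * (cmod (path t b))\<^sup>2 = (s - t) * Re ?J"
      using n unfolding * by simp
    then have "(s - t) * Im w * (cmod (path t b))\<^sup>2 = ((s - t) * (s - t)) * Re ?J"
      by (simp add: mult.assoc)
    moreover have "(s - t) * (s - t) > 0" using s(2) by (simp add: zero_less_mult_iff) linarith
    ultimately have "(s - t) * Im w * (cmod (path t b))\<^sup>2 > 0" using J by (metis mult_pos_pos)
    then have 1: "(s - t) * Im w > 0" using n by (simp add: zero_less_mult_iff)
    have w: "Re w > 0" "angle s b - angle t b = Im (Ln w)" using r(2)[of s] s by (auto simp: w_def)
    then have w0: "w \<noteq> 0" by auto
    define A where "A = Im (Ln w)"
    have A: "\<bar>A\<bar> < pi" using Im_Ln_le_pi[OF w0] mpi_less_Im_Ln[OF w0] Re_Ln_pos_lt_imp[OF w(1)] pi_gt_zero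
      unfolding A_def by linarith
    have "Im w = exp (Re (Ln w)) * sin A" using Im_exp[of "Ln w"] w0 by (simp add: A_def)
    then have "exp (Re (Ln w)) * ((s - t) * sin A) > 0" using 1 by (simp add: algebra_simps)
    then have "(s - t) * sin A > 0" by (simp add: zero_less_mult_iff)
    moreover have "sin A > 0 \<Longrightarrow> A > 0" using sin_ge_zero[of "- A"] A by (cases "A > 0") auto
    moreover have "sin A < 0 \<Longrightarrow> A < 0" using sin_ge_zero[of A] A by (cases "A < 0") auto
    ultimately show ?thesis unfolding w(2) A_def[symmetric] by (auto simp: zero_less_mult_iff)
  qed
  then show "\<exists>r>0. \<forall>s. \<bar>s - t\<bar> < r \<and> s \<noteq> t \<longrightarrow> (s - t) * (angle s b - angle t b) > 0"
    using r(1) r'(1) by (intro exI[of _ "min r r'"]) auto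
qed

lemma eigenvalues_between_angle:
  "eigenvalues_between (leb_on a b) dirichlet t = {s \<in> {min 0 t..max 0 t}. (angle s b + arctan (F b)) / pi \<in> \<int>}"
  by (auto simp: eigenvalues_between_def eigenvalue_dirichlet_iff char_fun_zero_iff_angle closed_segment_eq_real_ivl)

lemma eigenvalue_count_angle:
  "finite (eigenvalues_between (leb_on a b) dirichlet t)"
  "\<bar>real (eigenvalue_count (leb_on a b) dirichlet t) - \<bar>angle t b - angle 0 b\<bar> / pi\<bar> \<le> 1"
proof -
  define h where "h s = (angle s b + arctan (F b)) / pi" for s
  have hc: "continuous_on UNIV h" unfolding h_def by (intro continuous_intros angle_continuous) auto
  have hm: "strict_mono h"
    by (rule strict_monoI) (use angle_strict_mono in \<open>auto simp: h_def strict_mono_def divide_strict_right_mono\<close>)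
  have le: "min 0 t \<le> max 0 t" by simp
  note * = card_integer_level[OF hc hm le]
  have "h (max 0 t) - h (min 0 t) = \<bar>angle t b - angle 0 b\<bar> / pi"
  proof (cases "0 \<le> t")
    case True
    then have "angle 0 b \<le> angle t b" using strict_mono_less_eq[OF angle_strict_mono, of 0 t] by simp
    then show ?thesis using True by (simp add: h_def field_simps)
  next
    case False
    then have "angle t b \<le> angle 0 b" using strict_mono_less_eq[OF angle_strict_mono, of t 0] by simp
    then show ?thesis using False by (simp add: h_def field_simps)
  qed
  then show "finite (eigenvalues_between (leb_on a b) dirichlet t)"
    "\<bar>real (eigenvalue_count (leb_on a b) dirichlet t) - \<bar>angle t b - angle 0 b\<bar> / pi\<bar> \<le> 1"
    using * by (auto simp: eigenvalues_between_angle h_def eigenvalue_count_def)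
qed

end

section \<open>Rotation estimates on short pieces\<close>

text \<open>The error of a frame is controlled only in the interior of a piece, because jumps are
  put at its end points; for the integrals this makes no difference.\<close>

lemma integral_le_open:
  fixes f g :: "real \<Rightarrow> real"
  assumes "f integrable_on {c..d}" "g integrable_on {c..d}" "\<And>x. x \<in> {c<..<d} \<Longrightarrow> f x \<le> g x"
  shows "integral {c..d} f \<le> integral {c..d} g"
proof -
  have "integral {c<..<d} f \<le> integral {c<..<d} g"
    by (rule integral_le) (use assms in \<open>auto simp: integrable_on_open_interval_real\<close>)
  then show ?thesis by (simp add: integral_open_interval_real)
qed

text \<open>\<open>r d - r c\<close> is an additive cost, at most \<open>B\<close> on every piece
  where \<open>V\<close> oscillates little. Induction on the number of levels: each cut is made
  where \<open>V\<close> leaves the lowest level. A jump of \<open>V\<close> larger than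
  \<open>\<eta>\<close> can sit at a cut, where the oscillation over the open pieces does not see
  it.\<close>

lemma level_split:
  fixes r V :: "real \<Rightarrow> real"
  assumes "c \<le> d" and mono: "\<And>x y. c \<le> x \<Longrightarrow> x \<le> y \<Longrightarrow> y \<le> d \<Longrightarrow> V x \<le> V y" and \<eta>: "\<eta> > 0" "B \<ge> 0"
    and small: "\<And>c' d'. c \<le> c' \<Longrightarrow> c' \<le> d' \<Longrightarrow> d' \<le> d \<Longrightarrow>
       (\<And>x y. c' < x \<Longrightarrow> x \<le> y \<Longrightarrow> y < d' \<Longrightarrow> V y - V x \<le> \<eta>) \<Longrightarrow> r d' - r c' \<le> B"
    and osc: "\<And>x y. c < x \<Longrightarrow> x \<le> y \<Longrightarrow> y < d \<Longrightarrow> V y - V x \<le> real n * \<eta>"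
  shows "r d - r c \<le> (real n + 1) * B"
  using assms
proof (induction n arbitrary: c)
  case 0
  have "r d - r c \<le> B"
  proof (rule "0.prems"(5))
    show "c \<le> d" by fact
    show "V y - V x \<le> \<eta>" if "c < x" "x \<le> y" "y < d" for x y
      using "0.prems"(6)[OF that] \<eta>(1) by simp
  qed auto
  then show ?case by simp
next
  case (Suc n)
  show ?case
  proof (cases "c = d")
    case True then show ?thesis using \<eta>(2) by simp
  next
    case False
    with Suc.prems(1) have cd: "c < d" by simp
    define L where "L = Inf (V ` {c<..<d})"
    have bdd: "bdd_below (V ` {c<..<d})"
      by (rule bdd_belowI[of _ "V c"]) (use Suc.prems(2) in auto)
    have ne: "V ` {c<..<d} \<noteq> {}" using cd by auto
    have L: "L \<le> V x" if "c < x" "x < d" for x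
      unfolding L_def by (rule cInf_lower[OF _ bdd]) (use that in auto)
    have LU: "V y \<le> L + (real n + 1) * \<eta>" if y: "c < y" "y < d" for y
    proof -
      have "V y - (real n + 1) * \<eta> \<le> L" unfolding L_def
      proof (rule cInf_greatest[OF ne])
        fix v assume "v \<in> V ` {c<..<d}"
        then obtain x where x: "v = V x" "c < x" "x < d" by auto
        show "V y - (real n + 1) * \<eta> \<le> v"
        proof (cases "x \<le> y")
          case True then show ?thesis using Suc.prems(6)[of x y] x y by (simp add: algebra_simps)
        next
          case False
          then have "V y \<le> V x" using Suc.prems(2) x y by auto
          moreover have "0 \<le> (real n + 1) * \<eta>" using \<eta>(1) by simp
          ultimately show ?thesis using x by linarith
        qed
      qed
      then show ?thesis by simp
    qed
    define S where "S = {x \<in> {c<..<d}. V x \<le> L + \<eta>}"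
    have Sne: "S \<noteq> {}"
    proof -
      have "\<exists>v\<in>V ` {c<..<d}. v < L + \<eta>"
        using cInf_lessD[OF ne, of "L + \<eta>"] \<eta>(1) by (auto simp: L_def)
      then show ?thesis by (auto simp: S_def)
    qed
    have Sb: "bdd_above S" by (rule bdd_aboveI[of _ d]) (auto simp: S_def)
    define x1 where "x1 = Sup S"
    obtain s0 where s0: "s0 \<in> S" using Sne by auto
    have x1: "c < x1" "x1 \<le> d"
    proof -
      show "c < x1" using cSup_upper[OF s0 Sb] s0 by (auto simp: S_def x1_def)
      show "x1 \<le> d" unfolding x1_def by (rule cSup_least[OF Sne]) (auto simp: S_def)
    qed
    \<comment> \<open>On the open interval from \<open>c\<close> to \<open>x1\<close> all values of
      \<open>V\<close> lie between \<open>L\<close> and \<open>L + \<eta>\<close>.\<close>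
    have "r x1 - r c \<le> B"
    proof (rule Suc.prems(5))
      show "V y - V x \<le> \<eta>" if xy: "c < x" "x \<le> y" "y < x1" for x y
      proof -
        obtain s where s: "s \<in> S" "y < s" using xy(3) less_cSupD[OF Sne] unfolding x1_def by blast
        then have "V y \<le> V s" "V s \<le> L + \<eta>" using Suc.prems(2)[of y s] xy by (auto simp: S_def)
        moreover have "L \<le> V x" using L[of x] xy x1 by simp
        ultimately show ?thesis by simp
      qed
    qed (use x1 in auto)
    \<comment> \<open>Beyond \<open>x1\<close> the values exceed \<open>L + \<eta>\<close>, which
      uses up one of the \<open>Suc n\<close> levels.\<close>
    moreover have "r d - r x1 \<le> (real n + 1) * B"
    proof (rule Suc.IH)
      show "x1 \<le> d" using x1 by simp
      show "V x \<le> V y" if "x1 \<le> x" "x \<le> y" "y \<le> d" for x y using Suc.prems(2)[of x y] that x1 by auto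
      show "r d' - r c' \<le> B" if "x1 \<le> c'" "c' \<le> d'" "d' \<le> d"
        "\<And>x y. c' < x \<Longrightarrow> x \<le> y \<Longrightarrow> y < d' \<Longrightarrow> V y - V x \<le> \<eta>" for c' d'
        by (rule Suc.prems(5)) (use that x1 in auto)
      show "V y - V x \<le> real n * \<eta>" if xy: "x1 < x" "x \<le> y" "y < d" for x y
      proof -
        have "x \<notin> S" using cSup_upper[OF _ Sb, of x] xy by (auto simp: x1_def)
        then have "V x > L + \<eta>" using xy x1 by (auto simp: S_def)
        moreover have "V y \<le> L + (real n + 1) * \<eta>" using LU[of y] xy x1 by auto
        ultimately show ?thesis by (simp add: algebra_simps)
      qed
    qed (use \<eta> in auto)
    ultimately show ?thesis by (simp add: algebra_simps)
  qed
qed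

lemma level_split_real:
  fixes r V :: "real \<Rightarrow> real"
  assumes "c \<le> d" and mono: "\<And>x y. c \<le> x \<Longrightarrow> x \<le> y \<Longrightarrow> y \<le> d \<Longrightarrow> V x \<le> V y" and \<eta>: "\<eta> > 0" "B \<ge> 0"
    and small: "\<And>c' d'. c \<le> c' \<Longrightarrow> c' \<le> d' \<Longrightarrow> d' \<le> d \<Longrightarrow>
       (\<And>x y. c' < x \<Longrightarrow> x \<le> y \<Longrightarrow> y < d' \<Longrightarrow> V y - V x \<le> \<eta>) \<Longrightarrow> r d' - r c' \<le> B"
  shows "r d - r c \<le> ((V d - V c) / \<eta> + 2) * B"
proof -
  \<comment> \<open>Rounding up costs one piece, and \<open>level_split\<close> has one piece more
    than levels; together these make the 2 of the claim.\<close>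
  define n where "n = nat \<lceil>(V d - V c) / \<eta>\<rceil>"
  have Vcd: "V c \<le> V d" using mono assms(1) by auto
  have n: "real n \<ge> (V d - V c) / \<eta>" "real n \<le> (V d - V c) / \<eta> + 1"
    using Vcd \<eta>(1) by (auto simp: n_def of_nat_nat)
  have "r d - r c \<le> (real n + 1) * B"
  proof (rule level_split[OF assms(1) mono \<eta> small])
    fix x y assume xy: "c < x" "x \<le> y" "y < d"
    have "V y - V x \<le> V d - V c" using mono[of y d] mono[of c x] xy by auto
    also have "\<dots> \<le> real n * \<eta>" using n(1) \<eta>(1) by (simp add: field_simps)
    finally show "V y - V x \<le> real n * \<eta>" .
  qed auto
  also have "\<dots> \<le> ((V d - V c) / \<eta> + 2) * B" using n(2) \<eta>(2) by (intro mult_right_mono) auto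
  finally show ?thesis .
qed

text \<open>\<open>y\<close> is the first time at or below \<open>lo\<close>, and \<open>x\<close>
  the last time before \<open>y\<close> at or above \<open>hi\<close>; between them \<open>f\<close>
  cannot leave the strip.\<close>

lemma down_crossing:
  fixes f :: "real \<Rightarrow> real"
  assumes "continuous_on {c..d} f" "c \<le> d" "hi \<le> f c" "f d \<le> lo" "lo \<le> hi"
  obtains x y where "c \<le> x" "x \<le> y" "y \<le> d" "f x = hi" "f y = lo" "\<And>s. s \<in> {x..y} \<Longrightarrow> lo \<le> f s \<and> f s \<le> hi"
proof -
  define Y where "Y = {s \<in> {c..d}. f s \<le> lo}"
  have "closed Y" unfolding Y_def
    using continuous_closed_preimage[OF assms(1) closed_atLeastAtMost closed_atMost[of lo]] 
    by (simp add: vimage_def Int_def)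
  moreover have "bounded Y" by (rule bounded_subset[of "{c..d}"]) (auto simp: Y_def)
  ultimately have "compact Y" by (simp add: compact_eq_bounded_closed)
  moreover have "d \<in> Y" using assms by (auto simp: Y_def)
  ultimately obtain y where y: "y \<in> Y" "\<And>s. s \<in> Y \<Longrightarrow> y \<le> s" using compact_attains_inf[of Y] by auto
  have fy: "f y = lo"
  proof -
    have "continuous_on {c..y} f" using assms(1) by (rule continuous_on_subset) (use y in \<open>auto simp: Y_def\<close>)
    then obtain s where "c \<le> s" "s \<le> y" "f s = lo" using IVT2'[of f y lo c] y assms by (auto simp: Y_def)
    then show ?thesis using y(2)[of s] y(1) by (auto simp: Y_def)
  qed
  define X where "X = {s \<in> {c..y}. hi \<le> f s}"
  have cy: "continuous_on {c..y} f" using assms(1) by (rule continuous_on_subset) (use y in \<open>auto simp: Y_def\<close>)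
  have "closed X" unfolding X_def
    using continuous_closed_preimage[OF cy closed_atLeastAtMost closed_atLeast[of hi]] 
    by (simp add: vimage_def Int_def)
  moreover have "bounded X" by (rule bounded_subset[of "{c..y}"]) (auto simp: X_def)
  ultimately have "compact X" by (simp add: compact_eq_bounded_closed)
  moreover have "c \<in> X" using assms y by (auto simp: X_def Y_def)
  ultimately obtain x where x: "x \<in> X" "\<And>s. s \<in> X \<Longrightarrow> s \<le> x" using compact_attains_sup[of X] by auto
  have fx: "f x = hi"
  proof -
    have "continuous_on {x..y} f" using cy by (rule continuous_on_subset) (use x in \<open>auto simp: X_def\<close>)
    then obtain s where "x \<le> s" "s \<le> y" "f s = hi" using IVT2'[of f y hi x] x fy assms(5) by (auto simp: X_def)
    then show ?thesis using x(2)[of s] x(1) by (auto simp: X_def)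
  qed
  show ?thesis
  proof (rule that[OF _ _ _ fx fy])
    show "c \<le> x" "x \<le> y" "y \<le> d" using x y by (auto simp: X_def Y_def)
    fix s assume s: "s \<in> {x..y}"
    have "f s \<le> hi"
    proof (rule ccontr)
      assume "\<not> f s \<le> hi"
      then have "s \<in> X" using s x(1) by (auto simp: X_def)
      then have "s = x" using x(2)[of s] s by auto
      then show False using fx \<open>\<not> f s \<le> hi\<close> by simp
    qed
    moreover have "lo \<le> f s"
    proof (rule ccontr)
      assume "\<not> lo \<le> f s"
      then have "s \<in> Y" using s x(1) y(1) by (auto simp: X_def Y_def)
      then have "s = y" using y(2)[of s] s by auto
      then show False using fy \<open>\<not> lo \<le> f s\<close> by simp
    qed
    ultimately show "lo \<le> f s \<and> f s \<le> hi" by simp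
  qed
qed

text \<open>Cauchy-Schwarz for \<open>(1 / m) * (m * h) + \<eta> * v\<close>; the deficit is a
  perfect square.\<close>

lemma quasi_square_bound:
  fixes m :: real
  assumes "m > 0"
  shows "(h + \<eta> * v)\<^sup>2 \<le> (1 / m\<^sup>2 + \<eta>\<^sup>2) * (v\<^sup>2 + m\<^sup>2 * h\<^sup>2)"
proof -
  have "(1 / m\<^sup>2 + \<eta>\<^sup>2) * (v\<^sup>2 + m\<^sup>2 * h\<^sup>2) - (h + \<eta> * v)\<^sup>2 = (v / m - \<eta> * m * h)\<^sup>2"
    using assms by (simp add: power2_eq_square field_simps)
  then show ?thesis by (smt (verit) zero_le_power2)
qed

text \<open>The scale \<open>m = k / L\<close> is matched to the tolerance:
  \<open>|\<eta>| \<le> 1 / m\<close>. Then \<open>v^2\<close> contributes at most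
  \<open>k / L\<close>, hence at most \<open>L * k\<close>, and \<open>t * u^2\<close> at most
  \<open>2 * L * k\<close>, which adds up to \<open>3 * L * k\<close>.\<close>

lemma angle_rate_crude:
  fixes k L q t v h \<eta> :: real
  assumes k: "k > 0" and L: "L \<ge> 1" and \<eta>: "\<bar>\<eta>\<bar> \<le> L / k" and t: "\<bar>t\<bar> = k\<^sup>2"
    and m: "m = k / L"
  shows "\<bar>m * (v\<^sup>2 + (t - q) * (h + \<eta> * v)\<^sup>2) / (v\<^sup>2 + m\<^sup>2 * h\<^sup>2)\<bar> \<le> 3 * L * k + 2 * L / k * \<bar>q\<bar>"
proof -
  define D where "D = v\<^sup>2 + m\<^sup>2 * h\<^sup>2"
  have m0: "m > 0" using k L m by simp
  have D: "D \<ge> 0" by (simp add: D_def)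
  define u where "u = h + \<eta> * v"
  have u: "u\<^sup>2 \<le> (1 / m\<^sup>2 + \<eta>\<^sup>2) * D" unfolding u_def D_def by (rule quasi_square_bound[OF m0])
  have "\<eta>\<^sup>2 \<le> (L / k)\<^sup>2" using power_mono[OF \<eta>, of 2] by simp
  then have "1 / m\<^sup>2 + \<eta>\<^sup>2 \<le> 2 * (L / k)\<^sup>2" using m by (simp add: power_divide)
  then have u': "u\<^sup>2 \<le> 2 * (L / k)\<^sup>2 * D" using order.trans[OF u mult_right_mono[OF _ D]] by blast
  have "\<bar>v\<^sup>2 + (t - q) * u\<^sup>2\<bar> \<le> v\<^sup>2 + \<bar>t - q\<bar> * u\<^sup>2"
    using abs_triangle_ineq[of "v\<^sup>2" "(t - q) * u\<^sup>2"] by (simp add: abs_mult)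
  also have "\<dots> \<le> D + (k\<^sup>2 + \<bar>q\<bar>) * (2 * (L / k)\<^sup>2 * D)"
    using u' t by (intro add_mono mult_mono) (auto simp: D_def)
  finally have "m * \<bar>v\<^sup>2 + (t - q) * u\<^sup>2\<bar> \<le> m * (D + (k\<^sup>2 + \<bar>q\<bar>) * (2 * (L / k)\<^sup>2 * D))"
    using m0 by (intro mult_left_mono) auto
  also have "\<dots> = (k / L + 2 * L * k + 2 * L / k * \<bar>q\<bar>) * D"
    using k L by (simp add: m field_simps power2_eq_square)
  also have "\<dots> \<le> (3 * L * k + 2 * L / k * \<bar>q\<bar>) * D"
  proof (rule mult_right_mono[OF _ D])
    have "k / L \<le> k" using k L by (simp add: field_simps)
    moreover have "k \<le> L * k" using k L by simp
    ultimately show "k / L + 2 * L * k + 2 * L / k * \<bar>q\<bar> \<le> 3 * L * k + 2 * L / k * \<bar>q\<bar>" by simp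
  qed
  finally have *: "m * \<bar>v\<^sup>2 + (t - q) * u\<^sup>2\<bar> \<le> (3 * L * k + 2 * L / k * \<bar>q\<bar>) * D" .
  show ?thesis
  proof (cases "D = 0")
    case True
    then show ?thesis using k L by (simp add: D_def)
  next
    case False
    then have "D > 0" using D by simp
    then show ?thesis using * m0 unfolding u_def[symmetric] D_def[symmetric]
      by (simp add: abs_mult abs_divide divide_le_eq)
  qed
qed

text \<open>For \<open>\<eta> = 0\<close> and \<open>q = 0\<close> the rate is exactly
  \<open>k\<close>. With \<open>e = k * \<eta>\<close>, the cross term
  \<open>2 * (k * h) * v * e\<close> and the square \<open>e^2 * v^2\<close> each cost at most
  \<open>\<delta>\<close> times the denominator, the second because
  \<open>\<delta> \<le> 1\<close>.\<close>

lemma angle_rate_fine: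
  fixes k \<delta> q v h \<eta> :: real
  assumes k: "k > 0" and \<delta>: "0 \<le> \<delta>" "\<delta> \<le> 1" and \<eta>: "\<bar>\<eta>\<bar> \<le> \<delta> / k" and nz: "v \<noteq> 0 \<or> h \<noteq> 0"
  shows "\<bar>k * (v\<^sup>2 + (k\<^sup>2 - q) * (h + \<eta> * v)\<^sup>2) / (v\<^sup>2 + k\<^sup>2 * h\<^sup>2) - k\<bar> \<le> 2 * \<delta> * k + 2 / k * \<bar>q\<bar>"
proof -
  define D where "D = v\<^sup>2 + k\<^sup>2 * h\<^sup>2"
  have D: "D > 0" using nz k by (auto simp: D_def add_pos_nonneg add_nonneg_pos)
  define u where "u = h + \<eta> * v"
  have u: "u\<^sup>2 \<le> (1 / k\<^sup>2 + \<eta>\<^sup>2) * D" unfolding u_def D_def by (rule quasi_square_bound[OF k])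
  have "\<eta>\<^sup>2 \<le> (\<delta> / k)\<^sup>2" using power_mono[OF \<eta>, of 2] by simp
  also have "\<dots> \<le> (1 / k)\<^sup>2" using k \<delta> by (intro power_mono divide_right_mono) auto
  finally have "1 / k\<^sup>2 + \<eta>\<^sup>2 \<le> 2 / k\<^sup>2" by (simp add: power_divide)
  then have u': "u\<^sup>2 \<le> 2 / k\<^sup>2 * D" using order.trans[OF u mult_right_mono[OF _ less_imp_le[OF D]]] by blast
  define e where "e = k * \<eta>"
  have e: "\<bar>e\<bar> \<le> \<delta>" using \<eta> k by (simp add: e_def abs_mult field_simps)
  have ku: "k * u = k * h + e * v" by (simp add: u_def e_def algebra_simps)
  have eq: "v\<^sup>2 + (k\<^sup>2 - q) * u\<^sup>2 - D = 2 * (k * h) * v * e + e\<^sup>2 * v\<^sup>2 - q * u\<^sup>2"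
  proof -
    have "k\<^sup>2 * u\<^sup>2 = (k * h + e * v)\<^sup>2" unfolding ku[symmetric] by (simp add: power_mult_distrib)
    then show ?thesis by (simp add: D_def power2_eq_square algebra_simps)
  qed
  have 1: "\<bar>2 * (k * h) * v * e\<bar> \<le> D * \<delta>"
  proof -
    have "\<bar>2 * (k * h) * v\<bar> \<le> D"
      using sum_squares_bound[of "\<bar>k * h\<bar>" "\<bar>v\<bar>"] by (simp add: D_def abs_mult power_mult_distrib)
    then show ?thesis using e D by (simp add: abs_mult[of _ e] mult_mono)
  qed
  have 2: "e\<^sup>2 * v\<^sup>2 \<le> \<delta> * D"
  proof -
    have "e\<^sup>2 \<le> \<delta>\<^sup>2" using power_mono[OF e, of 2] by simp
    also have "\<dots> \<le> \<delta>" using \<delta> by (simp add: power2_eq_square mult_left_le)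
    finally show ?thesis using \<delta> by (intro mult_mono) (auto simp: D_def)
  qed
  have 3: "\<bar>q * u\<^sup>2\<bar> \<le> \<bar>q\<bar> * (2 / k\<^sup>2 * D)" using mult_left_mono[OF u' abs_ge_zero[of q]] by (simp add: abs_mult)
  have "\<bar>v\<^sup>2 + (k\<^sup>2 - q) * u\<^sup>2 - D\<bar> \<le> (2 * \<delta> + 2 / k\<^sup>2 * \<bar>q\<bar>) * D"
  proof -
    have "\<bar>2 * (k * h) * v * e + e\<^sup>2 * v\<^sup>2 - q * u\<^sup>2\<bar> \<le> D * \<delta> + \<delta> * D + \<bar>q\<bar> * (2 / k\<^sup>2 * D)"
      using 1 2 3 mult_nonneg_nonneg[OF zero_le_power2[of e] zero_le_power2[of v]] by linarith
    also have "\<dots> = (2 * \<delta> + 2 / k\<^sup>2 * \<bar>q\<bar>) * D" by (simp add: algebra_simps)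
    finally show ?thesis unfolding eq .
  qed
  then have "k * \<bar>v\<^sup>2 + (k\<^sup>2 - q) * u\<^sup>2 - D\<bar> \<le> k * ((2 * \<delta> + 2 / k\<^sup>2 * \<bar>q\<bar>) * D)"
    using k by (intro mult_left_mono) auto
  also have "\<dots> = (2 * \<delta> * k + 2 / k * \<bar>q\<bar>) * D" using k by (simp add: field_simps power2_eq_square)
  finally have "k * \<bar>v\<^sup>2 + (k\<^sup>2 - q) * u\<^sup>2 - D\<bar> / D \<le> 2 * \<delta> * k + 2 / k * \<bar>q\<bar>"
    using D by (simp add: divide_le_eq)
  moreover have "k * \<bar>v\<^sup>2 + (k\<^sup>2 - q) * u\<^sup>2 - D\<bar> / D = \<bar>k * (v\<^sup>2 + (k\<^sup>2 - q) * u\<^sup>2) / D - k\<bar>"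
  proof -
    have "k * (v\<^sup>2 + (k\<^sup>2 - q) * u\<^sup>2) / D - k = k * (v\<^sup>2 + (k\<^sup>2 - q) * u\<^sup>2 - D) / D"
      using D by (simp add: field_simps)
    then show ?thesis using k D by (simp add: abs_mult abs_divide)
  qed
  ultimately show ?thesis by (simp add: u_def D_def)
qed

text \<open>The zone says that the direction of \<open>(v, k * h)\<close> has
  \<open>|sin| \<le> 1/2\<close>, so \<open>k * |h|\<close> is at most \<open>|v| / sqrt 3\<close>,
  rounded up to \<open>(3/5) * |v|\<close>. The tolerance adds at most \<open>(1/4) * |v|\<close>;
  thus \<open>k * |u| \<le> |v|\<close>, the main part \<open>v^2 - k^2 * u^2\<close> is
  nonnegative, and only \<open>q\<close> can turn the path backwards.\<close>

lemma angle_rate_barrier: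
  fixes k q v h \<eta> :: real
  assumes k: "k > 0" and \<eta>: "\<bar>\<eta>\<bar> \<le> (1/4) / k" and nz: "v \<noteq> 0 \<or> h \<noteq> 0" 
    and zone: "4 * (k\<^sup>2 * h\<^sup>2) \<le> v\<^sup>2 + k\<^sup>2 * h\<^sup>2"
  shows "k * (v\<^sup>2 + (- k\<^sup>2 - q) * (h + \<eta> * v)\<^sup>2) / (v\<^sup>2 + k\<^sup>2 * h\<^sup>2) \<ge> - (2 / k) * \<bar>q\<bar>"
proof -
  define D where "D = v\<^sup>2 + k\<^sup>2 * h\<^sup>2"
  have D: "D > 0" using nz k by (auto simp: D_def add_pos_nonneg add_nonneg_pos)
  define u where "u = h + \<eta> * v"
  have u: "u\<^sup>2 \<le> (1 / k\<^sup>2 + \<eta>\<^sup>2) * D" unfolding u_def D_def by (rule quasi_square_bound[OF k])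
  have "\<eta>\<^sup>2 \<le> ((1/4) / k)\<^sup>2" using power_mono[OF \<eta>, of 2] by simp
  also have "\<dots> \<le> (1 / k)\<^sup>2" using k by (intro power_mono divide_right_mono) auto
  finally have "1 / k\<^sup>2 + \<eta>\<^sup>2 \<le> 2 / k\<^sup>2" by (simp add: power_divide)
  then have u': "u\<^sup>2 \<le> 2 / k\<^sup>2 * D" using order.trans[OF u mult_right_mono[OF _ less_imp_le[OF D]]] by blast
  have kh: "k * \<bar>h\<bar> \<le> (3/5) * \<bar>v\<bar>"
  proof -
    have "25 * (k\<^sup>2 * h\<^sup>2) \<le> 9 * v\<^sup>2" using zone zero_le_power2[of v] by linarith
    then have "(k * \<bar>h\<bar>)\<^sup>2 \<le> ((3/5) * \<bar>v\<bar>)\<^sup>2" by (simp add: power_mult_distrib power_divide)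
    then show ?thesis by (rule power2_le_imp_le) simp
  qed
  have "k * \<bar>u\<bar> \<le> k * \<bar>h\<bar> + (k * \<bar>\<eta>\<bar>) * \<bar>v\<bar>"
    unfolding u_def using k abs_triangle_ineq[of h "\<eta> * v"] mult_left_mono[of "\<bar>h + \<eta> * v\<bar>" "\<bar>h\<bar> + \<bar>\<eta> * v\<bar>" k]
    by (simp add: abs_mult algebra_simps)
  also have "\<dots> \<le> (3/5) * \<bar>v\<bar> + (1/4) * \<bar>v\<bar>"
    using kh \<eta> k by (intro add_mono mult_right_mono) (auto simp: field_simps)
  also have "\<dots> \<le> \<bar>v\<bar>" by simp
  finally have "(k * \<bar>u\<bar>)\<^sup>2 \<le> \<bar>v\<bar>\<^sup>2" using k by (intro power_mono) auto
  then have v: "k\<^sup>2 * u\<^sup>2 \<le> v\<^sup>2" by (simp add: power_mult_distrib)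
  have "q * u\<^sup>2 \<le> \<bar>q\<bar> * (2 / k\<^sup>2 * D)" using u' by (intro mult_mono) auto
  then have "v\<^sup>2 + (- k\<^sup>2 - q) * u\<^sup>2 \<ge> - (\<bar>q\<bar> * (2 / k\<^sup>2 * D))" using v by (simp add: algebra_simps)
  then have "k * (v\<^sup>2 + (- k\<^sup>2 - q) * u\<^sup>2) \<ge> k * - (\<bar>q\<bar> * (2 / k\<^sup>2 * D))" using k by (intro mult_left_mono) auto
  also have "k * - (\<bar>q\<bar> * (2 / k\<^sup>2 * D)) = (- (2 / k) * \<bar>q\<bar>) * D" using k by (simp add: power2_eq_square field_simps)
  finally show ?thesis using D unfolding u_def[symmetric] D_def[symmetric] by (simp add: le_divide_eq)
qed

section \<open>Sheared and rescaled frames\<close>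

context sl_nontrivial
begin

definition q_mass :: "real \<Rightarrow> real" where "q_mass x = integral {a..x} (\<lambda>s. \<bar>q s\<bar>)"

lemma abs_q_int: "(\<lambda>s. \<bar>q s\<bar>) absolutely_integrable_on {a..b}"
  using absolutely_integrable_norm[OF q_int] by (simp add: o_def)

lemma q_mass_diff: "a \<le> c \<Longrightarrow> c \<le> d \<Longrightarrow> d \<le> b \<Longrightarrow> integral {c..d} (\<lambda>s. \<bar>q s\<bar>) = q_mass d - q_mass c"
  unfolding q_mass_def by (rule abs_int_integral_diff[OF abs_q_int, symmetric])

lemma integral_affine_q:
  assumes "a \<le> c" "c \<le> d" "d \<le> b"
  shows "integral {c..d} (\<lambda>s. A + B * \<bar>q s\<bar>) = A * (d - c) + B * (q_mass d - q_mass c)"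
  unfolding q_mass_diff[OF assms, symmetric]
  using integral_add[OF integrable_const_ivl integrable_on_mult_right[OF abs_int_sub(2)[OF abs_q_int assms(1,3)]], of A B] assms
  by simp

lemma q_mass_mono: "a \<le> c \<Longrightarrow> c \<le> d \<Longrightarrow> d \<le> b \<Longrightarrow> q_mass c \<le> q_mass d"
  using q_mass_diff[of c d] integral_nonneg[of "\<lambda>s. \<bar>q s\<bar>" "{c..d}"] abs_int_sub(2)[OF abs_q_int, of c d] by simp

lemma q_mass_a: "q_mass a = 0" by (simp add: q_mass_def)

text \<open>This is \<open>u\<close> with \<open>F\<close> replaced by the affine model
  \<open>x - a + s\<close>; \<open>frame_err\<close> is the error of the model. Where the error
  vanishes, the derivative of \<open>frame_u\<close> is just \<open>v\<close>, as for
  \<open>dP = dx\<close>.\<close>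

definition frame_u :: "real \<Rightarrow> real \<Rightarrow> real \<Rightarrow> real" where "frame_u s t x = om_re t x + (x - a + s) * ve_re t x"
definition frame_err :: "real \<Rightarrow> real \<Rightarrow> real" where "frame_err s x = F x - (x - a) - s"

lemma uu_re_frame: "uu_re t x = frame_u s t x + frame_err s x * ve_re t x"
  by (simp add: uu_re_def frame_u_def frame_err_def algebra_simps)

text \<open>The angular velocity of \<open>frame_path\<close>, see \<open>Im_frame_path\<close>,
  arranged to match the pointwise estimates with \<open>h\<close> the frame component and
  \<open>\<eta>\<close> its error.\<close>

definition rate :: "real \<Rightarrow> real \<Rightarrow> real \<Rightarrow> real \<Rightarrow> real" where
  "rate m s t x = m * ((ve_re t x)\<^sup>2 + (t - q x) * (frame_u s t x + frame_err s x * ve_re t x)\<^sup>2) / ((ve_re t x)\<^sup>2 + m\<^sup>2 * (frame_u s t x)\<^sup>2)"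

definition frame_path :: "real \<Rightarrow> real \<Rightarrow> real \<Rightarrow> real \<Rightarrow> complex" where
  "frame_path m s t x = Complex (ve_re t x) (m * frame_u s t x)"
definition frame_path' :: "real \<Rightarrow> real \<Rightarrow> real \<Rightarrow> real \<Rightarrow> complex" where
  "frame_path' m s t x = Complex ((q x - t) * uu_re t x) (m * (ve_re t x - frame_err s x * (q x - t) * uu_re t x))"

lemma ac_ident: "ac_deriv c d (\<lambda>x::real. x + C) (\<lambda>x. 1)"
  unfolding ac_deriv_def by (auto intro: absolutely_integrable_continuous_real)

lemma frame_path_ac: "ac_deriv a b (frame_path m s t) (frame_path' m s t)"
proof -
  have "ac_deriv a b (\<lambda>x. m * (om_re t x + (x + (s - a)) * ve_re t x))
    (\<lambda>x. m * (F x * (t - q x) * uu_re t x + (1 * ve_re t x + (x + (s - a)) * ((q x - t) * uu_re t x))))"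
    by (intro ac_mult_left ac_add om_ve_re_ac ac_mult ac_ident)
  from ac_Complex[OF om_ve_re_ac(2)[of t] this] show ?thesis
    unfolding frame_path_def frame_path'_def by (rule ac_cong) (auto simp: frame_u_def frame_err_def algebra_simps)
qed

lemma frame_nonzero: "x \<in> {a..b} \<Longrightarrow> ve_re t x \<noteq> 0 \<or> frame_u s t x \<noteq> 0"
  using om_ve_re_nonzero[of x t] by (auto simp: frame_u_def)

lemma frame_path_nonzero: "m > 0 \<Longrightarrow> x \<in> {a..b} \<Longrightarrow> frame_path m s t x \<noteq> 0"
  using frame_nonzero[of x t s] by (auto simp: frame_path_def complex_eq_iff)

lemma Im_frame_path: "Im (frame_path' m s t x / frame_path m s t x) = rate m s t x"
proof -
  have "m * (ve_re t x - frame_err s x * (q x - t) * uu_re t x) * ve_re t x - (q x - t) * uu_re t x * (m * frame_u s t x)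
     = m * ((ve_re t x)\<^sup>2 + (t - q x) * (uu_re t x)\<^sup>2)"
    unfolding uu_re_frame[of t x s] by (simp add: power2_eq_square algebra_simps)
  then show ?thesis
    by (simp add: frame_path_def frame_path'_def rate_def Im_divide uu_re_frame[of t x s, symmetric] power_mult_distrib)
qed

lemma frame_path_int: "m > 0 \<Longrightarrow> (\<lambda>x. frame_path' m s t x / frame_path m s t x) absolutely_integrable_on {a..b}"
  by (rule ac_lift(1)[OF frame_path_ac frame_path_nonzero])

lemma rate_int:
  assumes "m > 0"
  shows "rate m s t absolutely_integrable_on {a..b}"
  using absolutely_integrable_linear[OF frame_path_int[OF assms] bounded_linear_Im, of s t] by (simp add: o_def Im_frame_path)

lemma Im_frame_path_integral:
  assumes "m > 0" "a \<le> c" "d \<le> b"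
  shows "Im (integral {c..d} (\<lambda>x. frame_path' m s t x / frame_path m s t x)) = integral {c..d} (rate m s t)"
  using integral_linear[OF abs_int_sub(2)[OF frame_path_int[OF assms(1)] assms(2,3)] bounded_linear_Im, of s t]
  by (simp add: o_def Im_frame_path)

text \<open>Changing the reference frame at fixed \<open>x\<close> is a linear map with positive eigenvalues, so
  the two paths are never antiparallel.\<close>

lemma rotation_frame:
  assumes m: "m > 0" and cd: "a \<le> c" "c \<le> d" "d \<le> b"
  shows "\<bar>(angle t d - angle t c) - integral {c..d} (rate m s t)\<bar> \<le> 2 * pi"
proof -
  have nr: "path t x / frame_path m s t x \<notin> \<real>\<^sub>\<le>\<^sub>0" if x: "x \<in> {c..d}" for x
  proof
    assume "path t x / frame_path m s t x \<in> \<real>\<^sub>\<le>\<^sub>0"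
    then obtain p where p: "path t x / frame_path m s t x = of_real p" "p \<le> 0" by (rule nonpos_Reals_cases)
    have x': "x \<in> {a..b}" using x cd by auto
    have "path t x = of_real p * frame_path m s t x"
      using p(1) frame_path_nonzero[OF m x', of s t] by (simp add: field_simps)
    then have e: "ve_re t x = p * ve_re t x" "om_re t x = p * m * frame_u s t x" by (auto simp: path_def frame_path_def complex_eq_iff)
    then have "(1 - p) * ve_re t x = 0" by (simp add: algebra_simps)
    then have v: "ve_re t x = 0" using p(2) by simp
    then have "(1 - p * m) * om_re t x = 0" using e(2) by (simp add: frame_u_def algebra_simps)
    moreover have "1 - p * m > 0" using p(2) m by (smt (verit) mult_nonneg_nonneg mult_nonpos_nonneg)
    ultimately show False using om_ve_re_nonzero[OF x', of t] v by simp
  qed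
  \<comment> \<open>Two principal arguments, each between \<open>- pi\<close> and \<open>pi\<close>,
    make up the error \<open>2 * pi\<close>.\<close>
  define A where "A x = Im (Ln (path t x / frame_path m s t x))" for x
  have A: "- pi < A x" "A x \<le> pi" if x: "x \<in> {c..d}" for x
  proof -
    have "path t x / frame_path m s t x \<noteq> 0" using nr[OF x] by auto
    then show "- pi < A x" "A x \<le> pi" unfolding A_def by (auto simp: mpi_less_Im_Ln Im_Ln_le_pi)
  qed
  have "integral {c..d} (\<lambda>s. path' t s / path t s) - integral {c..d} (\<lambda>x. frame_path' m s t x / frame_path m s t x)
    = Ln (path t d / frame_path m s t d) - Ln (path t c / frame_path m s t c)"
    by (rule rot_Ln[OF ac_sub[OF path_ac] ac_sub[OF frame_path_ac] cd(2) nr]) (use cd in auto)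
  moreover have "integral {c..d} (\<lambda>s. path' t s / path t s) = log_path t d - log_path t c"
    unfolding log_path_def by (rule abs_int_integral_diff[OF path_int cd, symmetric])
  ultimately have "log_path t d - log_path t c - integral {c..d} (\<lambda>x. frame_path' m s t x / frame_path m s t x)
    = Ln (path t d / frame_path m s t d) - Ln (path t c / frame_path m s t c)" by simp
  from arg_cong[OF this, of Im] have "angle t d - angle t c - integral {c..d} (rate m s t) = A d - A c"
    using Im_frame_path_integral[OF m cd(1,3), of s t] by (simp add: angle_def A_def)
  then show ?thesis using A[of c] A[of d] cd by auto
qed

lemma rotation_crude:
  assumes k: "k > 0" and L: "L \<ge> 1" and t: "\<bar>t\<bar> = k\<^sup>2" and cd: "a \<le> c" "c \<le> d" "d \<le> b"
    and \<eta>: "\<And>x. x \<in> {c<..<d} \<Longrightarrow> \<bar>frame_err s x\<bar> \<le> L / k"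
  shows "\<bar>angle t d - angle t c\<bar> \<le> 2 * pi + 3 * L * k * (d - c) + 2 * L / k * (q_mass d - q_mass c)"
proof -
  define m where "m = k / L"
  have m: "m > 0" using k L by (simp add: m_def)
  define g where "g x = 3 * L * k + 2 * L / k * \<bar>q x\<bar>" for x
  have gi: "g integrable_on {c..d}" unfolding g_def
    by (intro integrable_add integrable_on_mult_right abs_int_sub(2)[OF abs_q_int] integrable_const_ivl cd)
  have gI: "integral {c..d} g = 3 * L * k * (d - c) + 2 * L / k * (q_mass d - q_mass c)"
    unfolding g_def by (rule integral_affine_q[OF cd])
  have pi: "rate m s t integrable_on {c..d}" by (rule abs_int_sub(2)[OF rate_int[OF m] cd(1,3)])
  have b: "\<bar>rate m s t x\<bar> \<le> g x" if "x \<in> {c<..<d}" for x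
    unfolding rate_def g_def by (rule angle_rate_crude[OF k L \<eta>[OF that] t m_def])
  have "integral {c..d} (rate m s t) \<le> integral {c..d} g"
    by (rule integral_le_open[OF pi gi]) (use b in fastforce)
  moreover have "integral {c..d} (\<lambda>x. - g x) \<le> integral {c..d} (rate m s t)"
    by (rule integral_le_open[OF integrable_neg[OF gi] pi]) (use b in fastforce)
  moreover note rotation_frame[OF m cd, of t s]
  ultimately show ?thesis unfolding gI by (simp add: gI)
qed

lemma rotation_fine:
  assumes k: "k > 0" and \<delta>: "0 \<le> \<delta>" "\<delta> \<le> 1" and cd: "a \<le> c" "c \<le> d" "d \<le> b"
    and \<eta>: "\<And>x. x \<in> {c<..<d} \<Longrightarrow> \<bar>frame_err s x\<bar> \<le> \<delta> / k"
  shows "\<bar>angle (k\<^sup>2) d - angle (k\<^sup>2) c - k * (d - c)\<bar> \<le> 2 * pi + 2 * \<delta> * k * (d - c) + 2 / k * (q_mass d - q_mass c)"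
proof -
  define g where "g x = 2 * \<delta> * k + 2 / k * \<bar>q x\<bar>" for x
  let ?t = "k\<^sup>2"
  have gi: "g integrable_on {c..d}" unfolding g_def
    by (intro integrable_add integrable_on_mult_right abs_int_sub(2)[OF abs_q_int] integrable_const_ivl cd)
  have gI: "integral {c..d} g = 2 * \<delta> * k * (d - c) + 2 / k * (q_mass d - q_mass c)"
    unfolding g_def by (rule integral_affine_q[OF cd])
  have pi: "rate k s ?t integrable_on {c..d}" by (rule abs_int_sub(2)[OF rate_int[OF k] cd(1,3)])
  have kI: "integral {c..d} (\<lambda>x. k) = k * (d - c)" using cd by simp
  have b: "\<bar>rate k s ?t x - k\<bar> \<le> g x" if "x \<in> {c<..<d}" for x
    unfolding rate_def g_def 
    by (rule angle_rate_fine[OF k \<delta> \<eta>[OF that] frame_nonzero]) (use that cd in auto)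
  have "integral {c..d} (rate k s ?t) \<le> integral {c..d} (\<lambda>x. k + g x)"
    by (rule integral_le_open[OF pi integrable_add[OF integrable_const_ivl gi]]) (use b in fastforce)
  moreover have "integral {c..d} (\<lambda>x. k - g x) \<le> integral {c..d} (rate k s ?t)"
    by (rule integral_le_open[OF integrable_diff[OF integrable_const_ivl gi] pi]) (use b in fastforce)
  moreover note rotation_frame[OF k cd, of ?t s]
  moreover have "integral {c..d} (\<lambda>x. k + g x) = k * (d - c) + integral {c..d} g"
    by (subst integral_add) (auto simp: gi kI simp del: integral_const_real)
  moreover have "integral {c..d} (\<lambda>x. k - g x) = k * (d - c) - integral {c..d} g"
    by (subst integral_diff) (auto simp: gi kI simp del: integral_const_real)
  ultimately show ?thesis unfolding gI by linarith
qed

text \<open>For \<open>t = - k\<^sup>2\<close> the angle can hardly decrease while \<open>\<bar>sin\<bar> \<le> 1/2\<close>, so it cannot cross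
  such a zone downwards.\<close>

lemma rotation_barrier:
  assumes k: "k > 0" and cd: "a \<le> c" "c \<le> d" "d \<le> b"
    and \<eta>: "\<And>x. x \<in> {c<..<d} \<Longrightarrow> \<bar>frame_err s x\<bar> \<le> (1/4) / k" and Qk: "2 / k * q_mass b < pi / 3"
  shows "angle (- k\<^sup>2) c - angle (- k\<^sup>2) d \<le> 4 * pi"
proof -
  let ?t = "- k\<^sup>2"
  define \<phi>0 where "\<phi>0 = Im (Ln (frame_path k s ?t c))"
  \<comment> \<open>A continuous argument of \<open>frame_path\<close> on \<open>[c,d]\<close>,
    started at the principal value.\<close>
  define \<phi> where "\<phi> x = \<phi>0 + integral {c..x} (rate k s ?t)" for x
  have pint: "rate k s ?t absolutely_integrable_on {c..d}"
    by (rule abs_int_sub(1)[OF rate_int[OF k] cd(1,3)])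
  have \<phi>c: "continuous_on {c..d} \<phi>" unfolding \<phi>_def
    by (intro continuous_intros abs_int_indefinite_continuous pint)
  have cc: "c \<in> {c..d}" using cd by simp
  have polar: "k * frame_u s ?t x = cmod (frame_path k s ?t x) * sin (\<phi> x)" if x: "x \<in> {c..d}" for x
  proof -
    define I where "I = integral {c..x} (\<lambda>x. frame_path' k s ?t x / frame_path k s ?t x)"
    have nz: "frame_path k s ?t c \<noteq> 0" using frame_path_nonzero[OF k] cd by auto
    have "frame_path k s ?t x = frame_path k s ?t c * exp I"
      unfolding I_def
      by (rule ac_lift(2)[OF ac_sub[OF frame_path_ac cd(1,3)] _ x]) (use frame_path_nonzero[OF k] cd in auto)
    also have "\<dots> = exp (Ln (frame_path k s ?t c) + I)" using nz by (simp add: exp_add)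
    finally have e: "frame_path k s ?t x = exp (Ln (frame_path k s ?t c) + I)" .
    have "Im (Ln (frame_path k s ?t c) + I) = \<phi> x"
      using Im_frame_path_integral[OF k cd(1), of x s ?t] x cd by (simp add: I_def \<phi>_def \<phi>0_def)
    then have "Im (frame_path k s ?t x) = cmod (frame_path k s ?t x) * sin (\<phi> x)"
      unfolding e by (simp only: Im_exp norm_exp_eq_Re)
    then show ?thesis by (simp add: frame_path_def)
  qed
  have "\<phi> d - \<phi> c \<ge> - (2 * pi)"
  proof (rule ccontr)
    assume "\<not> ?thesis"
    then have lt: "\<phi> d < \<phi> c - 2 * pi" by simp
    \<comment> \<open>\<open>j\<close> is the largest integer with \<open>hi \<le> \<phi> c\<close>,
      where \<open>hi\<close> and \<open>lo\<close> bound the strip of width \<open>pi / 3\<close>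
      around \<open>j * pi\<close>. A drop by more than \<open>2 * pi\<close> has to traverse this
      strip completely.\<close>
    define j where "j = \<lfloor>\<phi> c / pi - 1 / 6\<rfloor>"
    have j: "of_int j \<le> \<phi> c / pi - 1 / 6" "\<phi> c / pi - 1 / 6 < of_int j + 1" by (auto simp: j_def)
    define hi where "hi = of_int j * pi + pi / 6"
    define lo where "lo = of_int j * pi - pi / 6"
    have hi: "hi \<le> \<phi> c" using mult_right_mono[OF j(1), of pi] by (simp add: hi_def algebra_simps)
    have "\<phi> c - pi / 6 < of_int j * pi + pi" using mult_strict_right_mono[OF j(2), of pi] by (simp add: algebra_simps)
    then have lo: "\<phi> d \<le> lo" using lt pi_gt_zero unfolding lo_def by linarith
    have lohi: "lo \<le> hi" by (simp add: lo_def hi_def)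
    obtain x y where xy: "c \<le> x" "x \<le> y" "y \<le> d" "\<phi> x = hi" "\<phi> y = lo" "\<And>s. s \<in> {x..y} \<Longrightarrow> lo \<le> \<phi> s \<and> \<phi> s \<le> hi"
      by (rule down_crossing[OF \<phi>c cd(2) hi lo lohi]) (rule that)
    have ph_ge: "- (2 / k) * \<bar>q z\<bar> \<le> rate k s ?t z" if z: "z \<in> {x<..<y}" for z
    proof -
      have z1: "z \<in> {c<..<d}" "z \<in> {c..d}" "z \<in> {a..b}" using z xy cd by auto
      have "lo \<le> \<phi> z" "\<phi> z \<le> hi" using xy(6)[of z] z by auto
      then have "\<bar>\<phi> z - of_int j * pi\<bar> \<le> pi / 6" unfolding lo_def hi_def by (intro abs_leI) linarith+
      then have "\<bar>sin (\<phi> z - of_int j * pi)\<bar> \<le> 1 / 2"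
      proof -
        assume A: "\<bar>\<phi> z - of_int j * pi\<bar> \<le> pi / 6"
        have "sin (\<phi> z - of_int j * pi) \<le> sin (pi / 6)" "sin (- (pi / 6)) \<le> sin (\<phi> z - of_int j * pi)"
          using A pi_gt_zero by (intro sin_monotone_2pi_le; linarith)+
        then show ?thesis by (simp add: sin_30 abs_le_iff)
      qed
      moreover have "\<bar>sin (\<phi> z - of_int j * pi)\<bar> = \<bar>sin (\<phi> z)\<bar>"
      proof -
        have s0: "sin (of_int j * pi) = 0" by (simp add: sin_times_pi_eq_0)
        then have "(cos (of_int j * pi))\<^sup>2 = 1" using sin_cos_squared_add[of "of_int j * pi"] by simp
        then have "\<bar>cos (of_int j * pi)\<bar> = 1" by (simp add: abs_square_eq_1)
        then show ?thesis by (simp add: sin_diff s0 abs_mult)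
      qed
      ultimately have "(sin (\<phi> z))\<^sup>2 \<le> (1 / 2)\<^sup>2" by (metis abs_le_square_iff abs_of_nonneg zero_le_divide_1_iff zero_le_numeral)
      then have "4 * (sin (\<phi> z))\<^sup>2 \<le> 1" by (simp add: power2_eq_square)
      then have "(cmod (frame_path k s ?t z))\<^sup>2 * (4 * (sin (\<phi> z))\<^sup>2) \<le> (cmod (frame_path k s ?t z))\<^sup>2 * 1"
        by (intro mult_left_mono) auto
      then have "4 * (k * frame_u s ?t z)\<^sup>2 \<le> (cmod (frame_path k s ?t z))\<^sup>2"
        unfolding polar[OF z1(2)] by (simp add: power_mult_distrib)
      then have zone: "4 * (k\<^sup>2 * (frame_u s ?t z)\<^sup>2) \<le> (ve_re ?t z)\<^sup>2 + k\<^sup>2 * (frame_u s ?t z)\<^sup>2"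
        by (simp add: frame_path_def cmod_power2 power_mult_distrib)
      show ?thesis unfolding rate_def
        by (rule angle_rate_barrier[OF k \<eta>[OF z1(1)] frame_nonzero[OF z1(3)] zone])
    qed
    have axy: "a \<le> x" "x \<le> y" "y \<le> b" using xy cd by auto
    have "integral {x..y} (\<lambda>z. - (2 / k) * \<bar>q z\<bar>) \<le> integral {x..y} (rate k s ?t)"
      by (rule integral_le_open[OF integrable_on_mult_right[OF abs_int_sub(2)[OF abs_q_int axy(1,3)]]
            abs_int_sub(2)[OF rate_int[OF k] axy(1,3)] ph_ge])
    moreover have "integral {x..y} (\<lambda>z. - (2 / k) * \<bar>q z\<bar>) = - (2 / k) * (q_mass y - q_mass x)"
      unfolding q_mass_diff[OF axy, symmetric] by simp
    moreover have "q_mass y - q_mass x \<le> q_mass b" using q_mass_mono[of y b] q_mass_mono[of a x] axy q_mass_a by auto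
    then have "2 / k * (q_mass y - q_mass x) \<le> 2 / k * q_mass b" using k by (intro mult_left_mono) auto
    moreover have "integral {x..y} (rate k s ?t) = lo - hi"
    proof -
      have "\<phi> y - \<phi> x = integral {c..y} (rate k s ?t) - integral {c..x} (rate k s ?t)" by (simp add: \<phi>_def)
      also have "\<dots> = integral {x..y} (rate k s ?t)" by (rule abs_int_integral_diff[OF pint xy(1-3)])
      finally show ?thesis using xy by simp
    qed
    \<comment> \<open>Inside the strip only \<open>q\<close> can lower the angle, and its total
      effect is less than the width \<open>pi / 3\<close>.\<close>
    ultimately have "- (2 / k * q_mass b) \<le> lo - hi" by linarith
    then show False using Qk by (simp add: lo_def hi_def)
  qed
  then have "integral {c..d} (rate k s ?t) \<ge> - (2 * pi)" by (simp add: \<phi>_def)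
  then show ?thesis using rotation_frame[OF k cd, of ?t s] by linarith
qed

end

section \<open>Asymptotics of the eigenvalue count\<close>

text \<open>\<open>V\<close> stands for the distribution function of the total variation of
  \<open>\<nu>\<close>. The second assumption is singularity expressed on uniform grids: cells of
  small total length carry all but a small part of the increase of \<open>V\<close>.\<close>

locale sl_singular = sl_system +
  fixes V :: "real \<Rightarrow> real"
  assumes F_V: "\<And>x y. a \<le> x \<Longrightarrow> x \<le> y \<Longrightarrow> y \<le> b \<Longrightarrow> \<bar>F y - F x - (y - x)\<bar> \<le> V y - V x"
    and V_grid: "\<And>\<epsilon>. \<epsilon> > 0 \<Longrightarrow> \<exists>N>0. \<exists>T \<subseteq> {..<N}. real (card T) * ((b - a) / real N) \<le> \<epsilon> \<and>
       (\<Sum>i\<in>{..<N} - T. V (a + real (Suc i) * ((b - a) / real N)) - V (a + real i * ((b - a) / real N))) \<le> \<epsilon>"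
begin

lemma V_mono: "a \<le> x \<Longrightarrow> x \<le> y \<Longrightarrow> y \<le> b \<Longrightarrow> V x \<le> V y"
  using F_V[of x y] by linarith

definition grid_point :: "nat \<Rightarrow> nat \<Rightarrow> real" where "grid_point N i = a + real i * ((b - a) / real N)"

lemma grid_point_props:
  assumes "N > 0" "i < N"
  shows "a \<le> grid_point N i" "grid_point N i < grid_point N (Suc i)" "grid_point N (Suc i) \<le> b" "grid_point N (Suc i) - grid_point N i = (b - a) / real N"
proof -
  have 1: "(b - a) / real N > 0" using ab assms by simp
  show 2: "grid_point N (Suc i) - grid_point N i = (b - a) / real N" by (simp add: grid_point_def algebra_simps add_divide_distrib diff_divide_distrib)
  show "a \<le> grid_point N i" using 1 unfolding grid_point_def by (intro le_add_same_cancel1[THEN iffD2] mult_nonneg_nonneg) auto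
  show "grid_point N i < grid_point N (Suc i)" using 1 2 by linarith
  have "real (Suc i) * ((b - a) / real N) \<le> real N * ((b - a) / real N)"
    using 1 assms by (intro mult_right_mono) auto
  then show "grid_point N (Suc i) \<le> b" using assms unfolding grid_point_def by simp
qed

lemma grid_point_ends: "N > 0 \<Longrightarrow> grid_point N 0 = a" "N > 0 \<Longrightarrow> grid_point N N = b"
  by (auto simp: grid_point_def)

lemma sum_grid_telescope: "(\<Sum>i<N. (f (grid_point N (Suc i)) - f (grid_point N i)) :: real) = f (grid_point N N) - f (grid_point N 0)"
  by (rule sum_lessThan_telescope)

text \<open>Otherwise the zeros of \<open>F\<close> are dense, and \<open>F_V\<close> between zeros
  makes \<open>V\<close> grow at least as fast as \<open>x\<close>. The cells outside
  \<open>T\<close> are then no longer in total than their \<open>V\<close>-mass, so with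
  \<open>\<epsilon> = (b - a) / 3\<close> all cells together cannot fill the interval.\<close>

lemma F_not_AE_zero: "\<not> (AE x in leb_on a b. F x = 0)"
proof
  assume "AE x in leb_on a b. F x = 0"
  then have "AE x in lebesgue. x \<in> {a..b} \<longrightarrow> F x = 0" by (simp add: AE_leb_on_iff)
  from AE_negligible[OF this] have neg: "negligible {x \<in> {a..b}. F x \<noteq> 0}" .
  have dense: "\<exists>x\<in>{c<..<d}. F x = 0" if "a \<le> c" "c < d" "d \<le> b" for c d
  proof (rule ccontr)
    assume "\<not> ?thesis"
    then have "{c<..<d} \<subseteq> {x \<in> {a..b}. F x \<noteq> 0}" using that by auto
    then have "negligible {c<..<d}" using neg negligible_subset by blast
    moreover have "\<not> negligible {c<..<d}" by (rule open_not_negligible) (use that in auto)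
    ultimately show False by simp
  qed
  have le: "d - c \<le> V d - V c" if cd: "a \<le> c" "c < d" "d \<le> b" for c d
  proof (rule field_le_epsilon)
    fix e :: real assume e: "e > 0"
    define h where "h = min (e / 2) ((d - c) / 2)"
    have h: "0 < h" "h \<le> e / 2" "h \<le> (d - c) / 2" using e cd unfolding h_def by (simp_all only: min.cobounded1 min.cobounded2) auto
    obtain x where x: "c < x" "x < c + h" "F x = 0" using dense[of c "c + h"] h cd by auto
    obtain y where y: "d - h < y" "y < d" "F y = 0" using dense[of "d - h" d] h cd by auto
    have h': "2 * h \<le> d - c" "2 * h \<le> e" using h by (simp_all add: field_simps)
    have xy: "x \<le> y" using x(2) y(1) h' by linarith
    have "\<bar>F y - F x - (y - x)\<bar> \<le> V y - V x" by (rule F_V) (use x y xy cd in auto)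
    then have "y - x \<le> V y - V x" using x y xy by simp
    also have "\<dots> \<le> V d - V c" using V_mono[of y d] V_mono[of c x] x y xy cd by auto
    finally show "d - c \<le> V d - V c + e" using x y h' by linarith
  qed
  define \<epsilon> where "\<epsilon> = (b - a) / 3"
  have "\<epsilon> > 0" using ab by (simp add: \<epsilon>_def)
  from V_grid[OF this] obtain N T where N: "N > 0" "T \<subseteq> {..<N}" "real (card T) * ((b - a) / real N) \<le> \<epsilon>"
    "(\<Sum>i\<in>{..<N} - T. V (grid_point N (Suc i)) - V (grid_point N i)) \<le> \<epsilon>" unfolding grid_point_def by blast
  have "b - a = (\<Sum>i<N. (b - a) / real N)" using N(1) by simp
  also have "\<dots> = (\<Sum>i\<in>{..<N} - T. (b - a) / real N) + (\<Sum>i\<in>T. (b - a) / real N)"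
    by (rule sum.subset_diff[OF N(2)]) simp
  also have "(\<Sum>i\<in>{..<N} - T. (b - a) / real N) \<le> (\<Sum>i\<in>{..<N} - T. V (grid_point N (Suc i)) - V (grid_point N i))"
  proof (rule sum_mono)
    fix i assume "i \<in> {..<N} - T"
    then have i: "i < N" by auto
    show "(b - a) / real N \<le> V (grid_point N (Suc i)) - V (grid_point N i)"
      using le[of "grid_point N i" "grid_point N (Suc i)"] grid_point_props[OF N(1) i] by simp
  qed
  also have "(\<Sum>i\<in>T. (b - a) / real N) \<le> \<epsilon>" using N(3) by simp
  finally have "b - a \<le> \<epsilon> + \<epsilon>" using N(4) by linarith
  moreover have "3 * \<epsilon> = b - a" by (simp add: \<epsilon>_def)
  ultimately show False using \<open>\<epsilon> > 0\<close> by linarith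
qed

sublocale sl_nontrivial
  by unfold_locales (rule F_not_AE_zero)

text \<open>\<open>s\<close> is the value of \<open>F x - (x - a)\<close> at the midpoint. Taking an
  interior point keeps every comparison inside the open interval, away from jumps at the
  ends.\<close>

lemma frame_err_of_osc:
  assumes cd: "a \<le> c" "c \<le> d" "d \<le> b" and osc: "\<And>x y. c < x \<Longrightarrow> x \<le> y \<Longrightarrow> y < d \<Longrightarrow> V y - V x \<le> \<eta>"
  obtains s where "\<And>x. x \<in> {c<..<d} \<Longrightarrow> \<bar>frame_err s x\<bar> \<le> \<eta>"
proof -
  define z where "z = (c + d) / 2"
  have "\<bar>frame_err (F z - (z - a)) x\<bar> \<le> \<eta>" if x: "x \<in> {c<..<d}" for x
  proof -
    have z: "c < z" "z < d" using x by (auto simp: z_def)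
    show ?thesis
    proof (cases "x \<le> z")
      case True
      then show ?thesis using F_V[of x z] osc[of x z] x z cd by (auto simp: frame_err_def)
    next
      case False
      then show ?thesis using F_V[of z x] osc[of z x] x z cd by (auto simp: frame_err_def)
    qed
  qed
  then show ?thesis using that by blast
qed

text \<open>Subtracting the additive terms in length and \<open>q_mass\<close> from the angle leaves
  a cost of \<open>2 * pi\<close> per piece, to which the subdivision by levels of height
  \<open>L / k\<close> applies. The sign \<open>\<sigma>\<close> yields both halves of an absolute
  value.\<close>

lemma cell_crude:
  assumes k: "k > 0" and L: "L \<ge> 1" and t: "\<bar>t\<bar> = k\<^sup>2" and cd: "a \<le> c" "c \<le> d" "d \<le> b" and \<sigma>: "\<sigma> \<in> {1, -1 :: real}"
  shows "\<sigma> * (angle t d - angle t c) \<le> ((V d - V c) * k / L + 2) * (2 * pi) + 3 * L * k * (d - c) + 2 * L / k * (q_mass d - q_mass c)"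
proof -
  define r where "r x = \<sigma> * angle t x - 3 * L * k * x - 2 * L / k * q_mass x" for x
  have "r d - r c \<le> ((V d - V c) / (L / k) + 2) * (2 * pi)"
  proof (rule level_split_real[OF cd(2)])
    show "V x \<le> V y" if "c \<le> x" "x \<le> y" "y \<le> d" for x y using V_mono[of x y] that cd by auto
    show "L / k > 0" using k L by simp
    fix c' d' assume c': "c \<le> c'" "c' \<le> d'" "d' \<le> d" and osc: "\<And>x y. c' < x \<Longrightarrow> x \<le> y \<Longrightarrow> y < d' \<Longrightarrow> V y - V x \<le> L / k"
    then have c'': "a \<le> c'" "c' \<le> d'" "d' \<le> b" using cd by auto
    obtain s where "\<And>x. x \<in> {c'<..<d'} \<Longrightarrow> \<bar>frame_err s x\<bar> \<le> L / k" using frame_err_of_osc[OF c'' osc] by blast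
    from rotation_crude[OF k L t c'' this] have
      "\<sigma> * (angle t d' - angle t c') \<le> 2 * pi + 3 * L * k * (d' - c') + 2 * L / k * (q_mass d' - q_mass c')"
      using \<sigma> by auto
    then show "r d' - r c' \<le> 2 * pi" by (simp add: r_def algebra_simps add_divide_distrib diff_divide_distrib)
  qed auto
  then show ?thesis using k by (simp add: r_def algebra_simps add_divide_distrib diff_divide_distrib)
qed

text \<open>The model rotation \<open>k * (d - c)\<close> is additive as well and goes into
  \<open>r\<close>; the levels now have height \<open>\<delta> / k\<close>, so there are more pieces
  but the rate is nearly exact.\<close>

lemma cell_fine:
  assumes k: "k > 0" and \<delta>: "0 < \<delta>" "\<delta> \<le> 1" and cd: "a \<le> c" "c \<le> d" "d \<le> b" and \<sigma>: "\<sigma> \<in> {1, -1 :: real}"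
  shows "\<sigma> * (angle (k\<^sup>2) d - angle (k\<^sup>2) c - k * (d - c)) \<le> ((V d - V c) * k / \<delta> + 2) * (2 * pi) + 2 * \<delta> * k * (d - c) + 2 / k * (q_mass d - q_mass c)"
proof -
  define r where "r x = \<sigma> * (angle (k\<^sup>2) x - k * x) - 2 * \<delta> * k * x - 2 / k * q_mass x" for x
  have "r d - r c \<le> ((V d - V c) / (\<delta> / k) + 2) * (2 * pi)"
  proof (rule level_split_real[OF cd(2)])
    show "V x \<le> V y" if "c \<le> x" "x \<le> y" "y \<le> d" for x y using V_mono[of x y] that cd by auto
    show "\<delta> / k > 0" using k \<delta> by simp
    fix c' d' assume c': "c \<le> c'" "c' \<le> d'" "d' \<le> d" and osc: "\<And>x y. c' < x \<Longrightarrow> x \<le> y \<Longrightarrow> y < d' \<Longrightarrow> V y - V x \<le> \<delta> / k"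
    then have c'': "a \<le> c'" "c' \<le> d'" "d' \<le> b" using cd by auto
    obtain s where "\<And>x. x \<in> {c'<..<d'} \<Longrightarrow> \<bar>frame_err s x\<bar> \<le> \<delta> / k" using frame_err_of_osc[OF c'' osc] by blast
    from rotation_fine[OF k less_imp_le[OF \<delta>(1)] \<delta>(2) c'' this] have
      "\<sigma> * (angle (k\<^sup>2) d' - angle (k\<^sup>2) c' - k * (d' - c')) \<le> 2 * pi + 2 * \<delta> * k * (d' - c') + 2 / k * (q_mass d' - q_mass c')"
      using \<sigma> by auto
    then show "r d' - r c' \<le> 2 * pi" by (simp add: r_def algebra_simps add_divide_distrib diff_divide_distrib)
  qed auto
  then show ?thesis using k by (simp add: r_def algebra_simps add_divide_distrib diff_divide_distrib)
qed

text \<open>Only a decrease of the angle is bounded here. Levels of height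
  \<open>\<delta> / k\<close> with \<open>\<delta> \<le> 1/4\<close> meet the tolerance of the
  barrier, and each piece loses at most \<open>4 * pi\<close>.\<close>

lemma cell_barrier:
  assumes k: "k > 0" and \<delta>: "0 < \<delta>" "\<delta> \<le> 1/4" and cd: "a \<le> c" "c \<le> d" "d \<le> b" and Qk: "2 / k * q_mass b < pi / 3"
  shows "angle (- k\<^sup>2) c - angle (- k\<^sup>2) d \<le> ((V d - V c) * k / \<delta> + 2) * (4 * pi)"
proof -
  define r where "r x = - angle (- k\<^sup>2) x" for x
  have "r d - r c \<le> ((V d - V c) / (\<delta> / k) + 2) * (4 * pi)"
  proof (rule level_split_real[OF cd(2)])
    show "V x \<le> V y" if "c \<le> x" "x \<le> y" "y \<le> d" for x y using V_mono[of x y] that cd by auto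
    show "\<delta> / k > 0" using k \<delta> by simp
    fix c' d' assume c': "c \<le> c'" "c' \<le> d'" "d' \<le> d" and osc: "\<And>x y. c' < x \<Longrightarrow> x \<le> y \<Longrightarrow> y < d' \<Longrightarrow> V y - V x \<le> \<delta> / k"
    then have c'': "a \<le> c'" "c' \<le> d'" "d' \<le> b" using cd by auto
    obtain s where s: "\<And>x. x \<in> {c'<..<d'} \<Longrightarrow> \<bar>frame_err s x\<bar> \<le> \<delta> / k" using frame_err_of_osc[OF c'' osc] by blast
    have "\<delta> / k \<le> (1/4) / k" using k \<delta> by (intro divide_right_mono) auto
    then have "\<bar>frame_err s x\<bar> \<le> (1/4) / k" if "x \<in> {c'<..<d'}" for x using s[OF that] by linarith
    from rotation_barrier[OF k c'' this Qk] show "r d' - r c' \<le> 4 * pi" by (simp add: r_def)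
  qed auto
  then show ?thesis using k by (simp add: r_def)
qed

lemma angle_a: "angle t a = 0" by (simp add: angle_def log_path_def)

text \<open>One bound \<open>E i\<close> per cell covers both signs of \<open>t\<close>. Its
  \<open>8 * pi\<close> and the coefficient \<open>4 * pi * k / \<delta>\<close> come from the
  barrier, the most expensive case outside \<open>T\<close>; the 1 added to \<open>3 * L\<close>
  absorbs the model rotation over a cell of \<open>T\<close>, where the coarse bound does not
  contain it.\<close>

lemma total_rotation:
  assumes k: "k > 0" and L: "L \<ge> 1" and \<delta>: "0 < \<delta>" "\<delta> \<le> 1/4" and Qk: "2 / k * q_mass b < pi / 3"
    and N: "N > 0" "T \<subseteq> {..<N}" "real (card T) * ((b - a) / real N) \<le> \<epsilon>"
    "(\<Sum>i\<in>{..<N} - T. V (grid_point N (Suc i)) - V (grid_point N i)) \<le> \<epsilon>"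
  defines "R \<equiv> 8 * pi * real N + 2 * pi * k / L * (V b - V a) + (3 * L + 1) * k * \<epsilon> + 4 * pi * k / \<delta> * \<epsilon>
     + 2 * \<delta> * k * (b - a) + 2 * L / k * q_mass b"
  shows "\<bar>angle (k\<^sup>2) b - k * (b - a)\<bar> \<le> R" "- angle (- k\<^sup>2) b \<le> R"
proof -
  define dV where "dV i = V (grid_point N (Suc i)) - V (grid_point N i)" for i
  define dQ where "dQ i = q_mass (grid_point N (Suc i)) - q_mass (grid_point N i)" for i
  define l where "l = (b - a) / real N"
  define E where "E i = 8 * pi + 2 * pi * k / L * dV i + (if i \<in> T then (3 * L + 1) * k * l else 4 * pi * k / \<delta> * dV i)
     + 2 * \<delta> * k * l + 2 * L / k * dQ i" for i
  have l: "l > 0" using ab N by (simp add: l_def)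
  have dV: "dV i \<ge> 0" if "i < N" for i
    using V_mono[of "grid_point N i" "grid_point N (Suc i)"] grid_point_props[OF N(1) that] by (simp add: dV_def)
  have dQ: "dQ i \<ge> 0" if "i < N" for i
    using q_mass_mono[of "grid_point N i" "grid_point N (Suc i)"] grid_point_props[OF N(1) that] by (simp add: dQ_def)
  have sumE: "(\<Sum>i<N. E i) \<le> R"
  proof -
    have 1: "(\<Sum>i<N. if i \<in> T then (3 * L + 1) * k * l else 4 * pi * k / \<delta> * dV i)
      = (\<Sum>i\<in>{..<N} - T. 4 * pi * k / \<delta> * dV i) + (\<Sum>i\<in>T. (3 * L + 1) * k * l)"
      by (subst sum.subset_diff[OF N(2)]) (auto intro!: sum.cong arg_cong2[where f = "(+)"])
    have 2: "(\<Sum>i\<in>{..<N} - T. 4 * pi * k / \<delta> * dV i) \<le> 4 * pi * k / \<delta> * \<epsilon>"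
      unfolding sum_distrib_left[symmetric] dV_def using N(4) k \<delta> by (intro mult_left_mono) auto
    have 3: "(\<Sum>i\<in>T. (3 * L + 1) * k * l) \<le> (3 * L + 1) * k * \<epsilon>"
    proof -
      have "(3 * L + 1) * k * (real (card T) * l) \<le> (3 * L + 1) * k * \<epsilon>"
        using N(3) k L unfolding l_def by (intro mult_left_mono) auto
      then show ?thesis by (simp add: algebra_simps)
    qed
    have 4: "(\<Sum>i<N. dV i) = V b - V a" unfolding dV_def sum_grid_telescope using grid_point_ends[OF N(1)] by simp
    have 5: "(\<Sum>i<N. dQ i) = q_mass b" unfolding dQ_def sum_grid_telescope using grid_point_ends[OF N(1)] by (simp add: q_mass_a)
    have 6: "real N * l = b - a" using N(1) by (simp add: l_def)
    have "(\<Sum>i<N. E i) = 8 * pi * real N + 2 * pi * k / L * (\<Sum>i<N. dV i)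
      + (\<Sum>i<N. if i \<in> T then (3 * L + 1) * k * l else 4 * pi * k / \<delta> * dV i) + 2 * \<delta> * k * (real N * l) + 2 * L / k * (\<Sum>i<N. dQ i)"
      unfolding E_def by (simp add: sum.distrib sum_distrib_left)
    then show ?thesis unfolding R_def 4 5 6 1 using 2 3 by linarith
  qed
  have Ecrude: "((dV i) * k / L + 2) * (2 * pi) + 3 * L * k * l + 2 * L / k * dQ i + k * l \<le> E i" if "i < N" "i \<in> T" for i
    using that k \<delta> l by (simp add: E_def algebra_simps)
  have EN: "E i = 8 * pi + 2 * pi * k / L * dV i + 4 * (pi * k / \<delta> * dV i) + 2 * \<delta> * k * l + 2 * L / k * dQ i"
    if "i \<notin> T" for i using that by (simp add: E_def)
  have nn: "0 \<le> 2 * pi * k / L * dV i" "0 \<le> pi * k / \<delta> * dV i" "0 \<le> 2 * \<delta> * k * l" "0 \<le> 2 * L / k * dQ i" if "i < N" for i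
    using dV[OF that] dQ[OF that] k L \<delta> l by (auto intro!: mult_nonneg_nonneg divide_nonneg_nonneg)
  have Efine: "((dV i) * k / \<delta> + 2) * (2 * pi) + 2 * \<delta> * k * l + 2 / k * dQ i \<le> E i" if "i < N" "i \<notin> T" for i
  proof -
    have "2 / k * dQ i \<le> 2 * L / k * dQ i" using dQ[OF that(1)] k L by (intro mult_right_mono divide_right_mono) auto
    moreover have "((dV i) * k / \<delta> + 2) * (2 * pi) = 2 * (pi * k / \<delta> * dV i) + 4 * pi" by (simp add: algebra_simps)
    ultimately show ?thesis unfolding EN[OF that(2)] using nn[OF that(1)] pi_gt_zero by linarith
  qed
  have Ebar: "((dV i) * k / \<delta> + 2) * (4 * pi) \<le> E i" if "i < N" "i \<notin> T" for i
  proof -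
    have "((dV i) * k / \<delta> + 2) * (4 * pi) = 4 * (pi * k / \<delta> * dV i) + 8 * pi" by (simp add: algebra_simps)
    then show ?thesis unfolding EN[OF that(2)] using nn[OF that(1)] by linarith
  qed
  have pos: "\<sigma> * (angle (k\<^sup>2) b - k * (b - a)) \<le> R" if \<sigma>: "\<sigma> \<in> {1, -1}" for \<sigma>
  proof -
    have "\<sigma> * (angle (k\<^sup>2) b - k * (b - a)) = (\<Sum>i<N. \<sigma> * (angle (k\<^sup>2) (grid_point N (Suc i)) - k * grid_point N (Suc i)) - \<sigma> * (angle (k\<^sup>2) (grid_point N i) - k * grid_point N i))"
      using sum_grid_telescope[of "\<lambda>x. \<sigma> * (angle (k\<^sup>2) x - k * x)" N] grid_point_ends[OF N(1)] by (simp add: angle_a algebra_simps)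
    also have "\<dots> \<le> (\<Sum>i<N. E i)"
    proof (rule sum_mono)
      fix i assume "i \<in> {..<N}"
      then have i: "i < N" by simp
      note g = grid_point_props[OF N(1) i]
      have gl: "grid_point N (Suc i) - grid_point N i = l" using g(4) by (simp add: l_def)
      have eq: "\<sigma> * (angle (k\<^sup>2) (grid_point N (Suc i)) - k * grid_point N (Suc i)) - \<sigma> * (angle (k\<^sup>2) (grid_point N i) - k * grid_point N i)
        = \<sigma> * (angle (k\<^sup>2) (grid_point N (Suc i)) - angle (k\<^sup>2) (grid_point N i)) - \<sigma> * (k * l)"
        unfolding gl[symmetric] by (simp add: algebra_simps)
      show "\<sigma> * (angle (k\<^sup>2) (grid_point N (Suc i)) - k * grid_point N (Suc i)) - \<sigma> * (angle (k\<^sup>2) (grid_point N i) - k * grid_point N i) \<le> E i"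
      proof (cases "i \<in> T")
        case True
        have "- \<sigma> * (k * l) \<le> k * l" using \<sigma> k l by auto
        then show ?thesis using cell_crude[OF k L _ g(1) less_imp_le[OF g(2)] g(3) \<sigma>, of "k\<^sup>2"] Ecrude[OF i True]
          unfolding eq gl dV_def dQ_def by simp
      next
        case False
        have "\<delta> \<le> 1" using \<delta> by simp
        from cell_fine[OF k \<delta>(1) this g(1) less_imp_le[OF g(2)] g(3) \<sigma>] Efine[OF i False]
        show ?thesis unfolding eq gl dV_def dQ_def by (simp add: right_diff_distrib)
      qed
    qed
    finally show ?thesis using sumE by simp
  qed
  from pos[of 1] pos[of "-1"] show "\<bar>angle (k\<^sup>2) b - k * (b - a)\<bar> \<le> R" by auto
  have "- angle (- k\<^sup>2) b = (\<Sum>i<N. - angle (- k\<^sup>2) (grid_point N (Suc i)) - - angle (- k\<^sup>2) (grid_point N i))"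
    using sum_grid_telescope[of "\<lambda>x. - angle (- k\<^sup>2) x" N] grid_point_ends[OF N(1)] by (simp add: angle_a)
  also have "\<dots> \<le> (\<Sum>i<N. E i)"
  proof (rule sum_mono)
    fix i assume "i \<in> {..<N}"
    then have i: "i < N" by simp
    note g = grid_point_props[OF N(1) i]
    have gl: "grid_point N (Suc i) - grid_point N i = l" using g(4) by (simp add: l_def)
    show "- angle (- k\<^sup>2) (grid_point N (Suc i)) - - angle (- k\<^sup>2) (grid_point N i) \<le> E i"
    proof (cases "i \<in> T")
      case True
      have "0 \<le> k * l" using k l by simp
      then show ?thesis using cell_crude[OF k L _ g(1) less_imp_le[OF g(2)] g(3), of "- k\<^sup>2" "-1"] Ecrude[OF i True]
        unfolding gl dV_def dQ_def by simp
    next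
      case False
      from cell_barrier[OF k \<delta> g(1) less_imp_le[OF g(2)] g(3) Qk] Ebar[OF i False]
      show ?thesis unfolding dV_def by simp
    qed
  qed
  finally show "- angle (- k\<^sup>2) b \<le> R" using sumE by simp
qed

lemma rotation_asymptotics:
  assumes "\<tau> > 0"
  obtains K where "K > 0" "\<And>k. k \<ge> K \<Longrightarrow> \<bar>angle (k\<^sup>2) b - k * (b - a)\<bar> \<le> \<tau> * k"
    "\<And>k. k \<ge> K \<Longrightarrow> - angle (- k\<^sup>2) b \<le> \<tau> * k"
proof -
  \<comment> \<open>\<open>R\<close> splits into five groups of terms, each to be made at most
    \<open>\<rho> * k\<close>.\<close>
  define \<rho> where "\<rho> = \<tau> / 5"
  have \<rho>: "\<rho> > 0" using assms by (simp add: \<rho>_def)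
  define W where "W = V b - V a"
  have W: "W \<ge> 0" using V_mono[of a b] ab by (simp add: W_def)
  have Qb: "q_mass b \<ge> 0" using q_mass_mono[of a b] ab q_mass_a by simp
  \<comment> \<open>Large \<open>L\<close> makes the cost \<open>2 * pi * k / L\<close> of cutting
    through the whole mass of \<open>V\<close> small against \<open>k\<close>.\<close>
  define L where "L = 1 + 2 * pi * W / \<rho>"
  have L: "L \<ge> 1" using W \<rho> by (simp add: L_def)
  have "\<rho> * L = \<rho> + 2 * pi * W" using \<rho> by (simp add: L_def distrib_left)
  then have "2 * pi * W \<le> \<rho> * L" using \<rho> by simp
  then have L1: "2 * pi / L * W \<le> \<rho>" using L by (simp add: divide_le_eq)
  define \<delta> where "\<delta> = min (1/4) (\<rho> / (2 * (b - a)))"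
  have \<delta>: "0 < \<delta>" "\<delta> \<le> 1/4" "2 * \<delta> * (b - a) \<le> \<rho>"
  proof -
    show "0 < \<delta>" using \<rho> ab by (simp add: \<delta>_def)
    show "\<delta> \<le> 1/4" unfolding \<delta>_def by (rule min.cobounded1)
    have "\<delta> * (2 * (b - a)) \<le> \<rho> / (2 * (b - a)) * (2 * (b - a))" using ab by (intro mult_right_mono) (auto simp: \<delta>_def)
    also have "\<dots> = \<rho>" using ab by simp
    finally show "2 * \<delta> * (b - a) \<le> \<rho>" by (simp only: mult_ac)
  qed
  \<comment> \<open>The first entry weighs the length of the cells in \<open>T\<close> against the
    coarse rate, the second the mass of the other cells against the fineness
    \<open>\<delta>\<close>.\<close>
  define \<epsilon> where "\<epsilon> = min (\<rho> / (3 * L + 1)) (\<rho> * \<delta> / (4 * pi))"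
  have \<epsilon>: "\<epsilon> > 0" "(3 * L + 1) * \<epsilon> \<le> \<rho>" "4 * pi / \<delta> * \<epsilon> \<le> \<rho>"
  proof -
    show "\<epsilon> > 0" using \<rho> L \<delta> by (auto simp: \<epsilon>_def)
    have "(3 * L + 1) * \<epsilon> \<le> (3 * L + 1) * (\<rho> / (3 * L + 1))" using L by (intro mult_left_mono) (auto simp: \<epsilon>_def)
    then show "(3 * L + 1) * \<epsilon> \<le> \<rho>" using L by simp
    have "4 * pi / \<delta> * \<epsilon> \<le> 4 * pi / \<delta> * (\<rho> * \<delta> / (4 * pi))" using \<delta> by (intro mult_left_mono) (auto simp: \<epsilon>_def)
    then show "4 * pi / \<delta> * \<epsilon> \<le> \<rho>" using \<delta> by simp
  qed
  from V_grid[OF \<epsilon>(1)] obtain N T where N: "N > 0" "T \<subseteq> {..<N}" "real (card T) * ((b - a) / real N) \<le> \<epsilon>"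
    "(\<Sum>i\<in>{..<N} - T. V (grid_point N (Suc i)) - V (grid_point N i)) \<le> \<epsilon>" unfolding grid_point_def by blast
  define c where "c = 8 * pi * real N + 2 * L * q_mass b"
  \<comment> \<open>The grid is fixed by now, so its cost and the effect of \<open>q\<close> are
    constants, negligible for large \<open>k\<close>. The last entry gives the strict inequality
    required by the barrier.\<close>
  define K where "K = max 1 (max (c / \<rho>) (6 * q_mass b / pi + 1))"
  have R: "8 * pi * real N + 2 * pi * k / L * (V b - V a) + (3 * L + 1) * k * \<epsilon> + 4 * pi * k / \<delta> * \<epsilon>
     + 2 * \<delta> * k * (b - a) + 2 * L / k * q_mass b \<le> \<tau> * k" and Qk: "2 / k * q_mass b < pi / 3" and k0: "k > 0" if "k \<ge> K" for k
  proof -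
    have k: "k \<ge> 1" "k \<ge> c / \<rho>" "k \<ge> 6 * q_mass b / pi + 1" using that by (auto simp: K_def)
    then show "k > 0" by simp
    have "6 * q_mass b / pi < k" using k(3) by simp
    then show "2 / k * q_mass b < pi / 3" using k(1) by (simp add: field_simps)
    have "2 * L * q_mass b * 1 \<le> 2 * L * q_mass b * k" using k(1) L Qb by (intro mult_left_mono) auto
    then have "2 * L / k * q_mass b \<le> 2 * L * q_mass b" using k(1) by (simp add: divide_le_eq)
    moreover have "c \<le> \<rho> * k" using k(2) \<rho> by (simp add: field_simps)
    ultimately have 1: "8 * pi * real N + 2 * L / k * q_mass b \<le> \<rho> * k" by (simp add: c_def)
    have k0: "k \<ge> 0" using k by simp
    note m = mult_right_mono[OF _ k0]
    have "2 * pi * k / L * (V b - V a) \<le> \<rho> * k" using m[OF L1] by (simp add: W_def algebra_simps)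
    moreover have "(3 * L + 1) * k * \<epsilon> \<le> \<rho> * k" using m[OF \<epsilon>(2)] by (simp add: algebra_simps)
    moreover have "4 * pi * k / \<delta> * \<epsilon> \<le> \<rho> * k" using m[OF \<epsilon>(3)] by (simp add: algebra_simps)
    moreover have "2 * \<delta> * k * (b - a) \<le> \<rho> * k" using m[OF \<delta>(3)] by (simp add: algebra_simps)
    moreover have "\<tau> * k = 5 * (\<rho> * k)" by (simp add: \<rho>_def)
    ultimately show "8 * pi * real N + 2 * pi * k / L * (V b - V a) + (3 * L + 1) * k * \<epsilon> + 4 * pi * k / \<delta> * \<epsilon>
     + 2 * \<delta> * k * (b - a) + 2 * L / k * q_mass b \<le> \<tau> * k" using 1 by linarith
  qed
  show ?thesis
  proof (rule that)
    show "K > 0" by (simp add: K_def)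
    fix k assume k: "k \<ge> K"
    note T = total_rotation[OF k0[OF k] L \<delta>(1,2) Qk[OF k] N]
    show "\<bar>angle (k\<^sup>2) b - k * (b - a)\<bar> \<le> \<tau> * k" using T(1) R[OF k] by linarith
    show "- angle (- k\<^sup>2) b \<le> \<tau> * k" using T(2) R[OF k] by linarith
  qed
qed

lemma count_asymptotics:
  defines "N \<equiv> \<lambda>t. real (eigenvalue_count (leb_on a b) dirichlet t)"
  shows "(\<lambda>t. N t - (b - a) / pi * sqrt t) \<in> o[at_top](\<lambda>t. sqrt t)"
    and "N \<in> o[at_bot](\<lambda>t. sqrt \<bar>t\<bar>)"
proof -
  \<comment> \<open>Absorbs the counting error 1 and the angle at parameter 0.\<close>
  define c0 where "c0 = 1 + \<bar>angle 0 b\<bar> / pi"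
  have c0: "c0 \<ge> 1" by (simp add: c0_def)
  have Np: "\<bar>N t - angle t b / pi\<bar> \<le> c0" if "t \<ge> 0" for t
  proof -
    have "angle 0 b \<le> angle t b" using strict_mono_less_eq[OF angle_strict_mono, of 0 t] that by simp
    then have "\<bar>N t - (angle t b / pi - angle 0 b / pi)\<bar> \<le> 1"
      using eigenvalue_count_angle(2)[of t] by (simp add: N_def diff_divide_distrib)
    moreover have "\<bar>angle 0 b / pi\<bar> = \<bar>angle 0 b\<bar> / pi" by simp
    ultimately show ?thesis unfolding c0_def by linarith
  qed
  have Nm: "N t \<le> c0 - angle t b / pi" if "t \<le> 0" for t
  proof -
    have "angle t b \<le> angle 0 b" using strict_mono_less_eq[OF angle_strict_mono, of t 0] that by simp
    then have "\<bar>N t - (angle 0 b / pi - angle t b / pi)\<bar> \<le> 1"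
      using eigenvalue_count_angle(2)[of t] by (simp add: N_def diff_divide_distrib)
    moreover have "\<bar>angle 0 b / pi\<bar> = \<bar>angle 0 b\<bar> / pi" by simp
    ultimately show ?thesis unfolding c0_def by linarith
  qed
  \<comment> \<open>The gain of \<open>1 / pi\<close> is simply given away.\<close>
  have pp: "x / pi \<le> x" if "x \<ge> 0" for x :: real
    using that pi_gt3 by (simp add: divide_le_eq mult_left_le mult_le_cancel_left1) 
  show "(\<lambda>t. N t - (b - a) / pi * sqrt t) \<in> o[at_top](\<lambda>t. sqrt t)"
  proof (rule landau_o.smallI)
    fix e :: real assume e: "e > 0"
    obtain K where K: "K > 0" "\<And>k. k \<ge> K \<Longrightarrow> \<bar>angle (k\<^sup>2) b - k * (b - a)\<bar> \<le> e / 2 * k"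
      by (rule rotation_asymptotics[OF half_gt_zero[OF e]]) (rule that)
    define k0 where "k0 = max K (2 * c0 / e)"
    have "norm (N t - (b - a) / pi * sqrt t) \<le> e * norm (sqrt t)" if t: "t \<ge> k0\<^sup>2" for t
    proof -
      have k00: "k0 > 0" using K(1) by (simp add: k0_def)
      have t0: "t \<ge> 0" using t by (meson order.trans zero_le_power2)
      define k where "k = sqrt t"
      have k: "k \<ge> k0" "k\<^sup>2 = t" using t0 real_le_rsqrt[OF t] by (auto simp: k_def)
      have k1: "k > 0" using k(1) k00 by simp
      have "\<bar>angle t b - k * (b - a)\<bar> \<le> e / 2 * k" using K(2)[of k] k by (simp add: k0_def)
      then have "\<bar>angle t b - k * (b - a)\<bar> / pi \<le> e / 2 * k"
        using pp[OF abs_ge_zero] by (rule order.trans[rotated])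
      moreover have "angle t b / pi - (b - a) / pi * k = (angle t b - k * (b - a)) / pi" by (simp add: field_simps)
      then have "\<bar>angle t b / pi - (b - a) / pi * k\<bar> = \<bar>angle t b - k * (b - a)\<bar> / pi" by simp
      ultimately have 1: "\<bar>angle t b / pi - (b - a) / pi * k\<bar> \<le> e / 2 * k" by simp
      have "c0 \<le> e / 2 * k" using k(1) e by (simp add: k0_def field_simps)
      with Np[OF t0] have 2: "\<bar>N t - angle t b / pi\<bar> \<le> e / 2 * k" by (rule order.trans)
      have "\<bar>N t - (b - a) / pi * k\<bar> \<le> \<bar>N t - angle t b / pi\<bar> + \<bar>angle t b / pi - (b - a) / pi * k\<bar>"
        using abs_triangle_ineq[of "N t - angle t b / pi" "angle t b / pi - (b - a) / pi * k"] by simp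
      from order.trans[OF this add_mono[OF 2 1]]
      have "\<bar>N t - (b - a) / pi * k\<bar> \<le> e / 2 * k + e / 2 * k" .
      then have "\<bar>N t - (b - a) / pi * k\<bar> \<le> e * k" by simp
      then show ?thesis using k1 by (simp add: k_def)
    qed
    then show "\<forall>\<^sub>F t in at_top. norm (N t - (b - a) / pi * sqrt t) \<le> e * norm (sqrt t)"
      unfolding eventually_at_top_linorder by blast
  qed
  show "N \<in> o[at_bot](\<lambda>t. sqrt \<bar>t\<bar>)"
  proof (rule landau_o.smallI)
    fix e :: real assume e: "e > 0"
    obtain K where K: "K > 0" "\<And>k. k \<ge> K \<Longrightarrow> - angle (- k\<^sup>2) b \<le> e / 2 * k"
      by (rule rotation_asymptotics[OF half_gt_zero[OF e]]) (rule that)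
    define k0 where "k0 = max K (2 * c0 / e)"
    have "norm (N t) \<le> e * norm (sqrt \<bar>t\<bar>)" if t: "t \<le> - k0\<^sup>2" for t
    proof -
      have k00: "k0 > 0" using K(1) by (simp add: k0_def)
      have t0: "t \<le> 0" using t zero_le_power2[of k0] by linarith
      define k where "k = sqrt (- t)"
      have "k0\<^sup>2 \<le> - t" using t by simp
      then have k: "k \<ge> k0" "- k\<^sup>2 = t" using t0 real_le_rsqrt[of k0 "- t"] by (auto simp: k_def)
      have k1: "k > 0" using k(1) k00 by simp
      have 1: "- angle t b \<le> e / 2 * k" using K(2)[of k] k by (simp add: k0_def)
      have "- angle t b / pi \<le> e / 2 * k"
      proof (cases "- angle t b \<ge> 0")
        case True then show ?thesis using pp[of "- angle t b"] 1 by linarith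
      next
        case False
        then have "- angle t b / pi \<le> 0" by simp
        moreover have "0 \<le> e / 2 * k" using e k1 by simp
        ultimately show ?thesis by linarith
      qed
      moreover have "c0 \<le> e / 2 * k" using k(1) e by (simp add: k0_def field_simps)
      ultimately have "N t \<le> e * k" using Nm[OF t0] by linarith
      moreover have "sqrt \<bar>t\<bar> = k" using t0 by (simp add: k_def)
      moreover have "N t \<ge> 0" by (simp add: N_def)
      ultimately show ?thesis using k1 by simp
    qed
    then show "\<forall>\<^sub>F t in at_bot. norm (N t) \<le> e * norm (sqrt \<bar>t\<bar>)"
      unfolding eventually_at_bot_linorder by blast
  qed
qed

end

section \<open>Finite signed measures\<close>

lemma fsm_empty: "finite_signed_measure M \<mu> \<Longrightarrow> \<mu> {} = 0"
  by (simp add: finite_signed_measure_def)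

lemma fsm_sums:
  "finite_signed_measure M \<mu> \<Longrightarrow> range A \<subseteq> sets M \<Longrightarrow> disjoint_family A \<Longrightarrow>
    (\<lambda>n::nat. \<mu> (A n)) sums \<mu> (\<Union>n. A n)"
  by (simp add: finite_signed_measure_def)

lemma fsm_add:
  assumes "finite_signed_measure M \<mu>" "A \<in> sets M" "B \<in> sets M" "A \<inter> B = {}"
  shows "\<mu> (A \<union> B) = \<mu> A + \<mu> B"
proof -
  have "(\<lambda>n. \<mu> (binaryset A B n)) sums \<mu> (\<Union>n. binaryset A B n)"
    by (rule fsm_sums[OF assms(1)])
      (use assms in \<open>auto simp: range_binaryset_eq disjoint_family_on_def binaryset_def split: nat.splits\<close>)
  moreover have "(\<lambda>n. \<mu> (binaryset A B n)) sums (\<mu> A + \<mu> B)"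
    by (rule binaryset_sums) (rule fsm_empty[OF assms(1)])
  ultimately show ?thesis using sums_unique2 by (metis UN_binaryset_eq)
qed

lemma fsm_diff:
  assumes "finite_signed_measure M \<mu>" "A \<in> sets M" "B \<in> sets M" "B \<subseteq> A"
  shows "\<mu> (A - B) = \<mu> A - \<mu> B"
  using fsm_add[OF assms(1), of B "A - B"] assms by (auto simp: Un_absorb1)

lemma fsm_uminus: "finite_signed_measure M \<mu> \<Longrightarrow> finite_signed_measure M (\<lambda>A. - \<mu> A)"
  by (auto simp: finite_signed_measure_def intro: sums_minus)

lemma fsm_plus: "finite_signed_measure M \<mu> \<Longrightarrow> finite_signed_measure M \<nu> \<Longrightarrow> finite_signed_measure M (\<lambda>A. \<mu> A + \<nu> A)"
  by (auto simp: finite_signed_measure_def intro: sums_add)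

text \<open>If the values on subsets of \<open>A\<close> are unbounded, a set of large absolute measure can be split
  off from \<open>A\<close> so that the rest still has this property; iterating this contradicts the
  convergence of the series.\<close>

lemma fsm_bounded:
  assumes \<mu>: "finite_signed_measure M \<mu>"
  obtains C where "\<And>A. A \<in> sets M \<Longrightarrow> \<bar>\<mu> A\<bar> \<le> C"
proof -
  define U where "U A \<longleftrightarrow> A \<in> sets M \<and> (\<forall>C. \<exists>B\<in>sets M. B \<subseteq> A \<and> \<bar>\<mu> B\<bar> > C)" for A
  have split: "\<exists>B. B \<in> sets M \<and> B \<subseteq> A \<and> \<bar>\<mu> B\<bar> > 1 \<and> U (A - B)" if A: "U A" for A
  proof -
    have AM: "A \<in> sets M" using A by (simp add: U_def)
    obtain E where E: "E \<in> sets M" "E \<subseteq> A" "\<bar>\<mu> E\<bar> > \<bar>\<mu> A\<bar> + 1" using A unfolding U_def by blast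
    have AE: "\<bar>\<mu> (A - E)\<bar> > 1" using fsm_diff[OF \<mu> AM E(1,2)] E(3) by linarith
    have "U E \<or> U (A - E)"
    proof (rule ccontr)
      assume "\<not> ?thesis"
      then obtain C1 C2 where C: "\<And>B. B \<in> sets M \<Longrightarrow> B \<subseteq> E \<Longrightarrow> \<bar>\<mu> B\<bar> \<le> C1"
        "\<And>B. B \<in> sets M \<Longrightarrow> B \<subseteq> A - E \<Longrightarrow> \<bar>\<mu> B\<bar> \<le> C2"
        using AM E(1) unfolding U_def by (metis not_le sets.Diff)
      obtain B where B: "B \<in> sets M" "B \<subseteq> A" "\<bar>\<mu> B\<bar> > C1 + C2" using A unfolding U_def by blast
      have "\<mu> B = \<mu> (B \<inter> E) + \<mu> (B - E)"
        using fsm_add[OF \<mu>, of "B \<inter> E" "B - E"] B E by (auto simp: Int_Diff_Un)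
      moreover have "\<bar>\<mu> (B \<inter> E)\<bar> \<le> C1" by (rule C(1)) (use B E in auto)
      moreover have "\<bar>\<mu> (B - E)\<bar> \<le> C2" by (rule C(2)) (use B E in auto)
      ultimately show False using B(3) by linarith
    qed
    then show ?thesis
    proof
      assume "U (A - E)" then show ?thesis using E by (intro exI[of _ E]) auto
    next
      assume "U E"
      moreover have "A - (A - E) = E" using E by auto
      ultimately show ?thesis using AE AM E by (intro exI[of _ "A - E"]) auto
    qed
  qed
  have "\<not> U (space M)"
  proof
    assume US: "U (space M)"
    define g where "g A = (SOME B. B \<in> sets M \<and> B \<subseteq> A \<and> \<bar>\<mu> B\<bar> > 1 \<and> U (A - B))" for A
    have g: "g A \<in> sets M" "g A \<subseteq> A" "\<bar>\<mu> (g A)\<bar> > 1" "U (A - g A)" if "U A" for A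
      using someI_ex[OF split[OF that]] by (auto simp: g_def)
    define S where "S n = ((\<lambda>A. A - g A) ^^ n) (space M)" for n
    have S: "U (S n)" for n by (induction n) (auto simp: S_def US g)
    have Smono: "S m \<subseteq> S n" if "n \<le> m" for m n
      by (rule lift_Suc_antimono_le[OF _ that]) (auto simp: S_def)
    have "disjoint_family (\<lambda>n. g (S n))"
      unfolding disjoint_family_on_def
    proof (intro ballI impI)
      have *: "g (S m) \<inter> g (S n) = {}" if "m < n" for m n
      proof -
        have "S n \<subseteq> S (Suc m)" using that by (intro Smono) auto
        moreover have "S (Suc m) \<inter> g (S m) = {}" by (auto simp: S_def)
        ultimately show ?thesis using g(2)[OF S[of n]] by blast
      qed
      fix m n :: nat assume "m \<noteq> n"
      then show "g (S m) \<inter> g (S n) = {}" using *[of m n] *[of n m] by (cases "m < n") auto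
    qed
    then have "(\<lambda>n. \<mu> (g (S n))) sums \<mu> (\<Union>n. g (S n))"
      by (intro fsm_sums[OF \<mu>]) (use g(1)[OF S] in auto)
    then have "(\<lambda>n. \<mu> (g (S n))) \<longlonglongrightarrow> 0" by (intro summable_LIMSEQ_zero) (rule sums_summable)
    then have "\<forall>\<^sub>F n in sequentially. dist (\<mu> (g (S n))) 0 < 1" by (rule tendstoD) simp
    then obtain n where "dist (\<mu> (g (S n))) 0 < 1" by (auto simp: eventually_sequentially)
    then show False using g(3)[OF S[of n]] by (simp add: dist_real_def)
  qed
  then obtain C where "\<And>B. B \<in> sets M \<Longrightarrow> B \<subseteq> space M \<Longrightarrow> \<bar>\<mu> B\<bar> \<le> C"
    unfolding U_def by (metis not_le sets.top)
  then show ?thesis using that sets.sets_into_space by metis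
qed

section \<open>Positive and negative variation\<close>

definition pos_var :: "'a measure \<Rightarrow> ('a set \<Rightarrow> real) \<Rightarrow> 'a set \<Rightarrow> ennreal" where
  "pos_var M \<mu> A = (SUP B \<in> {B \<in> sets M. B \<subseteq> A}. ennreal (\<mu> B))"

lemma pos_var_upper: "B \<in> sets M \<Longrightarrow> B \<subseteq> A \<Longrightarrow> ennreal (\<mu> B) \<le> pos_var M \<mu> A"
  unfolding pos_var_def by (rule SUP_upper) auto

lemma pos_var_mono: "A \<subseteq> A' \<Longrightarrow> pos_var M \<mu> A \<le> pos_var M \<mu> A'"
  unfolding pos_var_def by (rule SUP_subset_mono) auto

text \<open>Competitors for the two disjoint sets are united. A negative value counts as 0 in
  \<open>ennreal\<close>, in which case the other competitor alone suffices.\<close>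

lemma pos_var_superadd:
  assumes \<mu>: "finite_signed_measure M \<mu>" and "A \<inter> A' = {}"
  shows "pos_var M \<mu> A + pos_var M \<mu> A' \<le> pos_var M \<mu> (A \<union> A')"
proof -
  have "ennreal (\<mu> B) + ennreal (\<mu> B') \<le> pos_var M \<mu> (A \<union> A')"
    if B: "B \<in> sets M" "B \<subseteq> A" and B': "B' \<in> sets M" "B' \<subseteq> A'" for B B'
  proof -
    consider "\<mu> B \<le> 0" | "\<mu> B' \<le> 0" | "\<mu> B \<ge> 0" "\<mu> B' \<ge> 0" by linarith
    then show ?thesis
    proof cases
      case 1
      then show ?thesis using pos_var_upper[OF B'(1), of "A \<union> A'" \<mu>] B' by (auto simp: ennreal_neg)
    next
      case 2
      then show ?thesis using pos_var_upper[OF B(1), of "A \<union> A'" \<mu>] B by (auto simp: ennreal_neg)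
    next
      case 3
      have "B \<inter> B' = {}" using B B' assms by auto
      then have "ennreal (\<mu> B) + ennreal (\<mu> B') = ennreal (\<mu> (B \<union> B'))"
        using 3 fsm_add[OF \<mu> B(1) B'(1)] by (simp add: ennreal_plus)
      also have "\<dots> \<le> pos_var M \<mu> (A \<union> A')" by (rule pos_var_upper) (use B B' in auto)
      finally show ?thesis .
    qed
  qed
  note * = this
  have ne: "{B \<in> sets M. B \<subseteq> X} \<noteq> {}" for X by (auto intro!: exI[of _ "{}"])
  have "ennreal (\<mu> B) + pos_var M \<mu> A' \<le> pos_var M \<mu> (A \<union> A')" if "B \<in> sets M" "B \<subseteq> A" for B
  proof -
    have "ennreal (\<mu> B) + pos_var M \<mu> A' = (SUP B' \<in> {B \<in> sets M. B \<subseteq> A'}. ennreal (\<mu> B) + ennreal (\<mu> B'))"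
      unfolding pos_var_def by (rule ennreal_SUP_add_right[OF ne])
    also have "\<dots> \<le> pos_var M \<mu> (A \<union> A')" by (rule SUP_least) (use * that in auto)
    finally show ?thesis .
  qed
  then show ?thesis
  proof -
    assume **: "\<And>B. B \<in> sets M \<Longrightarrow> B \<subseteq> A \<Longrightarrow> ennreal (\<mu> B) + pos_var M \<mu> A' \<le> pos_var M \<mu> (A \<union> A')"
    have "pos_var M \<mu> A + pos_var M \<mu> A' = (SUP B \<in> {B \<in> sets M. B \<subseteq> A}. ennreal (\<mu> B) + pos_var M \<mu> A')"
      unfolding pos_var_def[of M \<mu> A] by (rule ennreal_SUP_add_left[OF ne, symmetric])
    also have "\<dots> \<le> pos_var M \<mu> (A \<union> A')" by (rule SUP_least) (use ** in auto)
    finally show ?thesis .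
  qed
qed

text \<open>One inequality is finite superadditivity in the limit. For the other, a competitor
  \<open>B\<close> for the union is cut into the sets \<open>B \<inter> A n\<close>, each of which
  competes for \<open>A n\<close>.\<close>

lemma pos_var_countably_additive:
  assumes \<mu>: "finite_signed_measure M \<mu>"
  shows "countably_additive (sets M) (pos_var M \<mu>)"
  unfolding countably_additive_def
proof (intro allI impI)
  fix A :: "nat \<Rightarrow> 'a set" assume A: "range A \<subseteq> sets M" "disjoint_family A" "(\<Union>i. A i) \<in> sets M"
  have "(\<Sum>i<n. pos_var M \<mu> (A i)) \<le> pos_var M \<mu> (\<Union>i<n. A i)" for n
  proof (induction n)
    case (Suc n)
    have "A i \<inter> A n = {}" if "i < n" for i
      using A(2) that by (intro disjoint_family_onD[of A UNIV]) auto
    then have "(\<Union>i<n. A i) \<inter> A n = {}" by auto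
    from pos_var_superadd[OF \<mu> this] have "pos_var M \<mu> (\<Union>i<n. A i) + pos_var M \<mu> (A n) \<le> pos_var M \<mu> (\<Union>i<Suc n. A i)"
      by (simp add: lessThan_Suc Un_commute)
    with Suc show ?case by (auto intro: order.trans add_right_mono)
  qed (auto simp: pos_var_def fsm_empty[OF \<mu>])
  also have "pos_var M \<mu> (\<Union>i<n. A i) \<le> pos_var M \<mu> (\<Union>i. A i)" for n by (rule pos_var_mono) auto
  finally have 1: "(\<Sum>i. pos_var M \<mu> (A i)) \<le> pos_var M \<mu> (\<Union>i. A i)" 
    by (simp add: suminf_le_const)
  have 2: "pos_var M \<mu> (\<Union>i. A i) \<le> (\<Sum>i. pos_var M \<mu> (A i))"
    unfolding pos_var_def[of M \<mu> "\<Union>i. A i"]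
  proof (rule SUP_least)
    fix B assume "B \<in> {B \<in> sets M. B \<subseteq> (\<Union>i. A i)}"
    then have B: "B \<in> sets M" "B \<subseteq> (\<Union>i. A i)" by auto
    have "(\<lambda>n. \<mu> (B \<inter> A n)) sums \<mu> (\<Union>n. B \<inter> A n)"
      by (rule fsm_sums[OF \<mu>]) (use A B in \<open>auto simp: disjoint_family_on_def\<close>)
    moreover have "(\<Union>n. B \<inter> A n) = B" using B by auto
    ultimately have "(\<lambda>n. \<Sum>i<n. \<mu> (B \<inter> A i)) \<longlonglongrightarrow> \<mu> B" by (simp add: sums_def)
    then have "(\<lambda>n. ennreal (\<Sum>i<n. \<mu> (B \<inter> A i))) \<longlonglongrightarrow> ennreal (\<mu> B)" by (rule tendsto_ennrealI)
    moreover have "ennreal (\<Sum>i<n. \<mu> (B \<inter> A i)) \<le> (\<Sum>i. pos_var M \<mu> (A i))" for n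
    proof -
      have "ennreal (\<Sum>i<n. \<mu> (B \<inter> A i)) \<le> (\<Sum>i<n. ennreal (\<mu> (B \<inter> A i)))"
      proof (induction n)
        case (Suc n)
        \<comment> \<open>Truncation of negative numbers to 0 is subadditive.\<close>
        have "ennreal (x + y) \<le> ennreal x + ennreal y" for x y
        proof (cases "x \<ge> 0 \<and> y \<ge> 0")
          case True then show ?thesis by (simp add: ennreal_plus)
        next
          case False
          then have "x + y \<le> x \<or> x + y \<le> y" by auto
          then show ?thesis
          proof
            assume "x + y \<le> x"
            then have "ennreal (x + y) \<le> ennreal x" by (rule ennreal_leI)
            then show ?thesis by (rule order.trans) simp
          next
            assume "x + y \<le> y"
            then have "ennreal (x + y) \<le> ennreal y" by (rule ennreal_leI)
            then show ?thesis by (rule order.trans) simp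
          qed
        qed
        from this[of "\<Sum>i<n. \<mu> (B \<inter> A i)" "\<mu> (B \<inter> A n)"] Suc show ?case
          by (auto intro: order.trans add_right_mono)
      qed simp
      also have "\<dots> \<le> (\<Sum>i<n. pos_var M \<mu> (A i))"
        by (intro sum_mono pos_var_upper) (use A B in auto)
      also have "\<dots> \<le> (\<Sum>i. pos_var M \<mu> (A i))" by (rule sum_le_suminf) auto
      finally show ?thesis .
    qed
    ultimately show "ennreal (\<mu> B) \<le> (\<Sum>i. pos_var M \<mu> (A i))" by (intro LIMSEQ_le_const2) auto
  qed
  show "(\<Sum>i. pos_var M \<mu> (A i)) = pos_var M \<mu> (\<Union>i. A i)" using 1 2 by (rule antisym)
qed

lemma sets_pos_variation [simp]: "sets (pos_variation M \<mu>) = sets M" "space (pos_variation M \<mu>) = space M"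
  by (auto simp: pos_variation_def sets.sigma_sets_eq sets.space_closed)

lemma sets_neg_variation [simp]: "sets (neg_variation M \<mu>) = sets M" "space (neg_variation M \<mu>) = space M"
  by (auto simp: neg_variation_def)

lemma emeasure_pos_variation:
  assumes \<mu>: "finite_signed_measure M \<mu>" and "A \<in> sets M"
  shows "emeasure (pos_variation M \<mu>) A = pos_var M \<mu> A"
proof (rule emeasure_measure_of[OF pos_variation_def[folded pos_var_def]])
  show "sets M \<subseteq> Pow (space M)" by (rule sets.space_closed)
  show "A \<in> sets (pos_variation M \<mu>)" using assms by simp
  show "positive (sets (pos_variation M \<mu>)) (pos_var M \<mu>)" by (simp add: positive_def pos_var_def fsm_empty[OF \<mu>])
  show "countably_additive (sets (pos_variation M \<mu>)) (pos_var M \<mu>)" using pos_var_countably_additive[OF \<mu>] by simp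
qed

lemma finite_pos_variation:
  assumes \<mu>: "finite_signed_measure M \<mu>"
  shows "finite_measure (pos_variation M \<mu>)"
proof
  obtain C where C: "\<And>A. A \<in> sets M \<Longrightarrow> \<bar>\<mu> A\<bar> \<le> C" using fsm_bounded[OF \<mu>] by blast
  have "pos_var M \<mu> (space M) \<le> ennreal C"
    unfolding pos_var_def by (rule SUP_least) (use C in \<open>auto intro!: ennreal_leI dest: abs_le_D1\<close>)
  then show "emeasure (pos_variation M \<mu>) (space (pos_variation M \<mu>)) \<noteq> \<infinity>"
    using emeasure_pos_variation[OF \<mu>, of "space M"] by (auto simp: top_unique)
qed

lemma finite_neg_variation: "finite_signed_measure M \<mu> \<Longrightarrow> finite_measure (neg_variation M \<mu>)"
  unfolding neg_variation_def by (intro finite_pos_variation fsm_uminus)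

lemma pos_variation_upper:
  assumes \<mu>: "finite_signed_measure M \<mu>" and "A \<in> sets M" "B \<in> sets M" "B \<subseteq> A"
  shows "\<mu> B \<le> measure (pos_variation M \<mu>) A"
proof -
  interpret finite_measure "pos_variation M \<mu>" by (rule finite_pos_variation[OF \<mu>])
  have "ennreal (\<mu> B) \<le> ennreal (measure (pos_variation M \<mu>) A)"
    using pos_var_upper[OF assms(3,4), of \<mu>] emeasure_pos_variation[OF \<mu> assms(2)] by (simp add: emeasure_eq_measure)
  then show ?thesis by (simp add: ennreal_le_iff)
qed

lemma pos_variation_least:
  assumes \<mu>: "finite_signed_measure M \<mu>" and "A \<in> sets M" and "\<And>B. B \<in> sets M \<Longrightarrow> B \<subseteq> A \<Longrightarrow> \<mu> B \<le> c"
  shows "measure (pos_variation M \<mu>) A \<le> c"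
proof -
  interpret finite_measure "pos_variation M \<mu>" by (rule finite_pos_variation[OF \<mu>])
  have c: "c \<ge> 0" using assms(3)[of "{}"] fsm_empty[OF \<mu>] by simp
  have "pos_var M \<mu> A \<le> ennreal c" unfolding pos_var_def by (rule SUP_least) (use assms(3) in \<open>auto intro: ennreal_leI\<close>)
  then have "ennreal (measure (pos_variation M \<mu>) A) \<le> ennreal c"
    using emeasure_pos_variation[OF \<mu> assms(2)] by (simp add: emeasure_eq_measure)
  then show ?thesis using c by (simp only: ennreal_le_iff)
qed

text \<open>Passing from \<open>B\<close> to \<open>A - B\<close> turns the supremum for
  \<open>\<mu>\<close> into the supremum for \<open>- \<mu>\<close>, shifted by
  \<open>\<mu> A\<close>; both inequalities are instances of this exchange.\<close>

lemma jordan_decomposition: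
  assumes \<mu>: "finite_signed_measure M \<mu>" and A: "A \<in> sets M"
  shows "\<mu> A = measure (pos_variation M \<mu>) A - measure (neg_variation M \<mu>) A"
proof (rule antisym)
  note \<mu>' = fsm_uminus[OF \<mu>]
  have "measure (neg_variation M \<mu>) A \<le> measure (pos_variation M \<mu>) A - \<mu> A"
    unfolding neg_variation_def
  proof (rule pos_variation_least[OF \<mu>' A])
    fix B assume B: "B \<in> sets M" "B \<subseteq> A"
    show "- \<mu> B \<le> measure (pos_variation M \<mu>) A - \<mu> A"
      using pos_variation_upper[OF \<mu> A, of "A - B"] fsm_diff[OF \<mu> A B] A B by simp
  qed
  then show "\<mu> A \<le> measure (pos_variation M \<mu>) A - measure (neg_variation M \<mu>) A" by simp
  have "measure (pos_variation M \<mu>) A \<le> measure (neg_variation M \<mu>) A + \<mu> A"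
  proof (rule pos_variation_least[OF \<mu> A])
    fix B assume B: "B \<in> sets M" "B \<subseteq> A"
    show "\<mu> B \<le> measure (neg_variation M \<mu>) A + \<mu> A"
      using pos_variation_upper[OF \<mu>' A, of "A - B"] fsm_diff[OF \<mu> A B] A B by (simp add: neg_variation_def)
  qed
  then show "measure (pos_variation M \<mu>) A - measure (neg_variation M \<mu>) A \<le> \<mu> A" by simp
qed

lemma variation_null:
  assumes \<mu>: "finite_signed_measure M \<mu>" and A: "A \<in> sets M" and "\<And>B. B \<in> sets M \<Longrightarrow> B \<subseteq> A \<Longrightarrow> \<mu> B = 0"
  shows "measure (pos_variation M \<mu>) A = 0" "measure (neg_variation M \<mu>) A = 0"
proof -
  have "measure (pos_variation M \<mu>) A \<le> 0" using pos_variation_least[OF \<mu> A, of 0] assms(3) by simp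
  then show "measure (pos_variation M \<mu>) A = 0" by (simp add: measure_le_0_iff)
  have "measure (neg_variation M \<mu>) A \<le> 0"
    unfolding neg_variation_def using pos_variation_least[OF fsm_uminus[OF \<mu>] A, of 0] assms(3) by simp
  then show "measure (neg_variation M \<mu>) A = 0" by (simp add: measure_le_0_iff)
qed

section \<open>Lebesgue measure as a signed measure\<close>

lemma sets_borel_of: "A \<in> sets (borel_of a b) \<longleftrightarrow> A \<in> sets borel \<and> A \<subseteq> {a<..<b}"
  unfolding borel_of_def by (subst sets_restrict_space_iff) auto

lemma space_borel_of [simp]: "space (borel_of a b) = {a<..<b}"
  by (simp add: borel_of_def space_restrict_space)

lemma lborel_restrict:
  "sets (restrict_space lborel {a<..<b}) = sets (borel_of a b)"
  "A \<in> sets (borel_of a b) \<Longrightarrow> emeasure (restrict_space lborel {a<..<b}) A = emeasure lborel A"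
  "finite_measure (restrict_space lborel {a<..<b::real})"
proof -
  show "sets (restrict_space lborel {a<..<b}) = sets (borel_of a b)"
    unfolding borel_of_def by (rule sets_restrict_space_cong) simp
  show "A \<in> sets (borel_of a b) \<Longrightarrow> emeasure (restrict_space lborel {a<..<b}) A = emeasure lborel A"
    by (intro emeasure_restrict_space) (auto simp: sets_borel_of)
  have "emeasure lborel {a<..<b} < \<infinity>" by (cases "a \<le> b") auto
  then show "finite_measure (restrict_space lborel {a<..<b})"
    by (intro finite_measureI) (simp add: emeasure_restrict_space space_restrict_space)
qed

text \<open>All sets concerned lie in a bounded interval, so \<open>measure lborel\<close> never
  takes its default value 0 for infinite measure and inherits countable additivity.\<close>

lemma fsm_lborel: "finite_signed_measure (borel_of a b) (measure lborel)"
  unfolding finite_signed_measure_def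
proof (intro conjI allI impI)
  fix A :: "nat \<Rightarrow> real set" assume A: "range A \<subseteq> sets (borel_of a b)" "disjoint_family A"
  let ?R = "restrict_space lborel {a<..<b}"
  interpret finite_measure ?R by (rule lborel_restrict(3))
  have m: "measure lborel B = measure ?R B" if "B \<in> sets (borel_of a b)" for B
    using lborel_restrict(2)[OF that] by (simp add: measure_def)
  have "(\<lambda>n. measure ?R (A n)) sums measure ?R (\<Union>n. A n)"
    by (rule finite_measure_UNION) (use A lborel_restrict(1) in auto)
  then show "(\<lambda>n. measure lborel (A n)) sums measure lborel (\<Union>n. A n)"
    using A(1) by (subst (asm) (1 2) m[symmetric]) auto
qed simp

lemma pos_variation_lborel: "pos_variation (borel_of a b) (measure lborel) = restrict_space lborel {a<..<b}"
proof (rule measure_eqI)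
  show "sets (pos_variation (borel_of a b) (measure lborel)) = sets (restrict_space lborel {a<..<b})"
    by (simp add: lborel_restrict)
  fix A assume "A \<in> sets (pos_variation (borel_of a b) (measure lborel))"
  then have A: "A \<in> sets (borel_of a b)" by simp
  interpret R: finite_measure "restrict_space lborel {a<..<b}" by (rule lborel_restrict(3))
  have e: "ennreal (measure lborel B) = emeasure lborel B" if "B \<in> sets (borel_of a b)" for B
    using lborel_restrict(2)[OF that] R.emeasure_finite[of B] by (simp add: measure_def less_top)
  have "pos_var (borel_of a b) (measure lborel) A = emeasure lborel A"
  proof (rule antisym)
    show "pos_var (borel_of a b) (measure lborel) A \<le> emeasure lborel A"
      unfolding pos_var_def by (rule SUP_least) (use A in \<open>auto simp: e sets_borel_of intro!: emeasure_mono\<close>)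
    show "emeasure lborel A \<le> pos_var (borel_of a b) (measure lborel) A"
      using pos_var_upper[OF A order.refl, of "measure lborel"] by (simp add: e A)
  qed
  then show "emeasure (pos_variation (borel_of a b) (measure lborel)) A = emeasure (restrict_space lborel {a<..<b}) A"
    using emeasure_pos_variation[OF fsm_lborel A] lborel_restrict(2)[OF A] by simp
qed

lemma neg_variation_lborel:
  assumes "A \<in> sets (borel_of a b)"
  shows "emeasure (neg_variation (borel_of a b) (measure lborel)) A = 0"
proof -
  have "pos_var (borel_of a b) (\<lambda>A. - measure lborel A) A \<le> 0"
    unfolding pos_var_def by (rule SUP_least) (simp add: ennreal_neg)
  then show ?thesis
    using emeasure_pos_variation[OF fsm_uminus[OF fsm_lborel] assms] by (simp add: neg_variation_def)
qed

text \<open>Integrability against a variation measure includes measurability on the interval, even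
  if that measure is zero; for functions cut off inside the interval this is plain Borel
  measurability.\<close>

lemma measurable_variation:
  assumes "a < c" "d < b"
  shows "(\<lambda>x. indicator {c..d} x *\<^sub>R g x) \<in> borel_measurable (borel_of a b) \<longleftrightarrow>
    (\<lambda>x. indicator {c..d} x *\<^sub>R (g x :: complex)) \<in> borel_measurable borel"
proof -
  have "(\<lambda>x. indicator {c..d} x *\<^sub>R g x) \<in> borel_measurable (borel_of a b) \<longleftrightarrow>
     (\<lambda>x. indicator {a<..<b} x *\<^sub>R (indicator {c..d} x *\<^sub>R g x)) \<in> borel_measurable borel"
    unfolding borel_of_def by (subst borel_measurable_restrict_space_iff) (auto simp: mult.commute)
  also have "(\<lambda>x. indicator {a<..<b} x *\<^sub>R (indicator {c..d} x *\<^sub>R g x)) = (\<lambda>x. indicator {c..d} x *\<^sub>R g x)"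
    using assms by (auto simp: indicator_def)
  finally show ?thesis .
qed

text \<open>The negative variation of Lebesgue measure is the zero measure, so the signed notions
  reduce to ordinary integrals. This is what unfolds the condition on the quasi-derivative.\<close>

lemma signed_lborel:
  assumes cd: "a < c" "d < b"
  shows "signed_set_integrable (borel_of a b) (measure lborel) {c..d} g \<longleftrightarrow> set_integrable lborel {c..d} g"
    and "signed_set_integral (borel_of a b) (measure lborel) {c..<d} g = set_lebesgue_integral lborel {c..<d} g"
proof -
  have p: "set_integrable (pos_variation (borel_of a b) (measure lborel)) {c..d} g \<longleftrightarrow> set_integrable lborel {c..d} g"
  proof -
    have "(\<lambda>x. indicator {a<..<b} x *\<^sub>R (indicator {c..d} x *\<^sub>R g x)) = (\<lambda>x. indicator {c..d} x *\<^sub>R g x)"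
      using cd by (auto simp: indicator_def)
    then show ?thesis unfolding pos_variation_lborel set_integrable_def
      by (subst integrable_restrict_space) auto
  qed
  have z: "AE x in neg_variation (borel_of a b) (measure lborel). f x = (0::complex)" for f
    by (rule AE_I'[OF null_setsI[OF neg_variation_lborel[OF sets.top]]]) (use sets.top[of "borel_of a b"] in auto)
  have n: "set_integrable (neg_variation (borel_of a b) (measure lborel)) {c..d} g" if "set_integrable lborel {c..d} g"
  proof -
    have "(\<lambda>x. indicator {c..d} x *\<^sub>R g x) \<in> borel_measurable lborel"
      using that unfolding set_integrable_def by (rule borel_measurable_integrable)
    then have "(\<lambda>x. indicator {c..d} x *\<^sub>R g x) \<in> borel_measurable (borel_of a b)"
      using measurable_variation[OF cd, of g] by simp
    then have "(\<lambda>x. indicator {c..d} x *\<^sub>R g x) \<in> borel_measurable (neg_variation (borel_of a b) (measure lborel))"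
      by (simp cong: measurable_cong_sets)
    then show ?thesis unfolding set_integrable_def
      by (rule integrable_cong_AE_imp[OF integrable_zero])
        (rule eventually_mono[OF z[of "\<lambda>x. indicator {c..d} x *\<^sub>R g x"]], simp)
  qed
  show "signed_set_integrable (borel_of a b) (measure lborel) {c..d} g \<longleftrightarrow> set_integrable lborel {c..d} g"
    unfolding signed_set_integrable_def p using n by blast
  have "set_lebesgue_integral (neg_variation (borel_of a b) (measure lborel)) {c..<d} g = 0"
    unfolding set_lebesgue_integral_def by (rule integral_eq_zero_AE[OF z])
  moreover have "set_lebesgue_integral (pos_variation (borel_of a b) (measure lborel)) {c..<d} g = set_lebesgue_integral lborel {c..<d} g"
  proof -
    have "(\<lambda>x. indicator {a<..<b} x *\<^sub>R (indicator {c..<d} x *\<^sub>R g x)) = (\<lambda>x. indicator {c..<d} x *\<^sub>R g x)"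
      using cd by (auto simp: indicator_def)
    then show ?thesis unfolding pos_variation_lborel set_lebesgue_integral_def
      by (subst integral_restrict_space) auto
  qed
  ultimately show "signed_set_integral (borel_of a b) (measure lborel) {c..<d} g = set_lebesgue_integral lborel {c..<d} g"
    by (simp add: signed_set_integral_def)
qed

section \<open>Distribution functions\<close>

text \<open>The open right end excludes an atom at \<open>x\<close>, which makes the function
  left-continuous in accordance with \<open>df([c,d)) = f(d) - f(c)\<close>; the intersection makes
  it constant beyond \<open>b\<close>.\<close>

definition dist_fun :: "real \<Rightarrow> real \<Rightarrow> real measure \<Rightarrow> real \<Rightarrow> real" where
  "dist_fun a b M x = measure M ({a<..<x} \<inter> {a<..<b})"

locale finite_on_interval = finite_measure M for M :: "real measure" +
  fixes a b :: real
  assumes sets_M: "sets M = sets (borel_of a b)" and ab: "a < b"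
begin

abbreviation "G \<equiv> dist_fun a b M"

lemma space_M: "space M = {a<..<b}"
  using sets_eq_imp_space_eq[OF sets_M] by simp

lemma in_sets_M: "A \<in> sets M \<longleftrightarrow> A \<in> sets borel \<and> A \<subseteq> {a<..<b}"
  by (simp add: sets_M sets_borel_of)

lemma G_mono: "x \<le> y \<Longrightarrow> G x \<le> G y"
  unfolding dist_fun_def by (rule finite_measure_mono) (auto simp: in_sets_M)

lemma G_borel: "G \<in> borel_measurable borel"
  by (rule borel_measurable_mono) (simp add: mono_def G_mono)

lemma G_bounds: "0 \<le> G x" "G x \<le> measure M (space M)"
  unfolding dist_fun_def by (auto simp: bounded_measure)

lemma G_diff:
  assumes "a \<le> x" "x \<le> y"
  shows "G y - G x = measure M ({x..<y} \<inter> {a<..<b})"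
proof -
  have "measure M ({a<..<y} \<inter> {a<..<b} - {a<..<x} \<inter> {a<..<b}) = G y - G x"
    unfolding dist_fun_def by (rule finite_measure_Diff) (use assms in \<open>auto simp: in_sets_M\<close>)
  moreover have "{a<..<y} \<inter> {a<..<b} - {a<..<x} \<inter> {a<..<b} = {x..<y} \<inter> {a<..<b}"
    using assms by auto
  ultimately show ?thesis by simp
qed

lemma G_left: "(G \<longlongrightarrow> G x) (at_left x)"
proof (rule tendsto_at_left_sequentially[of "x - 1"])
  fix S :: "nat \<Rightarrow> real" assume S: "\<And>n. S n < x" "incseq S" "S \<longlonglongrightarrow> x"
  have "(\<lambda>n. measure M ({a<..<S n} \<inter> {a<..<b})) \<longlonglongrightarrow> measure M (\<Union>n. {a<..<S n} \<inter> {a<..<b})"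
  proof (rule finite_Lim_measure_incseq)
    show "range (\<lambda>n. {a<..<S n} \<inter> {a<..<b}) \<subseteq> sets M" by (auto simp: in_sets_M)
    show "incseq (\<lambda>n. {a<..<S n} \<inter> {a<..<b})"
      using S(2) by (fastforce simp: incseq_def)
  qed
  also have "(\<Union>n. {a<..<S n} \<inter> {a<..<b}) = {a<..<x} \<inter> {a<..<b}"
  proof
    show "{a<..<x} \<inter> {a<..<b} \<subseteq> (\<Union>n. {a<..<S n} \<inter> {a<..<b})"
    proof
      fix y assume y: "y \<in> {a<..<x} \<inter> {a<..<b}"
      then have "\<forall>\<^sub>F n in sequentially. y < S n" using order_tendstoD(1)[OF S(3), of y] by simp
      then obtain n where "y < S n" by (auto simp: eventually_sequentially)
      then show "y \<in> (\<Union>n. {a<..<S n} \<inter> {a<..<b})" using y by auto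
    qed
  qed (auto intro: less_trans[OF _ S(1)])
  finally show "(\<lambda>n. G (S n)) \<longlonglongrightarrow> G x" by (simp add: dist_fun_def)
qed simp

lemma G_right_a: "(G \<longlongrightarrow> 0) (at_right a)"
proof (rule tendsto_at_right_sequentially[of a "a + 1"])
  fix S :: "nat \<Rightarrow> real" assume S: "\<And>n. a < S n" "decseq S" "S \<longlonglongrightarrow> a"
  have "(\<lambda>n. measure M ({a<..<S n} \<inter> {a<..<b})) \<longlonglongrightarrow> measure M (\<Inter>n. {a<..<S n} \<inter> {a<..<b})"
  proof (rule finite_Lim_measure_decseq)
    show "range (\<lambda>n. {a<..<S n} \<inter> {a<..<b}) \<subseteq> sets M" by (auto simp: in_sets_M)
    show "decseq (\<lambda>n. {a<..<S n} \<inter> {a<..<b})"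
      using S(2) by (fastforce simp: decseq_def)
  qed
  also have "(\<Inter>n. {a<..<S n} \<inter> {a<..<b}) = {}"
  proof -
    have False if y: "\<And>n. y \<in> {a<..<S n} \<inter> {a<..<b}" for y
    proof -
      have "a < y" using y[of 0] by simp
      then have "\<forall>\<^sub>F n in sequentially. S n < y" using order_tendstoD(2)[OF S(3), of y] by simp
      then obtain n where "S n < y" by (auto simp: eventually_sequentially)
      then show False using y[of n] by simp
    qed
    then show ?thesis by blast
  qed
  finally show "(\<lambda>n. G (S n)) \<longlonglongrightarrow> 0" by (simp add: dist_fun_def)
qed simp

lemma set_integrable_cont:
  fixes v :: "real \<Rightarrow> complex"
  assumes cd: "a < c" "d < b" and v: "continuous_on {c..d} v"
  shows "set_integrable M {c..d} v"
proof -
  have "bounded (v ` {c..d})" by (rule compact_imp_bounded) (auto intro!: compact_continuous_image v)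
  then obtain B where B: "\<And>x. x \<in> {c..d} \<Longrightarrow> cmod (v x) \<le> B" "B > 0" by (meson bounded_pos imageI)
  have "(\<lambda>x. indicator {c..d} x *\<^sub>R v x) \<in> borel_measurable borel"
    by (rule borel_measurable_continuous_on_indicator[OF _ v]) simp
  then have "(\<lambda>x. indicator {c..d} x *\<^sub>R v x) \<in> borel_measurable (borel_of a b)"
    using measurable_variation[OF cd, of v] by simp
  then have "(\<lambda>x. indicator {c..d} x *\<^sub>R v x) \<in> borel_measurable M"
    by (simp add: sets_M cong: measurable_cong_sets)
  then show ?thesis unfolding set_integrable_def
    by (rule integrable_const_bound[where B = B, rotated]) (use B in \<open>auto simp: indicator_def\<close>)
qed

lemma set_integrable_cont_sub:
  fixes v :: "real \<Rightarrow> complex"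
  assumes "a < c" "d < b" "continuous_on {c..d} v" "c \<le> x" "y \<le> d"
  shows "set_integrable M {x..<y} v"
proof -
  have "{x..<y} \<in> sets M" using assms by (auto simp: in_sets_M)
  then show ?thesis
    by (rule set_integrable_subset[OF set_integrable_cont[OF assms(1-3)]]) (use assms in auto)
qed

text \<open>On \<open>[x,y)\<close> the defect is the integral of \<open>v - v y\<close> against
  \<open>M\<close> plus that of \<open>(G - G x) w\<close>. Uniform continuity of \<open>v\<close>
  and of the integral of \<open>|w|\<close> bounds each by \<open>e * (G y - G x)\<close>, so
  \<open>2 * G\<close> serves as the control function, jumps included.\<close>

lemma by_parts:
  fixes v w :: "real \<Rightarrow> complex"
  assumes cd: "a < c" "c \<le> d" "d < b" and v: "ac_deriv c d v w"
  shows "set_lebesgue_integral M {c..<d} v = v d * of_real (G d) - v c * of_real (G c) - integral {c..d} (\<lambda>x. of_real (G x) * w x)"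
proof -
  define \<Phi> where "\<Phi> x = set_lebesgue_integral M {c..<x} v - v x * of_real (G x) + integral {c..x} (\<lambda>s. of_real (G s) * w s)" for x
  note vc = ac_continuous[OF v] and wi = ac_derivD(1)[OF v]
  have Gw: "(\<lambda>s. of_real (G s) * w s) absolutely_integrable_on {c..d}"
    by (rule bounded_borel_mult_abs_int[where B = "measure M (space M)"]) (use G_borel G_bounds wi in auto)
  have nwi: "(\<lambda>s. cmod (w s)) absolutely_integrable_on {c..d}"
    using absolutely_integrable_norm[OF wi] by (simp add: o_def)
  define J where "J x = integral {c..x} (\<lambda>s. cmod (w s))" for x
  have Jc: "continuous_on {c..d} J" unfolding J_def by (rule abs_int_indefinite_continuous[OF nwi])
  have "\<Phi> d = \<Phi> c"
  proof (rule const_if_small_increments[where K = "\<lambda>x. 2 * G x", OF cd(2)])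
    fix e :: real assume e: "e > 0"
    obtain d1 where d1: "d1 > 0" "\<And>x y. x \<in> {c..d} \<Longrightarrow> y \<in> {c..d} \<Longrightarrow> \<bar>y - x\<bar> \<le> d1 \<Longrightarrow> dist (v y) (v x) \<le> e"
      using uniform_modulus[OF vc e] by blast
    obtain d2 where d2: "d2 > 0" "\<And>x y. x \<in> {c..d} \<Longrightarrow> y \<in> {c..d} \<Longrightarrow> \<bar>y - x\<bar> \<le> d2 \<Longrightarrow> dist (J y) (J x) \<le> e"
      using uniform_modulus[OF Jc e] by blast
    have "norm (\<Phi> y - \<Phi> x) \<le> e * (2 * G y - 2 * G x)" if xy: "c \<le> x" "x \<le> y" "y \<le> d" "y - x \<le> min d1 d2" for x y
    proof -
      have sM: "{x..<y} \<in> sets M" using xy cd by (auto simp: in_sets_M)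
      have mxy: "measure M {x..<y} = G y - G x"
        using G_diff[of x y] xy cd by (simp add: Int_absorb2 subset_eq)
      have Gle: "0 \<le> G y - G x" using mxy measure_nonneg by metis
      note sv = set_integrable_cont_sub[OF cd(1,3) vc]
      have U: "set_lebesgue_integral M {c..<y} v = set_lebesgue_integral M {c..<x} v + set_lebesgue_integral M {x..<y} v"
      proof -
        have "{c..<x} \<union> {x..<y} = {c..<y}" using xy by auto
        then show ?thesis using set_integral_Un[of "{c..<x}" "{x..<y}" M v] sv[of c x] sv[of x y] xy by auto
      qed
      have ci: "set_integrable M {x..<y} (\<lambda>s. v y)"
        by (rule set_integrable_cont_sub[OF cd(1,3)]) (use xy in auto)
      have K: "set_lebesgue_integral M {x..<y} (\<lambda>s. v y) = v y * of_real (G y - G x)"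
        unfolding set_lebesgue_integral_def using sM 
        by (simp add: mxy[symmetric] scaleR_conv_of_real Int_absorb2 sets.sets_into_space mult.commute)
      have V1: "set_lebesgue_integral M {x..<y} v - v y * of_real (G y - G x) = set_lebesgue_integral M {x..<y} (\<lambda>s. v s - v y)"
        unfolding K[symmetric] by (rule set_integral_diff(2)[symmetric]) (use sv[of x y] ci xy in auto)
      have B1: "cmod (set_lebesgue_integral M {x..<y} (\<lambda>s. v s - v y)) \<le> e * (G y - G x)"
      proof -
        have di: "set_integrable M {x..<y} (\<lambda>s. v s - v y)"
          by (rule set_integral_diff(1)) (use sv[of x y] ci xy in auto)
        have "cmod (set_lebesgue_integral M {x..<y} (\<lambda>s. v s - v y)) \<le> (\<integral>s. cmod (indicator {x..<y} s *\<^sub>R (v s - v y)) \<partial>M)"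
          unfolding set_lebesgue_integral_def by (rule integral_norm_bound)
        also have "\<dots> \<le> (\<integral>s. indicator {x..<y} s * e \<partial>M)"
        proof (rule integral_mono)
          show "integrable M (\<lambda>s. cmod (indicator {x..<y} s *\<^sub>R (v s - v y)))"
            using di unfolding set_integrable_def by (rule integrable_norm)
          show "integrable M (\<lambda>s. indicator {x..<y} s * e)" using sM by (auto intro!: integrable_mult_left simp: emeasure_eq_measure)
          fix s
          show "cmod (indicator {x..<y} s *\<^sub>R (v s - v y)) \<le> indicator {x..<y} s * e"
            using d1(2)[of y s] xy by (auto simp: indicator_def dist_norm)
        qed
        also have "\<dots> = e * (G y - G x)"
          using sM by (simp add: mxy[symmetric] Int_absorb2 sets.sets_into_space)
        finally show ?thesis .
      qed
      have I1: "integral {c..y} (\<lambda>s. of_real (G s) * w s) - integral {c..x} (\<lambda>s. of_real (G s) * w s) = integral {x..y} (\<lambda>s. of_real (G s) * w s)"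
        by (rule abs_int_integral_diff[OF Gw xy(1-3)])
      note sub = abs_int_sub(2)[OF _ xy(1,3)]
      have I2: "integral {x..y} (\<lambda>s. of_real (G s) * w s) - (v y - v x) * of_real (G x) = integral {x..y} (\<lambda>s. of_real (G s - G x) * w s)"
      proof -
        have "(v y - v x) * of_real (G x) = integral {x..y} (\<lambda>s. of_real (G x) * w s)"
          using ac_diff[OF v xy(1-3)] by simp
        then have "integral {x..y} (\<lambda>s. of_real (G s) * w s) - (v y - v x) * of_real (G x)
           = integral {x..y} (\<lambda>s. of_real (G s) * w s - of_real (G x) * w s)"
          using integral_diff[OF sub[OF Gw] integrable_on_mult_right[OF sub[OF wi]], of "of_real (G x)"] by simp
        then show ?thesis by (simp add: algebra_simps)
      qed
      have B2: "cmod (integral {x..y} (\<lambda>s. of_real (G s - G x) * w s)) \<le> (G y - G x) * integral {x..y} (\<lambda>s. cmod (w s))"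
      proof -
        have "cmod (integral {x..y} (\<lambda>s. of_real (G s - G x) * w s)) \<le> integral {x..y} (\<lambda>s. (G y - G x) * cmod (w s))"
        proof (rule integral_norm_bound_integral)
          have "(\<lambda>s. of_real (G s) * w s - of_real (G x) * w s) integrable_on {x..y}"
            using sub[OF Gw] integrable_on_mult_right[OF sub[OF wi]] by (rule integrable_diff)
          then show "(\<lambda>s. of_real (G s - G x) * w s) integrable_on {x..y}" by (simp add: algebra_simps)
          show "(\<lambda>s. (G y - G x) * cmod (w s)) integrable_on {x..y}" using sub[OF nwi] by (rule integrable_on_mult_right)
          fix s assume "s \<in> {x..y}"
          then have "\<bar>G s - G x\<bar> \<le> G y - G x" using G_mono[of x s] G_mono[of s y] by auto
          then show "cmod (of_real (G s - G x) * w s) \<le> (G y - G x) * cmod (w s)"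
            unfolding norm_mult norm_of_real by (rule mult_right_mono) simp
        qed
        then show ?thesis by simp
      qed
      have "integral {x..y} (\<lambda>s. cmod (w s)) = J y - J x"
        unfolding J_def by (rule abs_int_integral_diff[OF nwi xy(1-3), symmetric])
      also have "\<dots> \<le> e" using d2(2)[of x y] xy by (auto simp: dist_real_def)
      finally have "(G y - G x) * integral {x..y} (\<lambda>s. cmod (w s)) \<le> (G y - G x) * e" using Gle by (rule mult_left_mono)
      then have B3: "cmod (integral {x..y} (\<lambda>s. of_real (G s - G x) * w s)) \<le> e * (G y - G x)"
        using B2 by (simp add: mult.commute)
      have "\<Phi> y - \<Phi> x = set_lebesgue_integral M {x..<y} (\<lambda>s. v s - v y) + integral {x..y} (\<lambda>s. of_real (G s - G x) * w s)"
        unfolding V1[symmetric] I2[symmetric] I1[symmetric] \<Phi>_def U by (simp add: algebra_simps)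
      then have "cmod (\<Phi> y - \<Phi> x) \<le> e * (G y - G x) + e * (G y - G x)"
        using norm_triangle_mono[OF B1 B3] by simp
      then show ?thesis by (simp add: algebra_simps)
    qed
    then show "\<exists>\<delta>>0. \<forall>x y. c \<le> x \<and> x \<le> y \<and> y \<le> d \<and> y - x \<le> \<delta> \<longrightarrow> norm (\<Phi> y - \<Phi> x) \<le> e * (2 * G y - 2 * G x)"
      using d1(1) d2(1) by (intro exI[of _ "min d1 d2"]) auto
  qed
  then show ?thesis by (simp add: \<Phi>_def set_lebesgue_integral_def algebra_simps)
qed

text \<open>The cells in question are those that stick out of \<open>U\<close>. A point of
  \<open>U\<close> lies in none of them once the mesh is smaller than the radius of a ball around it
  in \<open>U\<close>, so their indicators tend to 0 on \<open>U\<close>, and dominated convergence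
  applies since \<open>M\<close> has no mass outside.\<close>

lemma grid_cells_outside:
  assumes U: "open U" and null: "measure M ({a<..<b} - U) = 0" and e: "e > 0"
  defines "gr \<equiv> \<lambda>N i. a + real i * ((b - a) / real N)"
  shows "\<forall>\<^sub>F N in sequentially.
    (\<Sum>i\<in>{i. i < N \<and> \<not> {gr N i..<gr N (Suc i)} \<inter> {a<..<b} \<subseteq> U}. G (gr N (Suc i)) - G (gr N i)) < e"
proof -
  define cell where "cell N i = {gr N i..<gr N (Suc i)} \<inter> {a<..<b}" for N i
  define I where "I N = {i. i < N \<and> \<not> cell N i \<subseteq> U}" for N
  define R where "R N = (\<Union>i\<in>I N. cell N i)" for N
  have cM: "cell N i \<in> sets M" for N i by (auto simp: in_sets_M cell_def)
  have finI: "finite (I N)" for N by (simp add: I_def)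
  have RM: "R N \<in> sets M" for N unfolding R_def using finI cM by auto
  have UM: "U \<inter> {a<..<b} \<in> sets M" using U by (auto simp: in_sets_M)
  have step: "gr N (Suc i) - gr N i = (b - a) / real N" for N i by (simp add: gr_def algebra_simps add_divide_distrib diff_divide_distrib)
  have grm: "gr N i \<le> gr N j" if "i \<le> j" for N and i j :: nat
    using that ab unfolding gr_def by (intro add_left_mono mult_right_mono divide_nonneg_nonneg) auto
  have gra: "a \<le> gr N i" for N i using ab by (simp add: gr_def)
  have disj: "disjoint_family_on (cell N) (I N)" for N
    unfolding disjoint_family_on_def
  proof (intro ballI impI)
    fix i j :: nat assume "i \<noteq> j"
    then have "i < j \<or> j < i" by auto
    then show "cell N i \<inter> cell N j = {}"
      using grm[of "Suc i" j N] grm[of "Suc j" i N] by (auto simp: cell_def)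
  qed
  have sum: "(\<Sum>i\<in>I N. G (gr N (Suc i)) - G (gr N i)) = measure M (R N)" for N
  proof -
    have "measure M (R N) = (\<Sum>i\<in>I N. measure M (cell N i))"
      unfolding R_def by (rule finite_measure_finite_Union[OF finI _ disj]) (use cM in auto)
    also have "\<dots> = (\<Sum>i\<in>I N. G (gr N (Suc i)) - G (gr N i))"
      unfolding cell_def using G_diff[OF gra grm[of _ "Suc _"]] by (intro sum.cong) auto
    finally show ?thesis by simp
  qed
  have RU: "measure M (R N) = measure M (R N \<inter> U)" for N
  proof -
    have RN: "R N \<subseteq> {a<..<b}" by (auto simp: R_def cell_def)
    have d: "{a<..<b} - U \<in> sets M" using U by (auto simp: in_sets_M)
    have "measure M (R N) = measure M (R N \<inter> (U \<inter> {a<..<b})) + measure M (R N - U \<inter> {a<..<b})"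
      using finite_measure_Union[of "R N \<inter> (U \<inter> {a<..<b})" "R N - U \<inter> {a<..<b}"] RM UM by (auto simp: Int_Diff_Un)
    moreover have "measure M (R N - U \<inter> {a<..<b}) \<le> measure M ({a<..<b} - U)"
      by (rule finite_measure_mono[OF _ d]) (use RN in auto)
    moreover have "R N \<inter> (U \<inter> {a<..<b}) = R N \<inter> U" using RN by auto
    ultimately show ?thesis using null measure_nonneg[of M "R N - U \<inter> {a<..<b}"] by simp
  qed
  have "(\<lambda>N. \<integral>x. indicator (R N \<inter> U) x \<partial>M) \<longlonglongrightarrow> (\<integral>x. (0::real) \<partial>M)"
  proof (rule integral_dominated_convergence[where w = "\<lambda>x. 1"])
    have RUM: "R N \<inter> U \<in> sets M" for N
    proof -
      have "R N \<inter> U = R N \<inter> (U \<inter> {a<..<b})" by (auto simp: R_def cell_def)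
      then show ?thesis using RM UM by auto
    qed
    show "(\<lambda>x. indicator (R N \<inter> U) x :: real) \<in> borel_measurable M" for N using RUM by simp
    show "AE x in M. (\<lambda>N. indicator (R N \<inter> U) x :: real) \<longlonglongrightarrow> 0"
    proof (rule AE_I2)
      fix x
      show "(\<lambda>N. indicator (R N \<inter> U) x :: real) \<longlonglongrightarrow> 0"
      proof (cases "x \<in> U")
        case True
        then obtain r where r: "r > 0" "ball x r \<subseteq> U" using U by (auto simp: open_contains_ball)
        have "\<forall>\<^sub>F N in sequentially. (b - a) / real N < r"
          using order_tendstoD(2)[OF lim_const_over_n[of "b - a"] r(1)] .
        then have "\<forall>\<^sub>F N in sequentially. indicator (R N \<inter> U) x = (0 :: real)"
        proof eventually_elim
          case (elim N)
          have "x \<notin> R N"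
          proof
            assume "x \<in> R N"
            then obtain i where i: "i \<in> I N" "x \<in> cell N i" by (auto simp: R_def)
            have "cell N i \<subseteq> ball x r"
            proof
              fix y assume "y \<in> cell N i"
              then have "\<bar>x - y\<bar> < (b - a) / real N" using i(2) step[of N i] by (auto simp: cell_def abs_if)
              then show "y \<in> ball x r" using elim by (simp add: dist_real_def)
            qed
            then show False using r(2) i(1) by (auto simp: I_def)
          qed
          then show ?case by simp
        qed
        then show ?thesis by (rule tendsto_eventually)
      qed simp
    qed
  qed auto
  moreover have "(\<integral>x. indicator (R N \<inter> U) x \<partial>M) = measure M (R N)" for N
  proof -
    have "R N \<inter> U \<subseteq> space M" by (auto simp: R_def cell_def space_M)
    then show ?thesis using RU[of N] by (simp add: Int_absorb2)
  qed
  ultimately have "(\<lambda>N. measure M (R N)) \<longlonglongrightarrow> 0" by simp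
  then have "\<forall>\<^sub>F N in sequentially. measure M (R N) < e" using e by (rule order_tendstoD(2))
  then show ?thesis unfolding sum[symmetric] I_def cell_def .
qed

end

lemma bounded_variation_dominated:
  assumes "\<And>x y. c \<le> x \<Longrightarrow> x \<le> y \<Longrightarrow> y \<le> d \<Longrightarrow> cmod (f y - f x) \<le> m y - m x"
  shows "bounded_variation_on f c d"
  unfolding bounded_variation_on_def
proof (intro exI allI impI)
  fix n and x :: "nat \<Rightarrow> real"
  assume x: "\<forall>i\<le>n. x i \<in> {c..d}" "\<forall>i<n. x i \<le> x (Suc i)"
  have "(\<Sum>i<n. cmod (f (x (Suc i)) - f (x i))) \<le> (\<Sum>i<n. m (x (Suc i)) - m (x i))"
    by (rule sum_mono) (use x assms in auto)
  also have "\<dots> = m (x n) - m (x 0)" by (rule sum_lessThan_telescope)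
  also have "\<dots> \<le> m d - m c"
  proof -
    have "x n \<in> {c..d}" "x 0 \<in> {c..d}" using x(1) by auto
    then have "cmod (f d - f (x n)) \<le> m d - m (x n)" "cmod (f (x 0) - f c) \<le> m (x 0) - m c"
      by (auto intro!: assms)
    then show ?thesis using norm_ge_zero[of "f d - f (x n)"] norm_ge_zero[of "f (x 0) - f c"] by linarith
  qed
  finally show "(\<Sum>i<n. cmod (f (x (Suc i)) - f (x i))) \<le> m d - m c" .
qed

lemma bounded_variation_bounded:
  assumes "bounded_variation_on f c d"
  obtains B where "\<And>x. x \<in> {c..d} \<Longrightarrow> cmod (f x) \<le> B"
proof -
  obtain V where V: "\<And>n (x :: nat \<Rightarrow> real). (\<forall>i\<le>n. x i \<in> {c..d}) \<Longrightarrow> (\<forall>i<n. x i \<le> x (Suc i)) \<Longrightarrow>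
        (\<Sum>i<n. cmod (f (x (Suc i)) - f (x i))) \<le> V"
    using assms unfolding bounded_variation_on_def by blast
  have "cmod (f y) \<le> cmod (f c) + V" if y: "y \<in> {c..d}" for y
  proof -
    have "cmod (f y - f c) \<le> V" using V[of 1 "\<lambda>i. if i = 0 then c else y"] y by auto
    then show ?thesis using norm_triangle_sub[of "f y" "f c"] by simp
  qed
  then show ?thesis using that by blast
qed

section \<open>The Dirichlet operator of the measure\<close>

text \<open>\<open>ac_deriv\<close> provides densities that are only Lebesgue measurable, whereas
  \<open>loc_abs_cont\<close> asks for Borel measurability.\<close>

lemma ex_borel_AE_eq:
  fixes w :: "real \<Rightarrow> complex"
  assumes "w absolutely_integrable_on {a..b}"
  obtains w' where "w' \<in> borel_measurable borel" "AE x in lebesgue. x \<in> {a..b} \<longrightarrow> w x = w' x"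
proof -
  define f where "f x = indicator {a..b} x *\<^sub>R w x" for x
  have f: "f \<in> borel_measurable (completion lborel)"
    using assms unfolding set_integrable_def f_def by (rule borel_measurable_integrable)
  have m: "(\<lambda>x. Re (f x)) \<in> borel_measurable (completion lborel)" "(\<lambda>x. Im (f x)) \<in> borel_measurable (completion lborel)"
    using f by measurable
  then obtain g h where g: "g \<in> borel_measurable lborel" "AE x in lborel. Re (f x) = g x"
    and h: "h \<in> borel_measurable lborel" "AE x in lborel. Im (f x) = h x"
    using completion_ex_borel_measurable_real[OF m(1)] completion_ex_borel_measurable_real[OF m(2)] by blast
  define w' where "w' x = complex_of_real (g x) + \<i> * complex_of_real (h x)" for x
  have "w' \<in> borel_measurable borel" using g(1) h(1) unfolding w'_def by measurable
  moreover have "AE x in lborel. f x = w' x"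
    using g(2) h(2) by eventually_elim (simp add: w'_def complex_eq_iff)
  then have "AE x in lebesgue. f x = w' x" by (rule AE_completion)
  then have "AE x in lebesgue. x \<in> {a..b} \<longrightarrow> w x = w' x" by (rule eventually_mono) (auto simp: f_def)
  ultimately show ?thesis using that by blast
qed

lemma set_integrable_lborel_borel:
  fixes w :: "real \<Rightarrow> complex"
  assumes "w \<in> borel_measurable borel" "w absolutely_integrable_on {c..d}"
  shows "set_integrable lborel {c..d} w"
proof -
  have "(\<lambda>x. indicator {c..d} x *\<^sub>R w x) \<in> borel_measurable lborel" using assms(1) by measurable
  then show ?thesis using assms(2) unfolding set_integrable_def by (simp add: integrable_completion)
qed

lemma set_integral_lborel_Ico:
  fixes w :: "real \<Rightarrow> complex"
  assumes "set_integrable lborel {c..d} w"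
  shows "set_lebesgue_integral lborel {c..<d} w = integral {c..d} w" "w absolutely_integrable_on {c..d}"
proof -
  have i: "set_integrable lborel {c..<d} w" by (rule set_integrable_subset[OF assms]) auto
  then have m: "(\<lambda>x. indicator {c..<d} x *\<^sub>R w x) \<in> borel_measurable lborel"
    unfolding set_integrable_def by (rule borel_measurable_integrable)
  have "set_lebesgue_integral lborel {c..<d} w = integral {c..<d} w"
    by (rule set_borel_integral_eq_integral(2)[OF i])
  also have "\<dots> = integral {c..d} w"
    by (rule integral_spike_set) (auto intro: negligible_subset[of "{d}"])
  finally show "set_lebesgue_integral lborel {c..<d} w = integral {c..d} w" .
  show "w absolutely_integrable_on {c..d}" using assms unfolding set_integrable_def
    by (simp add: integrable_completion borel_measurable_integrable)
qed

locale dirichlet_data =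
  fixes a b :: real and \<nu> :: "real set \<Rightarrow> real" and q :: "real \<Rightarrow> real"
  assumes a_less_b: "a < b"
    and nu: "finite_signed_measure (borel_of a b) \<nu>"
    and sing: "lebesgue_singular a b \<nu>"
    and q_leb: "integrable (leb_on a b) q"
begin

definition P :: "real set \<Rightarrow> real" where "P A = measure lborel A + \<nu> A"

lemma fsm_P: "finite_signed_measure (borel_of a b) P"
  unfolding P_def by (rule fsm_plus[OF fsm_lborel nu])

lemma finite_on_interval_variation:
  assumes "finite_signed_measure (borel_of a b) \<mu>"
  shows "finite_on_interval (pos_variation (borel_of a b) \<mu>) a b" "finite_on_interval (neg_variation (borel_of a b) \<mu>) a b"
  using finite_pos_variation[OF assms] finite_neg_variation[OF assms] a_less_b
  by (auto simp: finite_on_interval_def finite_on_interval_axioms_def)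

sublocale Pp: finite_on_interval "pos_variation (borel_of a b) P" a b
  by (rule finite_on_interval_variation[OF fsm_P])
sublocale Pn: finite_on_interval "neg_variation (borel_of a b) P" a b
  by (rule finite_on_interval_variation[OF fsm_P])
sublocale Np: finite_on_interval "pos_variation (borel_of a b) \<nu>" a b
  by (rule finite_on_interval_variation[OF nu])
sublocale Nn: finite_on_interval "neg_variation (borel_of a b) \<nu>" a b
  by (rule finite_on_interval_variation[OF nu])

definition F :: "real \<Rightarrow> real" where "F x = Pp.G x - Pn.G x"
text \<open>The total variation of \<open>\<nu>\<close> on \<open>(a,x)\<close>, built from the
  Jordan parts of \<open>\<nu>\<close>, while \<open>F\<close> is built from those of
  \<open>P\<close>.\<close>

definition V :: "real \<Rightarrow> real" where "V x = Np.G x + Nn.G x"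
definition C :: real where
  "C = measure (pos_variation (borel_of a b) P) {a<..<b} + measure (neg_variation (borel_of a b) P) {a<..<b}"

lemma F_borel: "F \<in> borel_measurable borel"
  unfolding F_def using Pp.G_borel Pn.G_borel by measurable

lemma F_abs_le: "\<bar>F x\<bar> \<le> C"
  using Pp.G_bounds[of x] Pn.G_bounds[of x] by (simp add: F_def C_def)

lemma F_left: "(F \<longlongrightarrow> F x) (at_left x)"
  unfolding F_def by (intro tendsto_diff Pp.G_left Pn.G_left)

lemma F_right_a: "(F \<longlongrightarrow> 0) (at_right a)"
  using tendsto_diff[OF Pp.G_right_a Pn.G_right_a] by (simp add: F_def[abs_def])

text \<open>The Lebesgue part of \<open>P\<close> contributes exactly \<open>y - x\<close>, so the
  left side is the modulus of \<open>\<nu>\<close> on \<open>[x,y)\<close> inside the interval, and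
  the right side is the total variation of the same set.\<close>

lemma increments:
  assumes "a \<le> x" "x \<le> y" "y \<le> b"
  shows "\<bar>F y - F x - (y - x)\<bar> \<le> V y - V x"
proof -
  let ?A = "{x..<y} \<inter> {a<..<b}"
  have A: "?A \<in> sets (borel_of a b)" by (auto simp: sets_borel_of)
  have "measure lborel ?A = y - x"
  proof (cases "x = a")
    case True
    then have "?A = {a<..<y}" using assms by auto
    then show ?thesis using assms True by simp
  next
    case False
    then have "?A = {x..<y}" using assms by auto
    then show ?thesis using assms by simp
  qed
  then have 1: "F y - F x - (y - x) = \<nu> ?A"
    using jordan_decomposition[OF fsm_P A] Pp.G_diff[OF assms(1,2)] Pn.G_diff[OF assms(1,2)]
    by (simp add: F_def P_def)
  have 2: "V y - V x = measure (pos_variation (borel_of a b) \<nu>) ?A + measure (neg_variation (borel_of a b) \<nu>) ?A"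
    using Np.G_diff[OF assms(1,2)] Nn.G_diff[OF assms(1,2)] by (simp add: V_def)
  show ?thesis unfolding 1 2 jordan_decomposition[OF nu A] by (simp add: abs_le_iff)
qed

text \<open>The null set carrying \<open>\<nu>\<close> is covered by an open \<open>U\<close> of
  Lebesgue measure below \<open>\<epsilon>\<close>. The cells that stay inside \<open>U\<close> form
  \<open>T\<close>, and their disjointness bounds their total length; the others have little
  variation once the grid is fine.\<close>

lemma grid:
  assumes e: "\<epsilon> > 0"
  shows "\<exists>N>0. \<exists>T \<subseteq> {..<N}. real (card T) * ((b - a) / real N) \<le> \<epsilon> \<and>
       (\<Sum>i\<in>{..<N} - T. V (a + real (Suc i) * ((b - a) / real N)) - V (a + real i * ((b - a) / real N))) \<le> \<epsilon>"
proof -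
  obtain S where S: "S \<in> sets (borel_of a b)" "S \<in> null_sets lborel"
    "\<And>B. B \<in> sets (borel_of a b) \<Longrightarrow> B \<inter> S = {} \<Longrightarrow> \<nu> B = 0"
    using sing unfolding lebesgue_singular_def by blast
  have "S \<in> sets borel" using S(1) by (simp add: sets_borel_of)
  then obtain U where U: "open U" "S \<subseteq> U" "emeasure lborel (U - S) < ennreal \<epsilon>"
    using outer_regular_lborel[OF _ e] by metis
  have Ue: "emeasure lborel U < ennreal \<epsilon>"
  proof -
    have "emeasure lborel (U - S) = emeasure lborel U"
      by (rule emeasure_Diff_null_set) (use S(2) U(1) in auto)
    then show ?thesis using U(3) by simp
  qed
  have IU: "{a<..<b} - U \<in> sets (borel_of a b)" using U(1) by (auto simp: sets_borel_of)
  have null: "measure (pos_variation (borel_of a b) \<nu>) ({a<..<b} - U) = 0"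
    "measure (neg_variation (borel_of a b) \<nu>) ({a<..<b} - U) = 0"
    by (rule variation_null[OF nu IU]; use S(3) U(2) in blast)+
  \<comment> \<open>One half for each of the two variations of \<open>\<nu>\<close>.\<close>
  have e2: "\<epsilon> / 2 > 0" using e by simp
  define gr where "gr N i = a + real i * ((b - a) / real N)" for N i
  define I where "I N = {i. i < N \<and> \<not> {gr N i..<gr N (Suc i)} \<inter> {a<..<b} \<subseteq> U}" for N
  have "\<forall>\<^sub>F N in sequentially. N > 0 \<and> (\<Sum>i\<in>I N. Np.G (gr N (Suc i)) - Np.G (gr N i)) < \<epsilon> / 2 \<and>
      (\<Sum>i\<in>I N. Nn.G (gr N (Suc i)) - Nn.G (gr N i)) < \<epsilon> / 2"
    using Np.grid_cells_outside[OF U(1) null(1) e2] Nn.grid_cells_outside[OF U(1) null(2) e2] eventually_gt_at_top[of 0]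
    unfolding I_def gr_def by eventually_elim auto
  then obtain N where N: "N > 0" "(\<Sum>i\<in>I N. Np.G (gr N (Suc i)) - Np.G (gr N i)) < \<epsilon> / 2"
      "(\<Sum>i\<in>I N. Nn.G (gr N (Suc i)) - Nn.G (gr N i)) < \<epsilon> / 2"
    using eventually_happens[of _ sequentially] by auto
  define T where "T = {..<N} - I N"
  have TI: "{..<N} - T = I N" by (auto simp: T_def I_def)
  have l: "(b - a) / real N > 0" using a_less_b N by simp
  have step: "gr N (Suc i) - gr N i = (b - a) / real N" for i by (simp add: gr_def algebra_simps add_divide_distrib diff_divide_distrib)
  have grm: "gr N i \<le> gr N j" if "i \<le> j" for i j :: nat
    using that l unfolding gr_def by (intro add_left_mono mult_right_mono) auto
  have gra: "a \<le> gr N i" for i using grm[of 0 i] by (simp add: gr_def)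
  have grb: "gr N i \<le> b" if "i \<le> N" for i
  proof -
    have "gr N N = b" using N(1) by (simp add: gr_def)
    then show ?thesis using grm[OF that] by simp
  qed
  define c where "c i = {gr N i<..<gr N (Suc i)}" for i
  have cm: "measure lborel (c i) = (b - a) / real N" for i
    unfolding c_def using grm[of i "Suc i"] step[of i] by simp
  have "real (card T) * ((b - a) / real N) = (\<Sum>i\<in>T. measure lborel (c i))" by (simp add: cm)
  also have "\<dots> = measure lborel (\<Union>i\<in>T. c i)"
  proof (rule measure_finite_Union[symmetric])
    show "finite T" by (simp add: T_def)
    show "c ` T \<subseteq> sets lborel" by (auto simp: c_def)
    show "disjoint_family_on c T"
      unfolding disjoint_family_on_def
    proof (intro ballI impI)
      fix i j :: nat assume "i \<noteq> j"
      then have "i < j \<or> j < i" by auto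
      then show "c i \<inter> c j = {}"
        using grm[of "Suc i" j] grm[of "Suc j" i] by (auto simp: c_def)
    qed
    show "emeasure lborel (c i) \<noteq> \<infinity>" for i unfolding c_def using grm[of i "Suc i"] by simp
  qed
  also have "\<dots> \<le> measure lborel U"
  proof (rule measure_mono_fmeasurable)
    show "(\<Union>i\<in>T. c i) \<subseteq> U"
    proof
      fix x assume "x \<in> (\<Union>i\<in>T. c i)"
      then obtain i where i: "i \<in> T" "x \<in> c i" by auto
      then have "i < N" by (auto simp: T_def)
      then have "x \<in> {gr N i..<gr N (Suc i)} \<inter> {a<..<b}"
        using i(2) gra[of i] grb[of "Suc i"] by (auto simp: c_def)
      then show "x \<in> U" using i(1) by (auto simp: T_def I_def)
    qed
    show "(\<Union>i\<in>T. c i) \<in> sets lborel" by (auto simp: c_def)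
    show "U \<in> fmeasurable lborel" using Ue U(1) by (auto simp: fmeasurable_def intro: less_trans[OF _ ennreal_less_top])
  qed
  also have "\<dots> \<le> \<epsilon>"
  proof -
    have "emeasure lborel U < top" using Ue ennreal_less_top by (rule less_trans)
    then have "ennreal (measure lborel U) = emeasure lborel U" by (simp add: measure_def)
    then have "ennreal (measure lborel U) \<le> ennreal \<epsilon>" using Ue by simp
    then show ?thesis using e by (simp only: ennreal_le_iff)
  qed
  finally have 1: "real (card T) * ((b - a) / real N) \<le> \<epsilon>" .
  have "(\<Sum>i\<in>I N. V (gr N (Suc i)) - V (gr N i)) = (\<Sum>i\<in>I N. Np.G (gr N (Suc i)) - Np.G (gr N i)) + (\<Sum>i\<in>I N. Nn.G (gr N (Suc i)) - Nn.G (gr N i))"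
    unfolding sum.distrib[symmetric] by (rule sum.cong) (auto simp: V_def)
  then have 2: "(\<Sum>i\<in>{..<N} - T. V (gr N (Suc i)) - V (gr N i)) \<le> \<epsilon>" unfolding TI using N by simp
  show ?thesis using N(1) 1 2 unfolding gr_def by (intro exI[of _ N] conjI exI[of _ T]) (auto simp: T_def)
qed

sublocale sl_singular a b F q C V
  by unfold_locales (use a_less_b F_borel F_abs_le increments grid q_leb in \<open>auto simp: abs_int_leb_on_iff\<close>)

section \<open>Identification of the regularized operator with the original one\<close>

lemma signed_by_parts:
  fixes v w :: "real \<Rightarrow> complex"
  assumes cd: "a < c" "c \<le> d" "d < b" and v: "ac_deriv c d v w"
  shows "signed_set_integrable (borel_of a b) P {c..d} v"
    and "signed_set_integral (borel_of a b) P {c..<d} v = v d * of_real (F d) - v c * of_real (F c) - integral {c..d} (\<lambda>x. of_real (F x) * w x)"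
proof -
  note vc = ac_continuous[OF v] and wi = ac_derivD(1)[OF v]
  show "signed_set_integrable (borel_of a b) P {c..d} v"
    unfolding signed_set_integrable_def
    using Pp.set_integrable_cont[OF cd(1,3) vc] Pn.set_integrable_cont[OF cd(1,3) vc] by simp
  have p: "(\<lambda>s. of_real (Pp.G s) * w s) absolutely_integrable_on {c..d}"
    by (rule bounded_borel_mult_abs_int[where B = "measure (pos_variation (borel_of a b) P) {a<..<b}"])
      (use Pp.G_borel Pp.G_bounds wi in auto)
  have n: "(\<lambda>s. of_real (Pn.G s) * w s) absolutely_integrable_on {c..d}"
    by (rule bounded_borel_mult_abs_int[where B = "measure (neg_variation (borel_of a b) P) {a<..<b}"])
      (use Pn.G_borel Pn.G_bounds wi in auto)
  have "integral {c..d} (\<lambda>x. of_real (F x) * w x) = integral {c..d} (\<lambda>x. of_real (Pp.G x) * w x - of_real (Pn.G x) * w x)"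
    by (simp add: F_def algebra_simps)
  also have "\<dots> = integral {c..d} (\<lambda>x. of_real (Pp.G x) * w x) - integral {c..d} (\<lambda>x. of_real (Pn.G x) * w x)"
    by (rule integral_diff) (use p n in \<open>auto intro: set_lebesgue_integral_eq_integral(1)\<close>)
  finally show "signed_set_integral (borel_of a b) P {c..<d} v = v d * of_real (F d) - v c * of_real (F c) - integral {c..d} (\<lambda>x. of_real (F x) * w x)"
    unfolding signed_set_integral_def Pp.by_parts[OF cd v] Pn.by_parts[OF cd v]
    by (simp add: F_def algebra_simps)
qed

lemma loc_abs_cont_lborelD:
  assumes "a < c" "c \<le> d" "d < b"
    and "loc_abs_cont a b (measure lborel) v w"
  shows "ac_deriv c d v w"
  unfolding ac_deriv_def
proof (intro conjI ballI)
  have i: "set_integrable lborel {x..y} w \<and> v y - v x = integral {x..y} w" if "a < x" "x \<le> y" "y < b" for x y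
  proof -
    have "signed_set_integrable (borel_of a b) (measure lborel) {x..y} w"
      "v y - v x = signed_set_integral (borel_of a b) (measure lborel) {x..<y} w"
      using assms(4) that unfolding loc_abs_cont_def by blast+
    then have 1: "set_integrable lborel {x..y} w" "v y - v x = set_lebesgue_integral lborel {x..<y} w"
      using signed_lborel[OF that(1,3)] by simp_all
    then show ?thesis using set_integral_lborel_Ico[OF 1(1)] by simp
  qed
  show "w absolutely_integrable_on {c..d}" using set_integral_lborel_Ico(2) i[OF assms(1-3)] by blast
  fix x assume "x \<in> {c..d}"
  then have "v x - v c = integral {c..x} w" using i[of c x] assms by auto
  then show "v x = v c + integral {c..x} w" by (simp add: algebra_simps)
qed

lemma cont_ends:
  fixes v :: "real \<Rightarrow> complex"
  assumes "continuous_on {a..b} v"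
  shows "(v \<longlongrightarrow> v a) (at_right a)" "(v \<longlongrightarrow> v b) (at_left b)"
  using continuous_on_Icc_at_rightD[OF assms a_less_b] continuous_on_Icc_at_leftD[OF assms a_less_b] by auto

lemma F_mult_limits:
  assumes "continuous_on {a..b} v"
  shows "((\<lambda>x. of_real (F x) * v x) \<longlongrightarrow> (0::complex)) (at_right a)"
    "((\<lambda>x. of_real (F x) * v x) \<longlongrightarrow> of_real (F b) * v b) (at_left b)"
proof -
  note ar = cont_ends(1)[OF assms] and bl = cont_ends(2)[OF assms]
  show "((\<lambda>x. of_real (F x) * v x) \<longlongrightarrow> (0::complex)) (at_right a)"
    using tendsto_mult[OF tendsto_of_real[OF F_right_a] ar] by simp
  show "((\<lambda>x. of_real (F x) * v x) \<longlongrightarrow> of_real (F b) * v b) (at_left b)"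
    by (intro tendsto_mult tendsto_of_real F_left bl)
qed

text \<open>Integration by parts shows that \<open>\<omega> + F v\<close> has the measure
  \<open>v dP\<close>; its left-continuity comes from \<open>F\<close>, and the boundary limits from
  those of \<open>F\<close> at both ends.\<close>

lemma dirichlet_operator_subset: "dirichlet \<subseteq> dirichlet_operator a b P q"
proof safe
  fix f g assume fg: "(f, g) \<in> dirichlet"
  obtain w0 o1 v where f2: "f \<in> L2 (leb_on a b)" "g \<in> L2 (leb_on a b)"
    and 1: "ac_deriv a b o1 (\<lambda>s. - of_real (F s) * w0 s)" "ac_deriv a b v w0"
        "o1 a = 0" "o1 b + of_real (F b) * v b = 0"
    and 2: "AE x in leb_on a b. f x = o1 x + of_real (F x) * v x"
        "AE x in leb_on a b. g x = - w0 x + of_real (q x) * (o1 x + of_real (F x) * v x)"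
    using fg by (auto simp: dirichlet_def)
  obtain w where w: "w \<in> borel_measurable borel" "AE x in lebesgue. x \<in> {a..b} \<longrightarrow> w0 x = w x"
    using ex_borel_AE_eq[OF ac_derivD(1)[OF 1(2)]] by blast
  have v: "ac_deriv a b v w" by (rule ac_deriv_AE_cong[OF 1(2) w(2)])
  have o1: "ac_deriv a b o1 (\<lambda>s. - of_real (F s) * w s)"
    by (rule ac_deriv_AE_cong[OF 1(1)], rule eventually_mono[OF w(2)]) simp
  note vc = ac_continuous[OF v] and oc = ac_continuous[OF o1]
  define u where "u x = o1 x + of_real (F x) * v x" for x
  have wn: "(\<lambda>s. cmod (w s)) absolutely_integrable_on {a..b}" "(\<lambda>s. cmod (- of_real (F s) * w s)) absolutely_integrable_on {a..b}"
    using absolutely_integrable_norm[OF ac_derivD(1)[OF v]] absolutely_integrable_norm[OF ac_derivD(1)[OF o1]] by (auto simp: o_def)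
  define J where "J x = integral {a..x} (\<lambda>s. cmod (w s))" for x
  define Jo where "Jo x = integral {a..x} (\<lambda>s. cmod (- of_real (F s) * w s))" for x
  have vJ: "cmod (v y - v x) \<le> J y - J x" if "a \<le> x" "x \<le> y" "y \<le> b" for x y
    unfolding ac_diff[OF v that] J_def abs_int_integral_diff[OF wn(1) that]
    by (rule integral_norm_bound_integral) (use abs_int_sub(2)[OF ac_derivD(1)[OF v] that(1,3)] abs_int_sub(2)[OF wn(1) that(1,3)] in auto)
  have oJ: "cmod (o1 y - o1 x) \<le> Jo y - Jo x" if "a \<le> x" "x \<le> y" "y \<le> b" for x y
    unfolding ac_diff[OF o1 that] Jo_def abs_int_integral_diff[OF wn(2) that]
    by (rule integral_norm_bound_integral) (use abs_int_sub(2)[OF ac_derivD(1)[OF o1] that(1,3)] abs_int_sub(2)[OF wn(2) that(1,3)] in auto)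
  obtain B where B: "\<And>x. x \<in> {a..b} \<Longrightarrow> cmod (v x) \<le> B" "B > 0"
    using compact_imp_bounded[OF compact_continuous_image[OF vc compact_Icc]] by (meson bounded_pos imageI)
  \<comment> \<open>A monotone bound for the increments of \<open>u\<close>: \<open>Jo\<close> and
    \<open>J\<close> bound those of \<open>\<omega>\<close> and \<open>v\<close>, the two variations
    of \<open>P\<close> those of \<open>F\<close>, with \<open>C\<close> bounding \<open>F\<close>
    and \<open>B\<close> bounding \<open>v\<close>.\<close>
  define m where "m x = Jo x + C * J x + B * (Pp.G x + Pn.G x)" for x
  have um: "cmod (u y - u x) \<le> m y - m x" if xy: "a \<le> x" "x \<le> y" "y \<le> b" for x y
  proof -
    have "u y - u x = (o1 y - o1 x) + (of_real (F y) * (v y - v x) + v x * of_real (F y - F x))"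
      by (simp add: u_def algebra_simps)
    then have "cmod (u y - u x) \<le> cmod (o1 y - o1 x) + (cmod (of_real (F y) * (v y - v x)) + cmod (v x * of_real (F y - F x)))"
      by (metis norm_triangle_ineq norm_triangle_mono order_refl)
    also have "\<dots> = cmod (o1 y - o1 x) + (\<bar>F y\<bar> * cmod (v y - v x) + cmod (v x) * \<bar>F y - F x\<bar>)"
      by (simp only: norm_mult norm_of_real)
    also have "\<dots> \<le> (Jo y - Jo x) + (C * (J y - J x) + B * ((Pp.G y - Pp.G x) + (Pn.G y - Pn.G x)))"
    proof (intro add_mono mult_mono)
      show "\<bar>F y - F x\<bar> \<le> (Pp.G y - Pp.G x) + (Pn.G y - Pn.G x)"
        using Pp.G_mono[OF xy(2)] Pn.G_mono[OF xy(2)] unfolding F_def by linarith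
      show "cmod (v x) \<le> B" using B(1) xy by auto
      show "0 \<le> C" using M_nonneg .
    qed (use oJ vJ xy F_abs_le B in auto)
    finally show ?thesis by (simp add: m_def algebra_simps)
  qed
  have U: "loc_abs_cont a b P u v"
    unfolding loc_abs_cont_def
  proof (intro conjI ballI allI impI)
    fix x assume x: "x \<in> {a<..<b}"
    have "(o1 \<longlongrightarrow> o1 x) (at_left x)" "(v \<longlongrightarrow> v x) (at_left x)"
      using continuous_on_interior[OF oc, of x] continuous_on_interior[OF vc, of x] x
      by (auto simp: isCont_def intro: filterlim_mono[OF _ order_refl at_le])
    then have "(u \<longlongrightarrow> u x) (at_left x)"
      unfolding u_def by (intro tendsto_intros F_left)
    then show "continuous (at_left x) u" by (simp add: continuous_within)
  next
    fix c d assume "a < c \<and> c \<le> d \<and> d < b"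
    then have cd: "a < c" "c \<le> d" "d < b" by auto
    have vcd: "ac_deriv c d v w" by (rule ac_sub[OF v]) (use cd in auto)
    show "bounded_variation_on u c d" by (rule bounded_variation_dominated[where m = m]) (use um cd in auto)
    show "signed_set_integrable (borel_of a b) P {c..d} v" by (rule signed_by_parts(1)[OF cd vcd])
    have "o1 d - o1 c = integral {c..d} (\<lambda>s. - of_real (F s) * w s)" by (rule ac_diff[OF o1]) (use cd in auto)
    also have "\<dots> = - integral {c..d} (\<lambda>s. of_real (F s) * w s)" by simp
    finally show "u d - u c = signed_set_integral (borel_of a b) P {c..<d} v"
      unfolding signed_by_parts(2)[OF cd vcd] by (simp add: u_def algebra_simps)
  qed
  have W: "loc_abs_cont a b (measure lborel) v w"
    unfolding loc_abs_cont_def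
  proof (intro conjI ballI allI impI)
    fix x assume x: "x \<in> {a<..<b}"
    have "(v \<longlongrightarrow> v x) (at_left x)"
      using continuous_on_interior[OF vc, of x] x
      by (auto simp: isCont_def intro: filterlim_mono[OF _ order_refl at_le])
    then show "continuous (at_left x) v" by (simp add: continuous_within)
  next
    fix c d assume "a < c \<and> c \<le> d \<and> d < b"
    then have cd: "a < c" "c \<le> d" "d < b" by auto
    have vcd: "ac_deriv c d v w" by (rule ac_sub[OF v]) (use cd in auto)
    have wi: "set_integrable lborel {c..d} w" by (rule set_integrable_lborel_borel[OF w(1) ac_derivD(1)[OF vcd]])
    show "bounded_variation_on v c d" by (rule bounded_variation_dominated[where m = J]) (use vJ cd in auto)
    show "signed_set_integrable (borel_of a b) (measure lborel) {c..d} w" using wi signed_lborel(1)[OF cd(1,3)] by simp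
    show "v d - v c = signed_set_integral (borel_of a b) (measure lborel) {c..<d} w"
      unfolding signed_lborel(2)[OF cd(1,3)] set_integral_lborel_Ico(1)[OF wi] 
      by (rule ac_diff[OF v]) (use cd in auto)
  qed
  have "AE x in leb_on a b. w0 x = w x" using w(2) by (simp add: AE_leb_on_iff)
  then have g: "AE x in leb_on a b. g x = - w x + of_real (q x) * u x"
    using 2(2) by eventually_elim (simp add: u_def)
  have ua: "(u \<longlongrightarrow> 0) (at_right a)"
    unfolding u_def using tendsto_add[OF cont_ends(1)[OF oc] F_mult_limits(1)[OF vc]] 1(3) by simp
  have ub: "(u \<longlongrightarrow> 0) (at_left b)"
    unfolding u_def using tendsto_add[OF cont_ends(2)[OF oc] F_mult_limits(2)[OF vc]] 1(4) by simp
  have "AE x in leb_on a b. f x = u x" using 2(1) by (simp add: u_def)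
  then show "(f, g) \<in> dirichlet_operator a b P q"
    unfolding dirichlet_operator_def using f2 U W g ua ub by blast
qed

text \<open>The issue is regularity up to the end points. The boundary limits and local bounded
  variation make \<open>u\<close> bounded, so \<open>w = q u - g\<close> is integrable on the whole
  interval and \<open>v\<close> extends continuously. Integration by parts gives
  \<open>u = \<omega> + F v + k\<close> with a constant \<open>k\<close>, which the limit at
  \<open>a\<close> shows to be zero.\<close>

lemma dirichlet_operator_supset: "dirichlet_operator a b P q \<subseteq> dirichlet"
proof safe
  fix f g assume fg: "(f, g) \<in> dirichlet_operator a b P q"
  obtain u v w where f2: "f \<in> L2 (leb_on a b)" "g \<in> L2 (leb_on a b)"
    and fu: "AE x in leb_on a b. f x = u x"
    and U: "loc_abs_cont a b P u v" and W: "loc_abs_cont a b (measure lborel) v w"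
    and gw: "AE x in leb_on a b. g x = - w x + of_real (q x) * u x"
    and ua: "(u \<longlongrightarrow> 0) (at_right a)" and ub: "(u \<longlongrightarrow> 0) (at_left b)"
    using fg unfolding dirichlet_operator_def by blast
  obtain B where B: "\<And>x. x \<in> {a<..<b} \<Longrightarrow> cmod (u x) \<le> B"
  proof -
    have "\<forall>\<^sub>F x in at_right a. dist (u x) 0 < 1" "\<forall>\<^sub>F x in at_left b. dist (u x) 0 < 1"
      using tendstoD[OF ua] tendstoD[OF ub] by auto
    then obtain c d where c: "a < c" "\<And>x. a < x \<Longrightarrow> x < c \<Longrightarrow> cmod (u x) < 1" 
      and d: "d < b" "\<And>x. d < x \<Longrightarrow> x < b \<Longrightarrow> cmod (u x) < 1"
      using a_less_b by (auto simp: eventually_at_right[OF a_less_b] eventually_at_left[OF a_less_b])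
    \<comment> \<open>The midpoint separates the two neighbourhoods, so that
      \<open>c' \<le> d'\<close>.\<close>
    define c' where "c' = min c ((a + b) / 2)"
    define d' where "d' = max d ((a + b) / 2)"
    have cd: "a < c'" "c' \<le> d'" "d' < b" "c' \<le> c" "d \<le> d'" using a_less_b c(1) d(1) by (auto simp: c'_def d'_def)
    have "bounded_variation_on u c' d'" using U cd unfolding loc_abs_cont_def by blast
    then obtain B0 where B0: "\<And>x. x \<in> {c'..d'} \<Longrightarrow> cmod (u x) \<le> B0" using bounded_variation_bounded by blast
    have "cmod (u x) \<le> max 1 B0" if "x \<in> {a<..<b}" for x
    proof -
      consider "x < c'" | "x \<in> {c'..d'}" | "d' < x" by fastforce
      then show ?thesis
      proof cases
        case 1 then show ?thesis using c(2)[of x] that cd by auto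
      next
        case 2 then show ?thesis using B0[of x] by auto
      next
        case 3 then show ?thesis using d(2)[of x] that cd by auto
      qed
    qed
    then show ?thesis using that by blast
  qed
  have wi: "w absolutely_integrable_on {a..b}"
  proof -
    have gi: "integrable (leb_on a b) g" using L2_abs_int[OF f2(2)] by (simp add: abs_int_leb_on_iff)
    have "integrable (leb_on a b) (\<lambda>x. of_real (q x) * f x - g x)"
    proof (rule Bochner_Integration.integrable_bound)
      show "integrable (leb_on a b) (\<lambda>x. B * \<bar>q x\<bar> + cmod (g x))" using q_leb gi by auto
      have "f \<in> borel_measurable (leb_on a b)" "g \<in> borel_measurable (leb_on a b)" "q \<in> borel_measurable (leb_on a b)"
        using f2 q_leb by (auto simp: L2_def)
      then show "(\<lambda>x. of_real (q x) * f x - g x) \<in> borel_measurable (leb_on a b)" by measurable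
      have "AE x in leb_on a b. x \<in> {a<..<b}" by (rule AE_I2) simp
      then show "AE x in leb_on a b. cmod (of_real (q x) * f x - g x) \<le> norm (B * \<bar>q x\<bar> + cmod (g x))"
        using fu
      proof eventually_elim
        case (elim x)
        have "cmod (of_real (q x) * f x - g x) \<le> \<bar>q x\<bar> * cmod (f x) + cmod (g x)"
          using norm_triangle_ineq4[of "of_real (q x) * f x" "g x"] by (simp add: norm_mult)
        also have "\<dots> \<le> \<bar>q x\<bar> * B + cmod (g x)"
          using B[OF elim(1)] elim(2) by (intro add_right_mono mult_left_mono) auto
        finally show ?case by (simp add: mult.commute)
      qed
    qed
    then have 1: "(\<lambda>x. of_real (q x) * f x - g x) absolutely_integrable_on {a..b}" by (simp add: abs_int_leb_on_iff)
    have "AE x in leb_on a b. of_real (q x) * f x - g x = w x"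
      using fu gw by eventually_elim simp
    then show ?thesis using abs_int_AE_cong(1)[OF 1] by (simp add: AE_leb_on_iff)
  qed
  define e where "e = (a + b) / 2"
  have e: "a < e" "e < b" using a_less_b by (auto simp: e_def)
  \<comment> \<open>The continuous extension of \<open>v\<close> to the closed interval, anchored at
    the midpoint because \<open>v\<close> is meaningful only inside.\<close>
  define v1 where "v1 x = (v e - integral {a..e} w) + integral {a..x} w" for x
  have v1: "ac_deriv a b v1 w" unfolding v1_def by (rule ac_integral[OF wi])
  have v1v: "v1 x = v x" if "x \<in> {a<..<b}" for x
  proof (cases "e \<le> x")
    case True
    have "v x - v e = integral {e..x} w"
      by (rule ac_diff[OF loc_abs_cont_lborelD[OF e(1) True _ W]]) (use that True in auto)
    also have "\<dots> = integral {a..x} w - integral {a..e} w"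
      by (rule abs_int_integral_diff[OF wi, symmetric]) (use that True e in auto)
    finally show ?thesis by (simp add: v1_def algebra_simps)
  next
    case False
    have "v e - v x = integral {x..e} w"
      by (rule ac_diff[OF loc_abs_cont_lborelD[OF _ _ e(2) W]]) (use that False in auto)
    also have "\<dots> = integral {a..e} w - integral {a..x} w"
      by (rule abs_int_integral_diff[OF wi, symmetric]) (use that False e in auto)
    finally show ?thesis by (simp add: v1_def algebra_simps)
  qed
  have Fwi: "(\<lambda>s. - of_real (F s) * w s) absolutely_integrable_on {a..b}"
    using set_integrable_mult_right[OF F_mult_abs_int[OF wi], of "-1"] by simp
  define o1 where "o1 x = 0 + integral {a..x} (\<lambda>s. - of_real (F s) * w s)" for x
  have o1: "ac_deriv a b o1 (\<lambda>s. - of_real (F s) * w s)" unfolding o1_def by (rule ac_integral[OF Fwi])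
  have o1a: "o1 a = 0" by (simp add: o1_def)
  have inc: "u d - u c = (o1 d + of_real (F d) * v1 d) - (o1 c + of_real (F c) * v1 c)" if cd: "a < c" "c \<le> d" "d < b" for c d
  proof -
    have "u d - u c = signed_set_integral (borel_of a b) P {c..<d} v" using U cd unfolding loc_abs_cont_def by blast
    also have "\<dots> = v d * of_real (F d) - v c * of_real (F c) - integral {c..d} (\<lambda>x. of_real (F x) * w x)"
      by (rule signed_by_parts(2)[OF cd loc_abs_cont_lborelD[OF cd W]])
    also have "integral {c..d} (\<lambda>x. of_real (F x) * w x) = - (o1 d - o1 c)"
      using ac_diff[OF o1, of c d] cd by simp
    finally show ?thesis using v1v[of c] v1v[of d] cd by (simp add: algebra_simps)
  qed
  define k where "k = u e - (o1 e + of_real (F e) * v1 e)"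
  have uk: "u x = o1 x + of_real (F x) * v1 x + k" if "x \<in> {a<..<b}" for x
  proof (cases "e \<le> x")
    case True then show ?thesis using inc[of e x] that e by (simp add: k_def algebra_simps)
  next
    case False then show ?thesis using inc[of x e] that e by (simp add: k_def algebra_simps)
  qed
  note vc = ac_continuous[OF v1] and oc = ac_continuous[OF o1]
  have k0: "k = 0"
  proof -
    have "((\<lambda>x. o1 x + of_real (F x) * v1 x + k) \<longlongrightarrow> 0 + 0 + k) (at_right a)"
      using cont_ends(1)[OF oc] by (intro tendsto_add F_mult_limits(1)[OF vc] tendsto_const) (simp add: o1a)
    moreover have "\<forall>\<^sub>F x in at_right a. o1 x + of_real (F x) * v1 x + k = u x"
      unfolding eventually_at_right[OF a_less_b] using uk a_less_b by (intro exI[of _ b]) auto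
    ultimately have "(u \<longlongrightarrow> 0 + 0 + k) (at_right a)" by (rule Lim_transform_eventually)
    from tendsto_unique[OF _ this ua] show ?thesis by (simp add: trivial_limit_at_right_real)
  qed
  have bc: "o1 b + of_real (F b) * v1 b = 0"
  proof -
    have "((\<lambda>x. o1 x + of_real (F x) * v1 x) \<longlongrightarrow> o1 b + of_real (F b) * v1 b) (at_left b)"
      by (intro tendsto_add F_mult_limits(2)[OF vc] cont_ends(2)[OF oc])
    moreover have "\<forall>\<^sub>F x in at_left b. o1 x + of_real (F x) * v1 x = u x"
      unfolding eventually_at_left[OF a_less_b] using uk k0 a_less_b by (intro exI[of _ a]) auto
    ultimately have "(u \<longlongrightarrow> o1 b + of_real (F b) * v1 b) (at_left b)" by (rule Lim_transform_eventually)
    from tendsto_unique[OF _ this ub] show ?thesis by (simp add: trivial_limit_at_left_real)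
  qed
  have I: "AE x in leb_on a b. x \<in> {a<..<b}" by (rule AE_I2) simp
  have "AE x in leb_on a b. f x = o1 x + of_real (F x) * v1 x"
    using I fu by eventually_elim (use uk k0 in auto)
  moreover have "AE x in leb_on a b. g x = - w x + of_real (q x) * (o1 x + of_real (F x) * v1 x)"
    using I gw by eventually_elim (use uk k0 in auto)
  ultimately show "(f, g) \<in> dirichlet" unfolding dirichlet_def using f2 o1 v1 o1a bc by blast
qed

lemma dirichlet_operator_eq: "dirichlet_operator a b P q = dirichlet"
  using dirichlet_operator_subset dirichlet_operator_supset by blast

end

theorem lemma7p1:
  fixes a b :: real and \<nu> :: "real set \<Rightarrow> real" and q :: "real \<Rightarrow> real"
  assumes "a < b"
    and "finite_signed_measure (borel_of a b) \<nu>"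
    and "lebesgue_singular a b \<nu>"
    and "integrable (leb_on a b) q"
  defines "P \<equiv> \<lambda>A. measure lborel A + \<nu> A"
  defines "H \<equiv> dirichlet_operator a b P q"
  defines "N \<equiv> \<lambda>t. real (eigenvalue_count (leb_on a b) H t)"
  shows "purely_discrete_spectrum (leb_on a b) H \<and>
    (\<forall>t. finite (eigenvalues_between (leb_on a b) H t)) \<and>
    (\<lambda>t. N t - (b - a) / pi * sqrt t) \<in> o[at_top](\<lambda>t. sqrt t) \<and>
    N \<in> o[at_bot](\<lambda>t. sqrt \<bar>t\<bar>)"
proof -
  interpret D: dirichlet_data a b \<nu> q by (rule dirichlet_data.intro[OF assms(1-4)])
  have "H = D.dirichlet"
    unfolding H_def P_def D.dirichlet_operator_eq[symmetric] D.P_def[abs_def] ..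
  then show ?thesis
    using D.purely_discrete_dirichlet D.eigenvalue_count_angle(1) D.count_asymptotics by (simp add: N_def)
qed

end
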